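(* Let $a\ge0$, $q:[a,\infty)\to\mathbb C$, $\phi\in(-\frac\pi2,\frac\pi2)$, $p:=e^{-2i\phi}$, let $Q:=\overline{\mathrm{co}}\{q(x)+rp:0<r<\infty,\ x\in[a,\infty)\}$ and let $\lambda\in\mathbb C\setminus Q$. Assume that $q,q'\in \mathrm{AC}_{\mathrm{loc}}[a,\infty)$ and $$\int_a^\infty\left|\frac{5(e^{2i\phi}q'(x))^2}{16(e^{2i\phi}(q(x)-\lambda))^{5/2}}-\frac{e^{2i\phi}q''(x)}{4(e^{2i\phi}(q(x)-\lambda))^{3/2}}\right|dx<\infty.$$ Put $s_\lambda:=p^{-1}(q-\lambda)$. In addition assume that $\lim_{x\to\infty}|q(x)|=\infty$ and that the limits $$q_0:=\lim_{x\to\infty}\frac{\operatorname{Re}q(x)^{1/2}}{|q(x)|^{1/2}},\qquad \sigma:=\lim_{x\to\infty}\frac{\operatorname{Re}s_\lambda(x)^{1/2}}{|s_\lambda(x)|^{1/2}}$$ exist. If $\sigma=0$ (or equivalently, $q_0=\sin\phi$), then $\operatorname{Im}[s_\lambda(x)^{1/2}]\to\pm\infty$ (that is, it tends to $+\infty$ or to $-\infty$) as $x\to\infty$, and for any $\lambda\notin Q$ the only admissible angles $\theta$ such that $\operatorname{Re}[e^{i\theta}(z-K)]\ge0$ for all $z\in Q$, where $K$ is the point of $Q$ nearest to $\lambda$, are $\theta=\pm\frac\pi2+2\phi$. The Weyl classification at $\infty$ of the equation $$-e^{-2i\phi}v''(x)+q(x)v(x)=\lambda v(x),\qquad x\in[a,\infty),$$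 is then (i) limit point case I if $\sigma\ne0$; (ii) limit point case I if $\sigma=0$ and $\displaystyle\frac{e^{2\int_a^x\operatorname{Re}[s_\lambda(t)^{1/2}]\,dt}}{\operatorname{Im}[s_\lambda(x)^{1/2}]}\notin L^1[a,\infty)$; (iii) limit point case II if $\sigma=0$, $\operatorname{Re}[s_\lambda^{1/2}]\notin L^1[a,\infty)$ and $\displaystyle\frac{e^{2\int_a^x\operatorname{Re}[s_\lambda(t)^{1/2}]\,dt}}{\operatorname{Im}[s_\lambda(x)^{1/2}]}\in L^1[a,\infty)$; (iv) limit circle case if $\sigma=0$, $\operatorname{Re}[s_\lambda^{1/2}]\in L^1[a,\infty)$ and $(\operatorname{Im}[s_\lambda^{1/2}])^{-1}\in L^1[a,\infty)$. The classification is independent of $\lambda\notin Q$.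
   Context: $\overline{\mathrm{co}}(A)$ is the closed convex hull of $A\subset\mathbb C$. The $n$th root of $z=re^{i\arg(z)}$ with $-\pi<\arg z\le\pi$ is $z^{1/n}=r^{1/n}e^{i\arg(z)/n}$. $\mathrm{AC}_{\mathrm{loc}}$ means absolutely continuous on each compact subinterval. A solution is a function $v$ with $v,v'$ locally absolutely continuous satisfying the equation for almost all $x$; the endpoint $a$ is regular. Classification (Sims; Brown et al.), specialised to leading coefficient $p=e^{-2i\phi}$ and weight $w=1$, assuming $Q\neq\mathbb C$. Let $S$ be the set of pairs $(\theta,K)\in\mathbb R\times\mathbb C$ with $\operatorname{Re}[e^{i\theta}(z-K)]\ge0$ for all $z\in Q$, and $\Lambda_{K,\theta}:=\{z\in\mathbb C:\operatorname{Re}[e^{i\theta}(z-K)]<0\}$. (For $\lambda\notin Q$ one takes $K$ to be the point of $Q$ nearest to $\lambda$; then there is $\theta$ with $(\theta,K)\in S$.) Given $(\theta,K)\in S$ and $\lambda\in\Lambda_{K,\theta}$, consider for solutions $v$ of $-e^{-2i\phi}v''+qv=\lambda v$ the condition $$\int_a^\infty\operatorname{Re}(e^{i\theta}e^{-2i\phi})|v'|^2\,dt+\int_a^\infty\operatorname{Re}[e^{i\theta}(q-K)]|v|^2\,dt+\int_a^\infty|v|^2\,dt<\infty.\tag{C}$$ Exactly one of the following cases holds: (1) limit point I case: up to a multiplicative constant there is only one solution satisfying (C), and this is the only solution in $L^2(a,\infty)$; (2) limit point II case: all solutions are in $L^2(a,\infty)$ but, up to a multiplicative constant, only one solution satisfies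 (C); (3) limit circle case: all solutions are in $L^2(a,\infty)$ and all satisfy (C). It is known that if all solutions are in $L^2(a,\infty)$ for some $\lambda_0\in\mathbb C$, then the same is true for all $\lambda\in\mathbb C$; and if all solutions satisfy (C) for some $\lambda_0\in\Lambda_{K,\theta}$, then the same is true for all $\lambda\in\mathbb C$.
   Formalization: The parenthetical "or equivalently, q_0 = sin φ" is false as printed (φ=π/4, q=-ix², a=1, λ=1 gives q_0=sin φ but σ=1); it is replaced by: σ=0 iff q_0=|sin φ| and φ·Im q(x) ≥ 0 for all large x. Angles θ are read modulo 2π. *)

theory Defs
  imports "HOL-Analysis.Analysis"
begin

definition abs_cont_on :: "real \<Rightarrow> real \<Rightarrow> (real \<Rightarrow> 'a::real_normed_vector) \<Rightarrow> bool" where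
  "abs_cont_on c d f \<longleftrightarrow>
     (\<forall>e>0. \<exists>r>0. \<forall>D::(real \<times> real) set.
        finite D \<longrightarrow>
        (\<forall>I\<in>D. c \<le> fst I \<and> fst I \<le> snd I \<and> snd I \<le> d) \<longrightarrow>
        pairwise (\<lambda>I J. {fst I<..<snd I} \<inter> {fst J<..<snd J} = {}) D \<longrightarrow>
        (\<Sum>I\<in>D. snd I - fst I) < r \<longrightarrow>
        (\<Sum>I\<in>D. norm (f (snd I) - f (fst I))) < e)"

definition AC_loc :: "real \<Rightarrow> (real \<Rightarrow> 'a::real_normed_vector) \<Rightarrow> bool" where
  "AC_loc a f \<longleftrightarrow> (\<forall>c d. a \<le> c \<longrightarrow> c \<le> d \<longrightarrow> abs_cont_on c d f)"

text \<open>Functions on $[a,\infty)$ are total functions whose values on $(-\infty,a)$ are never used;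
  derivatives are taken within $[a,\infty)$, hence are one-sided at $a$.\<close>

definition AC1_loc ::
    "real \<Rightarrow> (real \<Rightarrow> complex) \<Rightarrow> (real \<Rightarrow> complex) \<Rightarrow> (real \<Rightarrow> complex) \<Rightarrow> bool" where
  "AC1_loc a f f' f'' \<longleftrightarrow> AC_loc a f \<and> AC_loc a f' \<and>
     (\<forall>x\<ge>a. (f has_vector_derivative f' x) (at x within {a..})) \<and>
     (AE x in lebesgue. x \<ge> a \<longrightarrow> (f' has_vector_derivative f'' x) (at x within {a..}))"

text \<open>The leading coefficient is $p = e^{-2i\phi}$.\<close>

definition lead :: "real \<Rightarrow> complex" where
  "lead \<phi> = cis (- 2 * \<phi>)"

definition Qset :: "real \<Rightarrow> real \<Rightarrow> (real \<Rightarrow> complex) \<Rightarrow> complex set" where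
  "Qset a \<phi> q = closure (convex hull {q x + of_real r * lead \<phi> | x r. a \<le> x \<and> 0 < r})"

definition admissible :: "complex set \<Rightarrow> (real \<times> complex) set" where
  "admissible Q = {(\<theta>, K). \<forall>z\<in>Q. 0 \<le> Re (cis \<theta> * (z - K))}"

definition half_plane :: "complex \<Rightarrow> real \<Rightarrow> complex set" where
  "half_plane K \<theta> = {z. Re (cis \<theta> * (z - K)) < 0}"

definition s_fun :: "real \<Rightarrow> (real \<Rightarrow> complex) \<Rightarrow> complex \<Rightarrow> real \<Rightarrow> complex" where
  "s_fun \<phi> q lam x = inverse (lead \<phi>) * (q x - lam)"

definition solution ::
    "real \<Rightarrow> real \<Rightarrow> (real \<Rightarrow> complex) \<Rightarrow> complex \<Rightarrow> (real \<Rightarrow> complex) \<Rightarrow> bool" where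
  "solution a \<phi> q lam v \<longleftrightarrow>
     (\<exists>v' v''. AC1_loc a v v' v'' \<and>
        (AE x in lebesgue. x \<ge> a \<longrightarrow> - lead \<phi> * v'' x + q x * v x = lam * v x))"

definition in_L2 :: "real \<Rightarrow> (real \<Rightarrow> complex) \<Rightarrow> bool" where
  "in_L2 a v \<longleftrightarrow> (\<lambda>t. (cmod (v t))\<^sup>2) absolutely_integrable_on {a..}"

text \<open>Condition (C). The coefficients are nonnegative on $[a,\infty)$ whenever
  $(\theta,K)$ is admissible, so that \<^const>\<open>ennreal\<close> truncates nothing there.\<close>

definition cond_C ::
    "real \<Rightarrow> real \<Rightarrow> (real \<Rightarrow> complex) \<Rightarrow> real \<Rightarrow> complex \<Rightarrow> (real \<Rightarrow> complex) \<Rightarrow> bool" where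
  "cond_C a \<phi> q \<theta> K v \<longleftrightarrow>
     (\<integral>\<^sup>+t\<in>{a..}. ennreal (Re (cis \<theta> * lead \<phi>)
          * (cmod (vector_derivative v (at t within {a..})))\<^sup>2) \<partial>lebesgue)
   + (\<integral>\<^sup>+t\<in>{a..}. ennreal (Re (cis \<theta> * (q t - K)) * (cmod (v t))\<^sup>2) \<partial>lebesgue)
   + (\<integral>\<^sup>+t\<in>{a..}. ennreal ((cmod (v t))\<^sup>2) \<partial>lebesgue) < \<infinity>"

definition only_solution_with ::
    "real \<Rightarrow> real \<Rightarrow> (real \<Rightarrow> complex) \<Rightarrow> complex \<Rightarrow> ((real \<Rightarrow> complex) \<Rightarrow> bool)
      \<Rightarrow> (real \<Rightarrow> complex) \<Rightarrow> bool" where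
  "only_solution_with a \<phi> q lam P v \<longleftrightarrow>
     solution a \<phi> q lam v \<and> (\<exists>x\<ge>a. v x \<noteq> 0) \<and> P v \<and>
     (\<forall>w. solution a \<phi> q lam w \<and> P w \<longrightarrow> (\<exists>c. \<forall>x\<ge>a. w x = c * v x))"

definition limit_point_I ::
    "real \<Rightarrow> real \<Rightarrow> (real \<Rightarrow> complex) \<Rightarrow> complex \<Rightarrow> real \<Rightarrow> complex \<Rightarrow> bool" where
  "limit_point_I a \<phi> q lam \<theta> K \<longleftrightarrow>
     (\<exists>v. only_solution_with a \<phi> q lam (cond_C a \<phi> q \<theta> K) v \<and>
          only_solution_with a \<phi> q lam (in_L2 a) v)"

definition limit_point_II ::
    "real \<Rightarrow> real \<Rightarrow> (real \<Rightarrow> complex) \<Rightarrow> complex \<Rightarrow> real \<Rightarrow> complex \<Rightarrow> bool" where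
  "limit_point_II a \<phi> q lam \<theta> K \<longleftrightarrow>
     (\<forall>v. solution a \<phi> q lam v \<longrightarrow> in_L2 a v) \<and>
     (\<exists>v. only_solution_with a \<phi> q lam (cond_C a \<phi> q \<theta> K) v)"

definition limit_circle ::
    "real \<Rightarrow> real \<Rightarrow> (real \<Rightarrow> complex) \<Rightarrow> complex \<Rightarrow> real \<Rightarrow> complex \<Rightarrow> bool" where
  "limit_circle a \<phi> q lam \<theta> K \<longleftrightarrow>
     (\<forall>v. solution a \<phi> q lam v \<longrightarrow> in_L2 a v \<and> cond_C a \<phi> q \<theta> K v)"

end

(*
  Write the equation as v'' = s v with s = (q - lam) / p. Since lam is not in Q, s avoids the cut
  (-oo, 0], and the integrability hypothesis is the Liouville-Green condition: some solution grows
  like s^(-1/4) exp (int s^(1/2)), and every solution is bounded by a multiple of this function.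
  Hence all solutions are square integrable for a weight W iff W exp (2 int Re s^(1/2)) / |s|^(1/2)
  is integrable. Weyl's nesting argument yields a nonzero solution satisfying (C), so the
  classification depends only on whether all solutions are in L^2 and whether all satisfy (C).
  If sigma = 0, then q / |q| tends to -p, which forces Re (e^(i theta) p) = 0 for every admissible
  theta; then (C) means square integrability for the weight |Im s| = 2 Re s^(1/2) |Im s^(1/2)|, and
  |Im s| exp (2 int Re s^(1/2)) / |s|^(1/2) is comparable to the derivative of exp (2 int Re s^(1/2)).
  If sigma is nonzero, the growing solution is not in L^2. Variation of constants gives independence
  of lam.
*)
theory Submission
  imports Defs
begin

section \<open>Absolutely continuous functions\<close>


text \<open>Since q'' exists only almost everywhere, the Liouville-Green estimates rest on an
  almost-everywhere derivative of an absolutely continuous function; the fundamental theorem for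
  such functions, proved directly for the gauge integral, turns it into an integral identity. No
  recessive solution is built from the asymptotics: if Re s^(1/2) is integrable, both
  Liouville-Green functions have comparable modulus. Testing all solutions against a weight needs
  only an upper bound for every solution and a lower bound for one. Condition (C) depends on (theta,
  K), while the integrability criteria mention only s. The link is that Re (e^(i theta) p) = 0
  forces e^(i theta) p = i or -i, so that Re (e^(i theta) (q - lam)) = |Im s| when lam lies in the
  open half plane; replacing lam by K shifts this by a constant, which the summand 1 in the weight
  absorbs. The change of spectral parameter must respect weights as well. It does, because solutions
  of the shifted equation are eventually dominated pointwise by the fundamental solutions once these
  are square integrable.\<close>

lemma abs_cont_onE:
  assumes "abs_cont_on c d f" "e > 0"
  obtains r where "r > 0"
    and "\<And>D. finite D \<Longrightarrow> (\<And>I. I \<in> D \<Longrightarrow> c \<le> fst I \<and> fst I \<le> snd I \<and> snd I \<le> d) \<Longrightarrow>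
        pairwise (\<lambda>I J. {fst I<..<snd I} \<inter> {fst J<..<snd J} = {}) D \<Longrightarrow>
        (\<Sum>I\<in>D. snd I - fst I) < r \<Longrightarrow> (\<Sum>I\<in>D. norm (f (snd I) - f (fst I))) < e"
proof -
  obtain r where "r > 0" and r: "\<forall>D. finite D \<longrightarrow> (\<forall>I\<in>D. c \<le> fst I \<and> fst I \<le> snd I \<and> snd I \<le> d) \<longrightarrow>
        pairwise (\<lambda>I J. {fst I<..<snd I} \<inter> {fst J<..<snd J} = {}) D \<longrightarrow>
        (\<Sum>I\<in>D. snd I - fst I) < r \<longrightarrow> (\<Sum>I\<in>D. norm (f (snd I) - f (fst I))) < e"
    using assms(1)[unfolded abs_cont_on_def, rule_format, OF assms(2)] by (elim exE conjE)
  show thesis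
    by (rule that[OF \<open>r > 0\<close>]) (intro r[rule_format])
qed

text \<open>Tags outside N contribute an error of at most \<epsilon> times the length, by
  differentiability at the tag. For tags in N the gauge keeps the intervals inside an open set U of
  measure less than r that contains N, so their total length is small and absolute continuity bounds
  the sum of the increments of f.\<close>

theorem abs_cont_on_has_integral:
  fixes f :: "real \<Rightarrow> 'a::real_normed_vector"
  assumes "c \<le> d" and ac: "abs_cont_on c d f" and N: "negligible N"
    and der: "\<And>x. x \<in> {c..d} - N \<Longrightarrow> (f has_vector_derivative g x) (at x within {c..d})"
  shows "(g has_integral (f d - f c)) {c..d}"
proof -
  \<comment> \<open>The values of \<open>g\<close> on \<open>N\<close> are arbitrary; setting them
    to 0 leaves only increments of \<open>f\<close> at tags in \<open>N\<close>.\<close>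
  define h where "h x = (if x \<in> N then 0 else g x)" for x
  have "(h has_integral (f d - f c)) {c..d}"
    unfolding has_integral_real
  proof (intro allI impI)
    fix e :: real
    assume "e > 0"
    \<comment> \<open>The summand 1 keeps the denominator positive when c = d.\<close>
    define \<epsilon> where "\<epsilon> = e / (2 * (d - c + 1))"
    have "\<epsilon> > 0"
      using \<open>e > 0\<close> \<open>c \<le> d\<close> by (simp add: \<epsilon>_def)
    have \<epsilon>: "\<epsilon> * (d - c) < e / 2"
      using \<open>e > 0\<close> \<open>c \<le> d\<close> by (simp add: \<epsilon>_def field_simps)
    obtain r where "r > 0" and r: "\<And>D. finite D \<Longrightarrow> (\<And>I. I \<in> D \<Longrightarrow> c \<le> fst I \<and> fst I \<le> snd I \<and> snd I \<le> d) \<Longrightarrow>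
        pairwise (\<lambda>I J. {fst I<..<snd I} \<inter> {fst J<..<snd J} = {}) D \<Longrightarrow>
        (\<Sum>I\<in>D. snd I - fst I) < r \<Longrightarrow> (\<Sum>I\<in>D. norm (f (snd I) - f (fst I))) < e / 2"
      using abs_cont_onE[OF ac half_gt_zero[OF \<open>e > 0\<close>]] by blast
    have "N \<in> sets lebesgue"
      using N negligible_imp_sets by blast
    then obtain U where U: "open U" "N \<subseteq> U" "U - N \<in> lmeasurable" "emeasure lebesgue (U - N) < ennreal r"
      using sets_lebesgue_outer_open \<open>r > 0\<close> by blast
    have UN: "measure lebesgue (U - N) < r"
      using U \<open>r > 0\<close> by (simp add: emeasure_eq_measure2 ennreal_less_iff)
    have Un: "U = (U - N) \<union> N"
      using U by blast
    have Um: "U \<in> lmeasurable"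
      using fmeasurable.Un[OF U(3) negligible_imp_measurable[OF N]] Un by simp
    have "measure lebesgue U \<le> measure lebesgue (U - N) + measure lebesgue N"
      using measure_Un_le[of "U - N" lebesgue N] U(3) \<open>N \<in> sets lebesgue\<close> Un fmeasurableD by metis
    then have Ur: "measure lebesgue U < r"
      using UN negligible_imp_measure0[OF N] by simp
    define ok where "ok x \<delta> \<longleftrightarrow> \<delta> > 0 \<and> (x \<in> N \<longrightarrow> ball x \<delta> \<subseteq> U) \<and> (x \<in> {c..d} - N \<longrightarrow>
         (\<forall>y\<in>{c..d}. norm (y-x) < \<delta> \<longrightarrow> norm (f y - f x - (y-x) *\<^sub>R g x) \<le> \<epsilon> * norm (y-x)))"
      for x \<delta>
    have "\<exists>\<delta>. ok x \<delta>" for x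
    proof (cases "x \<in> {c..d} - N")
      case True
      then show ?thesis
        using der[OF True] \<open>\<epsilon> > 0\<close> unfolding ok_def has_vector_derivative_def has_derivative_within_alt
        by blast
    next
      case False
      show ?thesis
      proof (cases "x \<in> N")
        case True
        with U(2) have "x \<in> U" by blast
        with openE[OF U(1)] obtain \<delta> where "\<delta> > 0" "ball x \<delta> \<subseteq> U" by blast
        with True show ?thesis unfolding ok_def by blast
      next
        case n: False
        with False show ?thesis unfolding ok_def by (intro exI[of _ 1]) auto
      qed
    qed
    then obtain \<delta> where ok: "\<And>x. ok x (\<delta> x)"
      using choice[of ok] by blast
    have \<delta>: "\<And>x. \<delta> x > 0" "\<And>x. x \<in> N \<Longrightarrow> ball x (\<delta> x) \<subseteq> U"
      "\<And>x y. x \<in> {c..d} - N \<Longrightarrow> y \<in> {c..d} \<Longrightarrow> norm (y-x) < \<delta> x \<Longrightarrow>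
           norm (f y - f x - (y-x) *\<^sub>R g x) \<le> \<epsilon> * norm (y-x)"
      using ok unfolding ok_def by blast+
    show "\<exists>\<gamma>. gauge \<gamma> \<and> (\<forall>p. p tagged_division_of {c..d} \<and> \<gamma> fine p \<longrightarrow>
           norm ((\<Sum>(x,k)\<in>p. measure lborel k *\<^sub>R h x) - (f d - f c)) < e)"
    proof (intro exI conjI allI impI)
      show "gauge (\<lambda>x. ball x (\<delta> x))"
        using \<delta>(1) gauge_ball_dependent by blast
      fix p
      assume *: "p tagged_division_of {c..d} \<and> (\<lambda>x. ball x (\<delta> x)) fine p"
      note p = conjunct1[OF *] and fine = conjunct2[OF *]
      have "finite p"
        using p by (rule tagged_division_ofD(1))
      have int: "\<exists>u v. K = {u..v} \<and> u \<le> x \<and> x \<le> v \<and> c \<le> u \<and> v \<le> d \<and> Inf K = u \<and> Sup K = v"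
        if xK: "(x, K) \<in> p" for x K
      proof -
        obtain u v where "K = cbox u v"
          using tagged_division_ofD(4)[OF p xK] by blast
        with tagged_division_ofD(2,3)[OF p xK] show ?thesis by (intro exI[of _ u] exI[of _ v]) auto
      qed
      define T where "T = (\<lambda>(x, K). measure lborel K *\<^sub>R h x - (f (Sup K) - f (Inf K)))"
      define A where "A = {z \<in> p. fst z \<in> N}"
      \<comment> \<open>Degenerate intervals are removed: two tags may share the same one-point
        interval only by having empty interiors, and then \<open>\<pi>\<close> would not be
        injective.\<close>
      define A' where "A' = {z \<in> A. Inf (snd z) < Sup (snd z)}"
      have fin: "finite A" "finite A'" "finite (p - A)"
        using \<open>finite p\<close> by (auto simp: A_def A'_def)
      have "(\<Sum>(x,k)\<in>p. measure lborel k *\<^sub>R h x) - (f d - f c) = sum T p"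
        using additive_tagged_division_1[OF \<open>c \<le> d\<close> p, of f]
        by (simp add: T_def split_def sum_subtractf)
      also have "\<dots> = sum T A + sum T (p - A)"
        by (metis (no_types, lifting) A_def \<open>finite p\<close> add.commute mem_Collect_eq subsetI sum.subset_diff)
      finally have eq: "(\<Sum>(x,k)\<in>p. measure lborel k *\<^sub>R h x) - (f d - f c) = sum T A + sum T (p - A)" .
      have "norm (sum T (p - A)) \<le> (\<Sum>z\<in>p - A. \<epsilon> * (Sup (snd z) - Inf (snd z)))"
      proof (rule sum_norm_le, clarify)
        fix x K
        assume xK: "(x, K) \<in> p" "(x, K) \<notin> A"
        then obtain u v where K: "K = {u..v}" "u \<le> x" "x \<le> v" "c \<le> u" "v \<le> d" "Inf K = u" "Sup K = v"
          using int by blast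
        have "x \<notin> N"
          using xK by (auto simp: A_def)
        have "K \<subseteq> ball x (\<delta> x)"
          using fine xK by blast
        moreover have "u \<in> K" "v \<in> K"
          using K by auto
        ultimately have "u \<in> ball x (\<delta> x)" "v \<in> ball x (\<delta> x)"
          by blast+
        then have uv: "norm (u - x) < \<delta> x" "norm (v - x) < \<delta> x"
          by (auto simp: dist_real_def)
        have "norm ((v - u) *\<^sub>R g x - (f v - f u))
            = norm ((f u - f x - (u - x) *\<^sub>R g x) - (f v - f x - (v - x) *\<^sub>R g x))"
          by (simp add: algebra_simps)
        also have "\<dots> \<le> norm (f u - f x - (u - x) *\<^sub>R g x) + norm (f v - f x - (v - x) *\<^sub>R g x)"
          by (rule norm_triangle_ineq4)
        also have "\<dots> \<le> \<epsilon> * norm (u - x) + \<epsilon> * norm (v - x)"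
          using K \<open>x \<notin> N\<close> uv by (intro add_mono \<delta>) auto
        also have "\<dots> = \<epsilon> * (v - u)"
          using K by (simp add: algebra_simps)
        finally show "norm (T (x, K)) \<le> \<epsilon> * (Sup (snd (x, K)) - Inf (snd (x, K)))"
          using K \<open>x \<notin> N\<close> by (simp add: T_def h_def)
      qed
      also have "\<dots> \<le> (\<Sum>z\<in>p. \<epsilon> * (Sup (snd z) - Inf (snd z)))"
      proof (rule sum_mono2)
        fix z
        assume "z \<in> p - (p - A)"
        then show "0 \<le> \<epsilon> * (Sup (snd z) - Inf (snd z))"
          using int[of "fst z" "snd z"] \<open>\<epsilon> > 0\<close> by force
      qed (use \<open>finite p\<close> in auto)
      also have "\<dots> = \<epsilon> * (d - c)"
        using additive_tagged_division_1[OF \<open>c \<le> d\<close> p, of "\<lambda>x. x"]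
        by (simp add: split_def flip: sum_distrib_left)
      finally have 1: "norm (sum T (p - A)) < e / 2"
        using \<epsilon> by linarith
      define \<pi> where "\<pi> z = (Inf (snd z), Sup (snd z))" for z :: "real \<times> real set"
      have A'p: "(x, K) \<in> A' \<Longrightarrow> (x, K) \<in> p" for x K
        by (auto simp: A'_def A_def)
      have disj: "{Inf K<..<Sup K} \<inter> {Inf K'<..<Sup K'} = {}"
        if xK: "(x, K) \<in> A'" "(x', K') \<in> A'" "(x, K) \<noteq> (x', K')" for x K x' K'
      proof -
        have "interior K \<inter> interior K' = {}"
          by (rule tagged_division_ofD(5)[OF p A'p[OF xK(1)] A'p[OF xK(2)] xK(3)])
        moreover obtain u v u' v' where "K = {u..v}" "Inf K = u" "Sup K = v"
            "K' = {u'..v'}" "Inf K' = u'" "Sup K' = v'"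
          using int[OF A'p[OF xK(1)]] int[OF A'p[OF xK(2)]] by blast
        ultimately show ?thesis
          by simp
      qed
      have inj: "inj_on \<pi> A'"
      proof (rule inj_onI)
        fix z z'
        assume z: "z \<in> A'" "z' \<in> A'" "\<pi> z = \<pi> z'"
        obtain x K x' K' where [simp]: "z = (x, K)" "z' = (x', K')"
          by (cases z, cases z')
        have "{Inf K<..<Sup K} \<noteq> {}"
          using z by (auto simp: A'_def)
        then show "z = z'"
          using disj[of x K x' K'] z by (auto simp: \<pi>_def)
      qed
      have lm: "snd z \<in> lmeasurable" if "z \<in> A'" for z
      proof -
        have "(fst z, snd z) \<in> p"
          using that by (simp add: A'_def A_def)
        from int[OF this] obtain u v where "snd z = cbox u v"
          unfolding cbox_interval by blast
        then show ?thesis by simp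
      qed
      \<comment> \<open>The intervals meet at most in endpoints, so their lengths add up to the
        measure of their union, and the union lies in \<open>U\<close>.\<close>
      have "(\<Sum>z\<in>A'. Sup (snd z) - Inf (snd z)) = (\<Sum>z\<in>A'. measure lebesgue (snd z))"
      proof (rule sum.cong)
        fix z
        assume "z \<in> A'"
        then have "(fst z, snd z) \<in> p"
          by (simp add: A'_def A_def)
        from int[OF this] obtain u v where "snd z = {u..v}" "u \<le> v" "Inf (snd z) = u" "Sup (snd z) = v"
          by (elim exE conjE) simp
        then show "Sup (snd z) - Inf (snd z) = measure lebesgue (snd z)"
          by simp
      qed simp
      also have "\<dots> = measure lebesgue (\<Union>(snd ` A'))"
      proof (rule measure_negligible_finite_Union_image[symmetric])
        show "snd z \<in> lmeasurable" if "z \<in> A'" for z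
          by (rule lm[OF that])
        show "pairwise (\<lambda>x y. negligible (snd x \<inter> snd y)) A'"
        proof (rule pairwiseI)
          fix z z'
          assume z: "z \<in> A'" "z' \<in> A'" "z \<noteq> z'"
          obtain x K x' K' where zz[simp]: "z = (x, K)" "z' = (x', K')"
            by (cases z, cases z')
          have "(x, K) \<in> p" "(x', K') \<in> p"
            using z A'p by auto
          from int[OF this(1)] int[OF this(2)]
          obtain u v u' v' where K: "K = {u..v}" "Inf K = u" "Sup K = v"
              "K' = {u'..v'}" "Inf K' = u'" "Sup K' = v'"
            by (elim exE conjE) blast
          have "{u<..<v} \<inter> {u'<..<v'} = {}"
            using disj[of x K x' K'] z unfolding K(2,3,5,6) by auto
          then have nott: "\<not> (u < t \<and> t < v \<and> u' < t \<and> t < v')" for t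
            by (metis IntI empty_iff greaterThanLessThan_iff)
          have "K \<inter> K' \<subseteq> {u, v, u', v'}"
          proof
            fix t
            assume "t \<in> K \<inter> K'"
            then show "t \<in> {u, v, u', v'}"
              using nott[of t] unfolding K(1,4) by (auto simp: order_less_le)
          qed
          then show "negligible (snd z \<inter> snd z')"
            using negligible_subset[OF negligible_finite[of "{u, v, u', v'}"]] by simp
        qed
      qed (use fin in auto)
      also have "\<dots> \<le> measure lebesgue U"
      proof (rule measure_mono_fmeasurable)
        show "\<Union>(snd ` A') \<subseteq> U"
        proof clarify
          fix x K y
          assume *: "(x, K) \<in> A'" "y \<in> snd (x, K)"
          then have "x \<in> N" "(x, K) \<in> p"
            by (simp_all add: A'_def A_def)
          then show "y \<in> U"
            using fineD[OF fine \<open>(x, K) \<in> p\<close>] \<delta>(2)[of x] * by auto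
        qed
        have "snd z \<in> sets lebesgue" if "z \<in> A'" for z
          using lm[OF that] by (rule fmeasurableD)
        then show "\<Union>(snd ` A') \<in> sets lebesgue"
          using fin by (intro sets.finite_Union) auto
      qed (use Um in auto)
      also have "\<dots> < r" by (fact Ur)
      finally have len: "(\<Sum>z\<in>A'. Sup (snd z) - Inf (snd z)) < r" .
      have "(\<Sum>I\<in>\<pi> ` A'. norm (f (snd I) - f (fst I))) < e / 2"
      proof (rule r)
        show "c \<le> fst I \<and> fst I \<le> snd I \<and> snd I \<le> d" if "I \<in> \<pi> ` A'" for I
        proof -
          from that obtain z where z: "z \<in> A'" "I = \<pi> z" ..
          then have "(fst z, snd z) \<in> p"
            by (simp add: A'_def A_def)
          from int[OF this] show ?thesis
            unfolding z(2) \<pi>_def by auto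
        qed
        show "pairwise (\<lambda>I J. {fst I<..<snd I} \<inter> {fst J<..<snd J} = {}) (\<pi> ` A')"
        proof (rule pairwiseI)
          fix I J
          assume IJ: "I \<in> \<pi> ` A'" "J \<in> \<pi> ` A'" "I \<noteq> J"
          then obtain z z' where z: "z \<in> A'" "z' \<in> A'" "I = \<pi> z" "J = \<pi> z'" "z \<noteq> z'"
            by auto
          then show "{fst I<..<snd I} \<inter> {fst J<..<snd J} = {}"
            using disj[of "fst z" "snd z" "fst z'" "snd z'"]
            by (simp add: \<pi>_def prod_eq_iff del: greaterThanLessThan_empty_iff)
        qed
        show "(\<Sum>I\<in>\<pi> ` A'. snd I - fst I) < r"
          using len unfolding sum.reindex[OF inj] by (simp add: \<pi>_def)
      qed (use fin in auto)
      then have 2: "(\<Sum>z\<in>A'. norm (f (Sup (snd z)) - f (Inf (snd z)))) < e / 2"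
        unfolding sum.reindex[OF inj] by (simp add: \<pi>_def)
      have "norm (sum T A) \<le> (\<Sum>z\<in>A. norm (T z))"
        by (rule norm_sum)
      also have "\<dots> = (\<Sum>z\<in>A. norm (f (Sup (snd z)) - f (Inf (snd z))))"
        by (rule sum.cong) (auto simp: T_def A_def h_def intro: norm_minus_commute)
      also have "\<dots> = (\<Sum>z\<in>A'. norm (f (Sup (snd z)) - f (Inf (snd z))))"
      proof (rule sum.mono_neutral_right)
        show "\<forall>z\<in>A - A'. norm (f (Sup (snd z)) - f (Inf (snd z))) = 0"
        proof
          fix z
          assume "z \<in> A - A'"
          then have "(fst z, snd z) \<in> p" "\<not> Inf (snd z) < Sup (snd z)"
            by (auto simp: A'_def A_def)
          then have "Inf (snd z) = Sup (snd z)"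
            using int[of "fst z" "snd z"] by force
          then show "norm (f (Sup (snd z)) - f (Inf (snd z))) = 0" by simp
        qed
      qed (use fin in \<open>auto simp: A'_def\<close>)
      finally have "norm (sum T A) < e / 2"
        using 2 by linarith
      with 1 show "norm ((\<Sum>(x,k)\<in>p. measure lborel k *\<^sub>R h x) - (f d - f c)) < e"
        unfolding eq using norm_triangle_ineq[of "sum T A" "sum T (p - A)"] by linarith
    qed
  qed
  then show ?thesis
    using has_integral_spike[OF N, of "{c..d}" g h] by (simp add: h_def)
qed

section \<open>Closure properties of absolute continuity\<close>

lemma abs_cont_on_add:
  assumes f: "abs_cont_on c d f" and g: "abs_cont_on c d g"
  shows "abs_cont_on c d (\<lambda>x. f x + g x)"
  unfolding abs_cont_on_def
proof (intro allI impI)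
  fix e :: real
  assume "e > 0"
  obtain r1 where r1: "r1 > 0" "\<And>D. finite D \<Longrightarrow> (\<And>I. I \<in> D \<Longrightarrow> c \<le> fst I \<and> fst I \<le> snd I \<and> snd I \<le> d) \<Longrightarrow>
        pairwise (\<lambda>I J. {fst I<..<snd I} \<inter> {fst J<..<snd J} = {}) D \<Longrightarrow>
        (\<Sum>I\<in>D. snd I - fst I) < r1 \<Longrightarrow> (\<Sum>I\<in>D. norm (f (snd I) - f (fst I))) < e / 2"
    using abs_cont_onE[OF f half_gt_zero[OF \<open>e > 0\<close>]] by blast
  obtain r2 where r2: "r2 > 0" "\<And>D. finite D \<Longrightarrow> (\<And>I. I \<in> D \<Longrightarrow> c \<le> fst I \<and> fst I \<le> snd I \<and> snd I \<le> d) \<Longrightarrow>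
        pairwise (\<lambda>I J. {fst I<..<snd I} \<inter> {fst J<..<snd J} = {}) D \<Longrightarrow>
        (\<Sum>I\<in>D. snd I - fst I) < r2 \<Longrightarrow> (\<Sum>I\<in>D. norm (g (snd I) - g (fst I))) < e / 2"
    using abs_cont_onE[OF g half_gt_zero[OF \<open>e > 0\<close>]] by blast
  show "\<exists>r>0. \<forall>D::(real \<times> real) set. finite D \<longrightarrow>
        (\<forall>I\<in>D. c \<le> fst I \<and> fst I \<le> snd I \<and> snd I \<le> d) \<longrightarrow>
        pairwise (\<lambda>I J. {fst I<..<snd I} \<inter> {fst J<..<snd J} = {}) D \<longrightarrow>
        (\<Sum>I\<in>D. snd I - fst I) < r \<longrightarrow>
        (\<Sum>I\<in>D. norm (f (snd I) + g (snd I) - (f (fst I) + g (fst I)))) < e"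
  proof (rule exI[of _ "min r1 r2"], intro conjI allI impI)
    fix D :: "(real \<times> real) set"
    assume D: "finite D" "\<forall>I\<in>D. c \<le> fst I \<and> fst I \<le> snd I \<and> snd I \<le> d"
      "pairwise (\<lambda>I J. {fst I<..<snd I} \<inter> {fst J<..<snd J} = {}) D"
      "(\<Sum>I\<in>D. snd I - fst I) < min r1 r2"
    have "(\<Sum>I\<in>D. norm (f (snd I) + g (snd I) - (f (fst I) + g (fst I))))
        \<le> (\<Sum>I\<in>D. norm (f (snd I) - f (fst I)) + norm (g (snd I) - g (fst I)))"
      by (intro sum_mono) (metis add_diff_add norm_triangle_ineq)
    also have "\<dots> < e/2 + e/2"
      unfolding sum.distrib using D by (intro add_strict_mono r1(2) r2(2)) auto
    finally show "(\<Sum>I\<in>D. norm (f (snd I) + g (snd I) - (f (fst I) + g (fst I)))) < e"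
      by simp
  qed (use r1 r2 in auto)
qed

lemma abs_cont_on_mult:
  fixes f g :: "real \<Rightarrow> 'a::real_normed_algebra"
  assumes f: "abs_cont_on c d f" and g: "abs_cont_on c d g"
    and "continuous_on {c..d} f" "continuous_on {c..d} g"
  shows "abs_cont_on c d (\<lambda>x. f x * g x)"
  unfolding abs_cont_on_def
proof (intro allI impI)
  fix e :: real
  assume "e > 0"
  have "bounded (f ` {c..d})" "bounded (g ` {c..d})"
    using assms by (auto intro!: compact_imp_bounded compact_continuous_image)
  then obtain M1 M2 where M: "M1 > 0" "M2 > 0" "\<And>x. x \<in> {c..d} \<Longrightarrow> norm (f x) \<le> M1"
    "\<And>x. x \<in> {c..d} \<Longrightarrow> norm (g x) \<le> M2"
    unfolding bounded_pos by blast
  have e: "e / (2 * M2) > 0" "e / (2 * M1) > 0"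
    using \<open>e > 0\<close> M by auto
  obtain r1 where r1: "r1 > 0" "\<And>D. finite D \<Longrightarrow> (\<And>I. I \<in> D \<Longrightarrow> c \<le> fst I \<and> fst I \<le> snd I \<and> snd I \<le> d) \<Longrightarrow>
        pairwise (\<lambda>I J. {fst I<..<snd I} \<inter> {fst J<..<snd J} = {}) D \<Longrightarrow>
        (\<Sum>I\<in>D. snd I - fst I) < r1 \<Longrightarrow> (\<Sum>I\<in>D. norm (f (snd I) - f (fst I))) < e / (2 * M2)"
    using abs_cont_onE[OF f e(1)] by blast
  obtain r2 where r2: "r2 > 0" "\<And>D. finite D \<Longrightarrow> (\<And>I. I \<in> D \<Longrightarrow> c \<le> fst I \<and> fst I \<le> snd I \<and> snd I \<le> d) \<Longrightarrow>
        pairwise (\<lambda>I J. {fst I<..<snd I} \<inter> {fst J<..<snd J} = {}) D \<Longrightarrow>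
        (\<Sum>I\<in>D. snd I - fst I) < r2 \<Longrightarrow> (\<Sum>I\<in>D. norm (g (snd I) - g (fst I))) < e / (2 * M1)"
    using abs_cont_onE[OF g e(2)] by blast
  show "\<exists>r>0. \<forall>D::(real \<times> real) set. finite D \<longrightarrow>
        (\<forall>I\<in>D. c \<le> fst I \<and> fst I \<le> snd I \<and> snd I \<le> d) \<longrightarrow>
        pairwise (\<lambda>I J. {fst I<..<snd I} \<inter> {fst J<..<snd J} = {}) D \<longrightarrow>
        (\<Sum>I\<in>D. snd I - fst I) < r \<longrightarrow>
        (\<Sum>I\<in>D. norm (f (snd I) * g (snd I) - f (fst I) * g (fst I))) < e"
  proof (rule exI[of _ "min r1 r2"], intro conjI allI impI)
    fix D :: "(real \<times> real) set"
    assume D: "finite D" "\<forall>I\<in>D. c \<le> fst I \<and> fst I \<le> snd I \<and> snd I \<le> d"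
      "pairwise (\<lambda>I J. {fst I<..<snd I} \<inter> {fst J<..<snd J} = {}) D"
      "(\<Sum>I\<in>D. snd I - fst I) < min r1 r2"
    have "(\<Sum>I\<in>D. norm (f (snd I) * g (snd I) - f (fst I) * g (fst I)))
        \<le> (\<Sum>I\<in>D. M2 * norm (f (snd I) - f (fst I)) + M1 * norm (g (snd I) - g (fst I)))"
    proof (rule sum_mono)
      fix I
      assume "I \<in> D"
      then have I: "norm (f (fst I)) \<le> M1" "norm (g (snd I)) \<le> M2"
        using D by (auto intro!: M)
      have "f (snd I) * g (snd I) - f (fst I) * g (fst I)
          = (f (snd I) - f (fst I)) * g (snd I) + f (fst I) * (g (snd I) - g (fst I))"
        by (simp add: algebra_simps)
      also have "norm \<dots> \<le> norm (f (snd I) - f (fst I)) * norm (g (snd I))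
          + norm (f (fst I)) * norm (g (snd I) - g (fst I))"
        by (meson add_mono norm_mult_ineq norm_triangle_le)
      also have "\<dots> \<le> norm (f (snd I) - f (fst I)) * M2 + M1 * norm (g (snd I) - g (fst I))"
        using I by (intro add_mono mult_mono) (auto simp: less_imp_le[OF M(1)])
      finally show "norm (f (snd I) * g (snd I) - f (fst I) * g (fst I))
          \<le> M2 * norm (f (snd I) - f (fst I)) + M1 * norm (g (snd I) - g (fst I))"
        by (simp add: mult.commute)
    qed
    also have "\<dots> < M2 * (e / (2 * M2)) + M1 * (e / (2 * M1))"
      unfolding sum.distrib sum_distrib_left[symmetric]
      using D M by (intro add_strict_mono mult_strict_left_mono r1(2) r2(2)) auto
    finally show "(\<Sum>I\<in>D. norm (f (snd I) * g (snd I) - f (fst I) * g (fst I))) < e"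
      using M by simp
  qed (use r1 r2 in auto)
qed

lemma abs_cont_on_C1:
  fixes f :: "real \<Rightarrow> 'a::real_normed_vector"
  assumes der: "\<And>x. x \<in> {c..d} \<Longrightarrow> (f has_vector_derivative f' x) (at x within {c..d})"
    and "continuous_on {c..d} f'"
  shows "abs_cont_on c d f"
  unfolding abs_cont_on_def
proof (intro allI impI)
  fix e :: real
  assume "e > 0"
  have "bounded (f' ` {c..d})"
    using assms by (auto intro!: compact_imp_bounded compact_continuous_image)
  then obtain M where M: "M > 0" "\<And>x. x \<in> {c..d} \<Longrightarrow> norm (f' x) \<le> M"
    unfolding bounded_pos by blast
  have lip: "norm (f v - f u) \<le> M * (v - u)" if "c \<le> u" "u \<le> v" "v \<le> d" for u v
  proof -
    have "norm (f v - f u) \<le> M * norm (v - u)"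
    proof (rule differentiable_bound[of "{c..d}" f "\<lambda>x h. h *\<^sub>R f' x"])
      show "onorm (\<lambda>h. h *\<^sub>R f' x) \<le> M" if "x \<in> {c..d}" for x
        using M(2)[OF that] by (intro onorm_le, simp) (metis abs_ge_zero mult.commute mult_left_mono)
    qed (use der that in \<open>auto simp: has_vector_derivative_def\<close>)
    with that show ?thesis by simp
  qed
  show "\<exists>r>0. \<forall>D::(real \<times> real) set. finite D \<longrightarrow>
        (\<forall>I\<in>D. c \<le> fst I \<and> fst I \<le> snd I \<and> snd I \<le> d) \<longrightarrow>
        pairwise (\<lambda>I J. {fst I<..<snd I} \<inter> {fst J<..<snd J} = {}) D \<longrightarrow>
        (\<Sum>I\<in>D. snd I - fst I) < r \<longrightarrow>
        (\<Sum>I\<in>D. norm (f (snd I) - f (fst I))) < e"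
  proof (rule exI[of _ "e / M"], intro conjI allI impI)
    fix D :: "(real \<times> real) set"
    assume D: "finite D" "\<forall>I\<in>D. c \<le> fst I \<and> fst I \<le> snd I \<and> snd I \<le> d"
      "(\<Sum>I\<in>D. snd I - fst I) < e / M"
    have "(\<Sum>I\<in>D. norm (f (snd I) - f (fst I))) \<le> (\<Sum>I\<in>D. M * (snd I - fst I))"
      using D by (intro sum_mono lip) auto
    also have "\<dots> < e"
      unfolding sum_distrib_left[symmetric] using D(3) M by (simp add: pos_less_divide_eq mult.commute)
    finally show "(\<Sum>I\<in>D. norm (f (snd I) - f (fst I))) < e" .
  qed (use M \<open>e > 0\<close> in auto)
qed

section \<open>Convergence of improper integrals\<close>


text \<open>For a nonnegative integrand this is finiteness of the integral over \<open>[a, \<infinity>)\<close>.\<close>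

definition fin_int :: "real \<Rightarrow> (real \<Rightarrow> real) \<Rightarrow> bool" where
  "fin_int a h \<longleftrightarrow> (\<exists>B. \<forall>X\<ge>a. integral {a..X} h \<le> B)"

lemma fin_int_cong:
  assumes "\<And>x. x \<ge> a \<Longrightarrow> f x = g x"
  shows "fin_int a f \<longleftrightarrow> fin_int a g"
proof -
  have "integral {a..X} f = integral {a..X} g" for X
    using assms by (intro integral_cong) auto
  then show ?thesis by (simp add: fin_int_def)
qed

lemma absolutely_integrable_imp_fin_int:
  assumes "h absolutely_integrable_on {a..}" "\<And>x. x \<ge> a \<Longrightarrow> 0 \<le> h x"
  shows "fin_int a h"
  unfolding fin_int_def
proof (intro exI allI impI)
  fix X
  show "integral {a..X} h \<le> integral {a..} h"
    using assms(1) by (intro integral_subset_le)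
      (auto intro: assms integrable_on_subinterval set_lebesgue_integral_eq_integral(1))
qed

text \<open>Monotone convergence for the truncations of \<open>h\<close> to [a, a + k].\<close>

lemma fin_int_imp_absolutely_integrable:
  assumes int: "\<And>X. h integrable_on {a..X}" and nn: "\<And>x. x \<ge> a \<Longrightarrow> 0 \<le> h x"
    and fin: "fin_int a h"
  shows "h absolutely_integrable_on {a..}"
proof -
  obtain B where B: "\<And>X. X \<ge> a \<Longrightarrow> integral {a..X} h \<le> B"
    using fin unfolding fin_int_def by blast
  define f where "f k x = (if x \<in> {a..a + real k} then h x else 0)" for k x
  have f_eq: "integral {a..} (f k) = integral {a..a + real k} h" for k
    unfolding f_def integral_restrict_Int by (rule arg_cong2[of _ _ _ _ integral]) auto
  have "h integrable_on {a..} \<and> (\<lambda>k. integral {a..} (f k)) \<longlonglongrightarrow> integral {a..} h"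
  proof (rule monotone_convergence_increasing)
    show "f k integrable_on {a..}" for k
      unfolding f_def integrable_restrict_Int
      using int[of "a + real k"] by (auto simp: Int_absorb2 subset_iff)
    show "f k x \<le> f (Suc k) x" if "x \<in> {a..}" for k x
      using that nn by (auto simp: f_def)
    show "(\<lambda>k. f k x) \<longlonglongrightarrow> h x" if "x \<in> {a..}" for x
    proof (rule tendsto_eventually)
      obtain N where N: "x - a \<le> real N"
        using real_arch_simple by blast
      show "\<forall>\<^sub>F k in sequentially. f k x = h x"
        using eventually_ge_at_top[of N] by eventually_elim (use that N in \<open>auto simp: f_def\<close>)
    qed
    have "norm (integral {a..} (f k)) \<le> B" for k
    proof -
      have "0 \<le> integral {a..a + real k} h"
        by (intro integral_nonneg int) (auto intro: nn)
      then show ?thesis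
        using B[of "a + real k"] by (simp add: f_eq)
    qed
    then show "bounded (range (\<lambda>k. integral {a..} (f k)))"
      by (auto intro!: boundedI)
  qed
  then show ?thesis
    by (intro nonnegative_absolutely_integrable_1) (auto intro: nn)
qed

lemma continuous_on_imp_integrable:
  fixes h :: "real \<Rightarrow> 'a::banach"
  shows "continuous_on {a..} h \<Longrightarrow> a \<le> b \<Longrightarrow> h integrable_on {b..X}"
  by (intro integrable_continuous_real) (auto elim: continuous_on_subset)

lemma absolutely_integrable_iff_fin_int:
  assumes "continuous_on {a..} h" "\<And>x. x \<ge> a \<Longrightarrow> 0 \<le> h x"
  shows "h absolutely_integrable_on {a..} \<longleftrightarrow> fin_int a h"
  using assms absolutely_integrable_imp_fin_int fin_int_imp_absolutely_integrable
    continuous_on_imp_integrable[OF assms(1) order_refl] by metis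

text \<open>Continuity supplies measurability and nonnegativity makes \<open>ennreal\<close>
  harmless, so a finite extended integral is the same as absolute integrability. This translates (C)
  into bounds on the intervals [a, X].\<close>

lemma nn_integral_finite_iff_fin_int:
  assumes cont: "continuous_on {a..} h" and nn: "\<And>x. x \<ge> a \<Longrightarrow> 0 \<le> h x"
  shows "(\<integral>\<^sup>+t\<in>{a..}. ennreal (h t) \<partial>lebesgue) < \<infinity> \<longleftrightarrow> fin_int a h"
proof -
  have "(\<lambda>x. indicator {a..} x *\<^sub>R h x) \<in> borel_measurable lborel"
    using borel_measurable_continuous_on_indicator[OF _ cont] by simp
  then have meas: "(\<lambda>x. indicator {a..} x *\<^sub>R h x) \<in> borel_measurable lebesgue"
    by (rule measurable_completion)
  have "(\<integral>\<^sup>+t\<in>{a..}. ennreal (h t) \<partial>lebesgue)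
      = (\<integral>\<^sup>+t. ennreal (norm (indicator {a..} t *\<^sub>R h t)) \<partial>lebesgue)"
    by (intro nn_integral_cong) (auto simp: indicator_def nn)
  then have "(\<integral>\<^sup>+t\<in>{a..}. ennreal (h t) \<partial>lebesgue) < \<infinity> \<longleftrightarrow> h absolutely_integrable_on {a..}"
    using meas by (simp add: set_integrable_def integrable_iff_bounded)
  then show ?thesis
    using absolutely_integrable_iff_fin_int[OF assms] by simp
qed

lemma fin_int_mono:
  assumes f: "continuous_on {a..} f" "\<And>x. x \<ge> a \<Longrightarrow> 0 \<le> f x"
    and g: "continuous_on {a..} g" "\<And>x. x \<ge> a \<Longrightarrow> 0 \<le> g x"
    and "0 \<le> C" and fg: "\<forall>\<^sub>F x in at_top. f x \<le> C * g x" and fin: "fin_int a g"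
  shows "fin_int a f"
proof -
  obtain B where B: "\<And>X. X \<ge> a \<Longrightarrow> integral {a..X} g \<le> B"
    using fin unfolding fin_int_def by blast
  obtain b0 where b0: "\<And>x. x \<ge> b0 \<Longrightarrow> f x \<le> C * g x"
    using fg unfolding eventually_at_top_linorder by blast
  define b where "b = max a b0"
  have b: "a \<le> b" "\<And>x. x \<ge> b \<Longrightarrow> f x \<le> C * g x"
    using b0 by (auto simp: b_def)
  note if_ = continuous_on_imp_integrable[OF f(1)] and ig = continuous_on_imp_integrable[OF g(1)]
  have "integral {a..X} f \<le> integral {a..b} f + C * B" if "X \<ge> a" for X
  proof -
    \<comment> \<open>Passing to an interval that reaches beyond \<open>b\<close> allows the cut at
      \<open>b\<close> also for X < b.\<close>
    define Y where "Y = max b X"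
    have Y: "b \<le> Y" "X \<le> Y"
      by (auto simp: Y_def)
    have "integral {a..X} f \<le> integral {a..Y} f"
      using Y f(2) by (intro integral_subset_le if_) auto
    also have "\<dots> = integral {a..b} f + integral {b..Y} f"
      using Henstock_Kurzweil_Integration.integral_combine[OF b(1) Y(1) if_] by simp
    also have "integral {b..Y} f \<le> integral {b..Y} (\<lambda>x. C * g x)"
      using b by (intro integral_le if_ integrable_on_mult_right ig) auto
    also have "\<dots> = C * integral {b..Y} g"
      by simp
    also have "integral {b..Y} g \<le> integral {a..Y} g"
      using b g(2) by (intro integral_subset_le ig) auto
    also have "\<dots> \<le> B"
      using B[of Y] Y b by simp
    finally show ?thesis
      using \<open>0 \<le> C\<close> by (simp add: mult_left_mono)
  qed
  then show ?thesis
    unfolding fin_int_def by blast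
qed

lemma fin_int_add:
  assumes f: "continuous_on {a..} f" and g: "continuous_on {a..} g"
    and "fin_int a f" "fin_int a g"
  shows "fin_int a (\<lambda>x. f x + g x)"
proof -
  obtain B B' where B: "\<And>X. X \<ge> a \<Longrightarrow> integral {a..X} f \<le> B" "\<And>X. X \<ge> a \<Longrightarrow> integral {a..X} g \<le> B'"
    using assms unfolding fin_int_def by blast
  have "integral {a..X} (\<lambda>x. f x + g x) \<le> B + B'" if "X \<ge> a" for X
    using B[OF that] f g by (subst integral_add) (auto intro: continuous_on_imp_integrable)
  then show ?thesis
    unfolding fin_int_def by blast
qed

text \<open>The partial integrals increase to their supremum; \<open>b\<close> is a point where they
  come within \<epsilon> of it. Starting an estimate at such a \<open>b\<close> makes its error term
  small enough to be absorbed.\<close>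

lemma fin_int_tail:
  assumes int: "\<And>X. g integrable_on {a..X}" and nn: "\<And>x. x \<ge> a \<Longrightarrow> 0 \<le> g x"
    and fin: "fin_int a g" and "\<epsilon> > 0"
  obtains b where "b \<ge> a" "\<And>X. X \<ge> b \<Longrightarrow> integral {b..X} g \<le> \<epsilon>"
proof -
  obtain B where B: "\<And>X. X \<ge> a \<Longrightarrow> integral {a..X} g \<le> B"
    using fin unfolding fin_int_def by blast
  define S where "S = (SUP X\<in>{a..}. integral {a..X} g)"
  have bdd: "bdd_above ((\<lambda>X. integral {a..X} g) ` {a..})"
    using B by (auto intro!: bdd_aboveI2)
  have "\<exists>b\<in>{a..}. S - \<epsilon> < integral {a..b} g"
    using \<open>\<epsilon> > 0\<close> bdd unfolding S_def by (subst less_cSUP_iff[symmetric]) auto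
  then obtain b where b: "b \<ge> a" "S - \<epsilon> < integral {a..b} g"
    by auto
  have "integral {b..X} g \<le> \<epsilon>" if "X \<ge> b" for X
  proof -
    have "integral {a..X} g \<le> S"
      unfolding S_def using that b bdd by (intro cSUP_upper) auto
    moreover have "integral {a..X} g = integral {a..b} g + integral {b..X} g"
      using Henstock_Kurzweil_Integration.integral_combine[OF b(1) that int] by simp
    ultimately show ?thesis
      using b by linarith
  qed
  with b that show thesis by blast
qed

text \<open>With M the maximum of \<open>T\<close> over a compact interval, attained at m, the
  hypothesis reads M \<le> C + M / 2, hence M \<le> 2 * C independently of the interval. This
  absorption takes the place of Gronwall's inequality in the estimates for solutions.\<close>

lemma le_absorb:
  fixes T :: "real \<Rightarrow> real"
  assumes cont: "continuous_on {b..} T"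
    and step: "\<And>X M x. (\<And>y. y \<in> {b..X} \<Longrightarrow> T y \<le> M) \<Longrightarrow> x \<in> {b..X} \<Longrightarrow> T x \<le> C + M / 2"
    and "x \<ge> b"
  shows "T x \<le> 2 * C"
proof -
  have "continuous_on {b..x} T"
    using cont by (rule continuous_on_subset) auto
  then obtain m where m: "m \<in> {b..x}" "\<And>y. y \<in> {b..x} \<Longrightarrow> T y \<le> T m"
    using continuous_attains_sup[of "{b..x}" T] \<open>x \<ge> b\<close> by auto
  have "T m \<le> C + T m / 2"
    by (rule step[OF m(2) m(1)])
  moreover have "T x \<le> T m"
    using m(2) \<open>x \<ge> b\<close> by auto
  ultimately show ?thesis by linarith
qed

section \<open>Linear differential equations\<close>


lemma at_within_atLeastAtMost_eq:
  fixes x :: real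
  assumes "x < T"
  shows "at x within {a..T} = at x within {a..}"
  by (rule at_within_nhd[of x "{..<T}"]) (use assms in auto)

lemma continuous_on_atLeastI:
  fixes f :: "real \<Rightarrow> 'a::topological_space"
  assumes "\<And>T. continuous_on {a..T} f"
  shows "continuous_on {a..} f"
  unfolding continuous_on_eq_continuous_within
proof
  fix x
  assume "x \<in> {a..}"
  then have "continuous (at x within {a..x+1}) f"
    using assms[of "x+1"] by (simp add: continuous_on_eq_continuous_within)
  then show "continuous (at x within {a..}) f"
    by (simp add: at_within_atLeastAtMost_eq)
qed

lemma integral_has_vector_derivative_atLeast:
  fixes f :: "real \<Rightarrow> 'a::banach"
  assumes "continuous_on {a..} f" "x \<ge> a"
  shows "((\<lambda>x. integral {a..x} f) has_vector_derivative f x) (at x within {a..})"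
proof -
  have "continuous_on {a..x+1} f"
    using assms(1) by (rule continuous_on_subset) auto
  then have "((\<lambda>x. integral {a..x} f) has_vector_derivative f x) (at x within {a..x+1})"
    using assms(2) by (intro integral_has_vector_derivative) auto
  then show ?thesis
    by (simp add: at_within_atLeastAtMost_eq)
qed

lemma has_vector_derivative_atLeast_continuous_on:
  assumes "\<And>x. x \<ge> a \<Longrightarrow> (f has_vector_derivative f' x) (at x within {a..})"
  shows "continuous_on {a..} f"
  unfolding continuous_on_eq_continuous_within
  using assms by (auto intro: has_vector_derivative_continuous)

text \<open>The induction step of the Picard estimate: multiplying by the Lipschitz constant and
  integrating raises the power and the factorial by one.\<close>

lemma picard_bound:
  fixes f g :: "real \<Rightarrow> 'a::banach"
  assumes "x \<ge> a" "0 \<le> L" and g: "continuous_on {a..} g"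
    and bd: "\<And>t. t \<in> {a..x} \<Longrightarrow> norm (g t) \<le> L * (C * (L * (t - a)) ^ n / fact n)"
  shows "norm (integral {a..x} g) \<le> C * (L * (x - a)) ^ Suc n / fact (Suc n)"
proof -
  have "((\<lambda>t. L * (C * (L * (t - a)) ^ n / fact n)) has_integral
       (C * (L * (x - a)) ^ Suc n / fact (Suc n) - C * (L * (a - a)) ^ Suc n / fact (Suc n))) {a..x}"
  proof (rule fundamental_theorem_of_calculus)
    fix t
    show "((\<lambda>t. C * (L * (t - a)) ^ Suc n / fact (Suc n)) has_vector_derivative
        L * (C * (L * (t - a)) ^ n / fact n)) (at t within {a..x})"
      unfolding has_real_derivative_iff_has_vector_derivative[symmetric] fact_Suc
      by (rule derivative_eq_intros refl | simp)+
  qed fact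
  then have i: "((\<lambda>t. L * (C * (L * (t - a)) ^ n / fact n)) has_integral
       (C * (L * (x - a)) ^ Suc n / fact (Suc n))) {a..x}"
    by simp
  have "norm (integral {a..x} g) \<le> integral {a..x} (\<lambda>t. L * (C * (L * (t - a)) ^ n / fact n))"
    by (rule integral_norm_bound_integral[OF continuous_on_imp_integrable[OF g order_refl] _ bd])
      (use i in blast)
  also have "\<dots> = C * (L * (x - a)) ^ Suc n / fact (Suc n)"
    using i by (rule integral_unique)
  finally show ?thesis .
qed

text \<open>The series of Picard increments is dominated on [a, T] by an exponential series, so it
  converges uniformly there for every T. Linearity is what makes the solution exist on the whole
  half line.\<close>

theorem linear_ode_exists:
  fixes A :: "real \<Rightarrow> 'a \<Rightarrow> 'a::banach"
  assumes lin: "\<And>t. linear (A t)"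
    and cont: "\<And>u. continuous_on {a..} u \<Longrightarrow> continuous_on {a..} (\<lambda>t. A t (u t))"
    and bd: "\<And>T. \<exists>L. \<forall>t\<in>{a..T}. \<forall>v. norm (A t v) \<le> L * norm v"
  shows "\<exists>V. V a = v0 \<and> (\<forall>x\<ge>a. (V has_vector_derivative A x (V x)) (at x within {a..}))"
proof -
  \<comment> \<open>By linearity the increments of the Picard iteration satisfy the recursion
    themselves; the partial sums \<open>W N\<close> are the iterates.\<close>
  define P where "P = rec_nat (\<lambda>_. v0) (\<lambda>_ u x. integral {a..x} (\<lambda>t. A t (u t)))"
  have P0: "P 0 = (\<lambda>_. v0)" and PS: "P (Suc n) = (\<lambda>x. integral {a..x} (\<lambda>t. A t (P n t)))" for n
    by (simp_all add: P_def)
  have contP: "continuous_on {a..} (P n)" for n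
  proof (induction n)
    case (Suc n)
    have "((\<lambda>x. integral {a..x} (\<lambda>t. A t (P n t))) has_vector_derivative A x (P n x)) (at x within {a..})"
      if "x \<ge> a" for x
      by (rule integral_has_vector_derivative_atLeast[OF cont[OF Suc.IH] that])
    then show ?case
      unfolding PS by (rule has_vector_derivative_atLeast_continuous_on)
  qed (simp add: P0)
  define W where "W N x = (\<Sum>n<N. P n x)" for N x
  define V where "V x = (\<Sum>n. P n x)" for x
  have contW: "continuous_on {a..} (W N)" for N
    unfolding W_def by (intro continuous_intros contP)
  have lim: "uniform_limit {a..T} W V sequentially" for T
  proof -
    obtain L0 where L0: "\<And>t v. t \<in> {a..T} \<Longrightarrow> norm (A t v) \<le> L0 * norm v"
      using bd by blast
    \<comment> \<open>Nothing makes \<open>L0\<close> nonnegative, for instance when [a, T] is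
      empty.\<close>
    define L where "L = max L0 0"
    have L: "0 \<le> L" "norm (A t v) \<le> L * norm v" if "t \<in> {a..T}" for t v
      using order_trans[OF L0[OF that] mult_right_mono[of L0 L "norm v"]] by (simp_all add: L_def)
    have L0: "0 \<le> L"
      by (simp add: L_def)
    have PB: "norm (P n x) \<le> norm v0 * (L * (x - a)) ^ n / fact n" if "x \<in> {a..T}" for n x
      using that
    proof (induction n arbitrary: x)
      case (Suc n)
      show ?case
        unfolding PS
      proof (rule picard_bound)
        fix t
        assume t: "t \<in> {a..x}"
        then have "t \<in> {a..T}"
          using Suc.prems by auto
        then show "norm (A t (P n t)) \<le> L * (norm v0 * (L * (t - a)) ^ n / fact n)"
          using order_trans[OF L(2)[of t "P n t"] mult_left_mono[OF Suc.IH L0]] by simp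
      qed (use Suc.prems L0 cont contP in auto)
    qed (simp add: P0)
    show ?thesis
      unfolding W_def V_def
    proof (rule Weierstrass_m_test)
      show "norm (P n x) \<le> norm v0 * (L * (T - a)) ^ n / fact n" if "x \<in> {a..T}" for n x
      proof (rule order_trans[OF PB[OF that]])
        show "norm v0 * (L * (x - a)) ^ n / fact n \<le> norm v0 * (L * (T - a)) ^ n / fact n"
          using that L0 by (intro divide_right_mono mult_left_mono power_mono) auto
      qed
      show "summable (\<lambda>n. norm v0 * (L * (T - a)) ^ n / fact n)"
        using summable_mult[OF summable_exp[of "L * (T - a)"], of "norm v0"]
        by (simp add: field_simps)
    qed
  qed
  have "continuous_on {a..T} V" for T
    using uniform_limit_theorem[OF _ lim[of T]] continuous_on_subset[OF contW] by fastforce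
  then have contV: "continuous_on {a..} V"
    by (rule continuous_on_atLeastI)
  have eq: "V x = v0 + integral {a..x} (\<lambda>t. A t (V t))" if "x \<ge> a" for x
  proof -
    obtain L where L: "\<And>t v. t \<in> {a..x} \<Longrightarrow> norm (A t v) \<le> L * norm v"
      using bd by blast
    have "uniform_limit {a..x} (\<lambda>N t. A t (W N t)) (\<lambda>t. A t (V t)) sequentially"
    proof (rule uniform_limitI)
      fix e :: real
      assume "e > 0"
      then have "e / (\<bar>L\<bar> + 1) > 0"
        by simp
      from uniform_limitD[OF lim[of x] this]
      show "\<forall>\<^sub>F N in sequentially. \<forall>t\<in>{a..x}. dist (A t (W N t)) (A t (V t)) < e"
      proof eventually_elim
        case (elim N)
        show ?case
        proof
          fix t
          assume t: "t \<in> {a..x}"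
          have "dist (A t (W N t)) (A t (V t)) = norm (A t (W N t - V t))"
            by (simp add: dist_norm linear_diff[OF lin])
          also have "\<dots> \<le> L * norm (W N t - V t)"
            by (rule L[OF t])
          also have "\<dots> \<le> (\<bar>L\<bar> + 1) * norm (W N t - V t)"
            by (rule mult_right_mono) auto
          also have "\<dots> < e"
            using elim t by (simp add: dist_norm field_simps)
          finally show "dist (A t (W N t)) (A t (V t)) < e" .
        qed
      qed
    qed
    then obtain I J where I: "\<And>N. ((\<lambda>t. A t (W N t)) has_integral I N) {a..x}"
        "((\<lambda>t. A t (V t)) has_integral J) {a..x}" "I \<longlonglongrightarrow> J"
      by (rule uniform_limit_integral) (auto intro: continuous_on_subset[OF cont[OF contW]])
    have "I N = (\<Sum>n<N. P (Suc n) x)" for N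
    proof -
      have "I N = integral {a..x} (\<lambda>t. \<Sum>n<N. A t (P n t))"
        using I(1)[of N] by (simp add: W_def linear_sum[OF lin] has_integral_iff)
      also have "\<dots> = (\<Sum>n<N. P (Suc n) x)"
        unfolding PS by (intro integral_sum continuous_on_imp_integrable[OF cont[OF contP]]) auto
      finally show ?thesis .
    qed
    \<comment> \<open>Integration turns the terms 0, ..., N - 1 into 1, ..., N; the initial value
      supplies term 0 of the next partial sum.\<close>
    then have WI: "W (Suc N) x = v0 + I N" for N
      unfolding W_def sum.lessThan_Suc_shift by (simp add: P0)
    have "(\<lambda>N. W N x) \<longlonglongrightarrow> V x"
      using tendsto_uniform_limitI[OF lim[of x], of x] that by simp
    then have "(\<lambda>N. v0 + I N) \<longlonglongrightarrow> V x"
      unfolding WI[symmetric] by (rule LIMSEQ_Suc)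
    moreover have "(\<lambda>N. v0 + I N) \<longlonglongrightarrow> v0 + J"
      by (intro tendsto_intros I)
    ultimately have "V x = v0 + J"
      by (rule LIMSEQ_unique)
    then show ?thesis
      using I(2) by (simp add: has_integral_iff)
  qed
  show ?thesis
  proof (intro exI conjI allI impI)
    show "V a = v0"
      using eq[of a] by simp
    fix x
    assume "x \<ge> a"
    have "((\<lambda>x. v0 + integral {a..x} (\<lambda>t. A t (V t))) has_vector_derivative A x (V x)) (at x within {a..})"
      using has_vector_derivative_add[OF has_vector_derivative_const[of v0]
          integral_has_vector_derivative_atLeast[OF cont[OF contV] \<open>x \<ge> a\<close>]] by simp
    then show "(V has_vector_derivative A x (V x)) (at x within {a..})"
    proof (rule has_vector_derivative_transform[rotated 2])
      show "V y = v0 + integral {a..y} (\<lambda>t. A t (V t))" if "y \<in> {a..}" for y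
        by (rule eq) (use that in simp)
    qed (use \<open>x \<ge> a\<close> in simp)
  qed
qed

text \<open>Classical solutions of y'' = s y. The derivative is carried as a second function, so
  that Wronskians and initial data can be written without a derivative operator.\<close>

definition sol :: "real \<Rightarrow> (real \<Rightarrow> complex) \<Rightarrow> (real \<Rightarrow> complex) \<Rightarrow> (real \<Rightarrow> complex) \<Rightarrow> bool" where
  "sol a s y y' \<longleftrightarrow> (\<forall>x\<ge>a. (y has_vector_derivative y' x) (at x within {a..}) \<and>
     (y' has_vector_derivative s x * y x) (at x within {a..}))"

lemma solD:
  assumes "sol a s y y'" "x \<ge> a"
  shows "(y has_vector_derivative y' x) (at x within {a..})"
    and "(y' has_vector_derivative s x * y x) (at x within {a..})"
  using assms by (auto simp: sol_def)

lemma sol_continuous_on: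
  assumes "sol a s y y'"
  shows "continuous_on {a..} y" "continuous_on {a..} y'"
  using has_vector_derivative_atLeast_continuous_on[OF solD(1)[OF assms]]
    has_vector_derivative_atLeast_continuous_on[OF solD(2)[OF assms]] by simp_all

lemma sol_lincomb:
  assumes u: "sol a s u u'" and v: "sol a s v v'"
  shows "sol a s (\<lambda>x. c * u x + d * v x) (\<lambda>x. c * u' x + d * v' x)"
  unfolding sol_def
proof (intro allI impI conjI)
  fix x
  assume x: "x \<ge> a"
  show "((\<lambda>x. c * u x + d * v x) has_vector_derivative c * u' x + d * v' x) (at x within {a..})"
    using has_vector_derivative_add[OF
        has_vector_derivative_mult[OF has_vector_derivative_const solD(1)[OF u x]]
        has_vector_derivative_mult[OF has_vector_derivative_const solD(1)[OF v x]], of c d] by simp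
  show "((\<lambda>x. c * u' x + d * v' x) has_vector_derivative s x * (c * u x + d * v x)) (at x within {a..})"
    using has_vector_derivative_add[OF
        has_vector_derivative_mult[OF has_vector_derivative_const solD(2)[OF u x]]
        has_vector_derivative_mult[OF has_vector_derivative_const solD(2)[OF v x]], of c d]
    by (simp add: algebra_simps)
qed

lemma sol_exists:
  assumes s: "continuous_on {a..} s"
  obtains y y' where "sol a s y y'" "y a = c" "y' a = d"
proof -
  have "\<exists>V. V a = (c, d) \<and> (\<forall>x\<ge>a. (V has_vector_derivative (snd (V x), s x * fst (V x))) (at x within {a..}))"
  proof (rule linear_ode_exists[where A = "\<lambda>t v. (snd v, s t * fst v)"])
    show "linear (\<lambda>v. (snd v, s t * fst v))" for t
      by (intro linearI) (auto simp: algebra_simps)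
    show "continuous_on {a..} (\<lambda>t. (snd (u t), s t * fst (u t)))"
      if "continuous_on {a..} u" for u :: "real \<Rightarrow> complex \<times> complex"
      using s that by (intro continuous_intros)
    fix T
    have "compact (s ` {a..T})"
      by (rule compact_continuous_image) (auto intro: continuous_on_subset[OF s])
    then obtain B where "\<forall>z\<in>s ` {a..T}. norm z \<le> B"
      using compact_imp_bounded[of "s ` {a..T}"] unfolding bounded_iff by blast
    then have B: "norm (s t) \<le> B" if "t \<in> {a..T}" for t
      using that by blast
    have "norm (snd v, s t * fst v) \<le> (1 + B) * norm v" if "t \<in> {a..T}" for t and v :: "complex \<times> complex"
    proof -
      have "norm (snd v, s t * fst v) \<le> norm (snd v) + norm (s t * fst v)"
        by (simp add: norm_Pair sqrt_sum_squares_le_sum)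
      also have "\<dots> \<le> norm v + B * norm v"
      proof (intro add_mono)
        have n: "norm (fst v) \<le> norm v" "norm (snd v) \<le> norm v"
          using norm_fst_le[of "fst v" "snd v"] norm_snd_le[of "snd v" "fst v"] by simp_all
        show "norm (snd v) \<le> norm v" by (fact n)
        show "norm (s t * fst v) \<le> B * norm v"
          unfolding norm_mult using B[OF that] n(1) order_trans[OF norm_ge_zero B[OF that]]
          by (intro mult_mono) simp_all
      qed
      finally show ?thesis by (simp add: algebra_simps)
    qed
    then show "\<exists>L. \<forall>t\<in>{a..T}. \<forall>v::complex \<times> complex. norm (snd v, s t * fst v) \<le> L * norm v"
      by (intro exI[of _ "1 + B"] ballI allI)
  qed
  then obtain V where V: "V a = (c, d)"
    "\<And>x. x \<ge> a \<Longrightarrow> (V has_vector_derivative (snd (V x), s x * fst (V x))) (at x within {a..})"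
    by blast
  have "sol a s (\<lambda>x. fst (V x)) (\<lambda>x. snd (V x))"
    unfolding sol_def
  proof (intro allI impI conjI)
    fix x
    assume x: "x \<ge> a"
    show "((\<lambda>x. fst (V x)) has_vector_derivative snd (V x)) (at x within {a..})"
      using bounded_linear.has_vector_derivative[OF bounded_linear_fst V(2)[OF x]] by simp
    show "((\<lambda>x. snd (V x)) has_vector_derivative s x * fst (V x)) (at x within {a..})"
      using bounded_linear.has_vector_derivative[OF bounded_linear_snd V(2)[OF x]] by simp
  qed
  from that[OF this] V(1) show thesis by simp
qed

section \<open>Wronskians and fundamental systems\<close>

lemma has_vector_derivative_zero_atLeast:
  assumes "\<And>x. x \<ge> a \<Longrightarrow> (f has_vector_derivative 0) (at x within {a..})" "x \<ge> a"
  shows "f x = f (a::real)"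
proof -
  have "\<And>x. x \<in> {a..} \<Longrightarrow> (f has_vector_derivative 0) (at x within {a..})"
    using assms(1) by simp
  then obtain c where "\<And>x. x \<in> {a..} \<Longrightarrow> f x = c"
    by (rule has_vector_derivative_zero_constant[of "{a..}" f, rotated]) (use convex_real_interval in auto)
  from this[of x] this[of a] show ?thesis
    using assms(2) by simp
qed

lemma sol_wronskian:
  assumes u: "sol a s u u'" and v: "sol a s v v'" and "x \<ge> a"
  shows "u x * v' x - u' x * v x = u a * v' a - u' a * v a"
proof (rule has_vector_derivative_zero_atLeast[OF _ \<open>x \<ge> a\<close>])
  fix x
  assume x: "x \<ge> a"
  show "((\<lambda>x. u x * v' x - u' x * v x) has_vector_derivative 0) (at x within {a..})"
    using has_vector_derivative_diff[OF has_vector_derivative_mult[OF solD(1)[OF u x] solD(2)[OF v x]]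
        has_vector_derivative_mult[OF solD(2)[OF u x] solD(1)[OF v x]]]
    by (simp add: algebra_simps)
qed

definition fundamental_system where
  "fundamental_system a s u u' v v' \<longleftrightarrow> sol a s u u' \<and> sol a s v v' \<and> (\<forall>x\<ge>a. u x * v' x - u' x * v x = 1)
     \<and> u a = 1 \<and> u' a = 0 \<and> v a = 0 \<and> v' a = 1"

lemma fund_exists:
  assumes "continuous_on {a..} s"
  obtains u u' v v' where "fundamental_system a s u u' v v'"
proof -
  obtain u u' where u: "sol a s u u'" "u a = 1" "u' a = 0"
    using sol_exists[OF assms] .
  obtain v v' where v: "sol a s v v'" "v a = 0" "v' a = 1"
    using sol_exists[OF assms] .
  have "fundamental_system a s u u' v v'"
    using u v sol_wronskian[OF u(1) v(1)] by (simp add: fundamental_system_def)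
  then show thesis by (rule that)
qed

text \<open>The Wronskians of y with u and v are constant, hence given by the initial data, and they
  determine y because u and v have Wronskian 1. This also settles uniqueness for the initial value
  problem.\<close>

lemma fund_sol_eq:
  assumes f: "fundamental_system a s u u' v v'" and y: "sol a s y y'" and "x \<ge> a"
  shows "y x = y a * u x + y' a * v x"
proof -
  note u = f[unfolded fundamental_system_def, THEN conjunct1] and v = f[unfolded fundamental_system_def, THEN conjunct2, THEN conjunct1]
  have 1: "y x * u' x - y' x * u x = - y' a"
    using sol_wronskian[OF y u \<open>x \<ge> a\<close>] f by (simp add: fundamental_system_def)
  have 2: "y x * v' x - y' x * v x = y a"
    using sol_wronskian[OF y v \<open>x \<ge> a\<close>] f by (simp add: fundamental_system_def)
  have "y x = y x * (u x * v' x - u' x * v x)"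
    using f \<open>x \<ge> a\<close> by (simp add: fundamental_system_def)
  also have "\<dots> = u x * (y x * v' x - y' x * v x) - v x * (y x * u' x - y' x * u x)"
    by (simp add: algebra_simps)
  finally show ?thesis
    unfolding 1 2 by simp
qed

text \<open>Existence is available for data at a only, while the growing solution below needs data
  at a later point. Cramer's rule in a fundamental system, whose determinant is 1, supplies a
  solution on all of [a, \<infinity>).\<close>

lemma sol_exists_at:
  assumes s: "continuous_on {a..} s" and "b \<ge> a"
  obtains y y' where "sol a s y y'" "y b = c" "y' b = d"
proof -
  obtain u u' v v' where f: "fundamental_system a s u u' v v'"
    using fund_exists[OF s] .
  then have u: "sol a s u u'" and v: "sol a s v v'" and w: "u b * v' b - u' b * v b = 1"
    using \<open>b \<ge> a\<close> by (simp_all add: fundamental_system_def)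
  have "(c * v' b - d * v b) * u b + (d * u b - c * u' b) * v b = c * (u b * v' b - u' b * v b)"
       "(c * v' b - d * v b) * u' b + (d * u b - c * u' b) * v' b = d * (u b * v' b - u' b * v b)"
    by (simp_all add: algebra_simps)
  with w show thesis
    using that[OF sol_lincomb[OF u v, of "c * v' b - d * v b" "d * u b - c * u' b"]] by simp
qed

section \<open>Condition (C) and solutions of finite energy\<close>


lemma AC_loc_has_integral:
  fixes f :: "real \<Rightarrow> 'a::real_normed_vector"
  assumes "AC_loc a f" and ae: "AE x in lebesgue. x \<ge> a \<longrightarrow> (f has_vector_derivative g x) (at x within {a..})"
    and "a \<le> c" "c \<le> d"
  shows "(g has_integral (f d - f c)) {c..d}"
proof -
  obtain N where N: "N \<in> null_sets lebesgue"
    "{x \<in> space lebesgue. \<not> (x \<ge> a \<longrightarrow> (f has_vector_derivative g x) (at x within {a..}))} \<subseteq> N"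
    using ae unfolding eventually_ae_filter by blast
  show ?thesis
  proof (rule abs_cont_on_has_integral[OF \<open>c \<le> d\<close>])
    show "abs_cont_on c d f"
      using assms by (simp add: AC_loc_def)
    show "negligible N"
      using N(1) by (simp add: negligible_iff_null_sets)
    fix x
    assume x: "x \<in> {c..d} - N"
    then have "(f has_vector_derivative g x) (at x within {a..})"
      using subsetD[OF N(2), of x] \<open>a \<le> c\<close> by auto
    then show "(f has_vector_derivative g x) (at x within {c..d})"
      by (rule has_vector_derivative_within_subset) (use \<open>a \<le> c\<close> in auto)
  qed
qed

lemma AC_loc_C1:
  assumes der: "\<And>x. x \<ge> a \<Longrightarrow> (f has_vector_derivative f' x) (at x within {a..})"
    and cont: "continuous_on {a..} f'"
  shows "AC_loc a f"
  unfolding AC_loc_def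
proof (intro allI impI)
  fix c d :: real
  assume cd: "a \<le> c" "c \<le> d"
  show "abs_cont_on c d f"
  proof (rule abs_cont_on_C1)
    show "continuous_on {c..d} f'"
      by (rule continuous_on_subset[OF cont]) (use cd in auto)
    fix x
    assume "x \<in> {c..d}"
    then show "(f has_vector_derivative f' x) (at x within {c..d})"
      using cd by (intro has_vector_derivative_within_subset[OF der]) auto
  qed
qed

lemma lead_neq_0 [simp]: "lead \<phi> \<noteq> 0"
  by (simp add: lead_def)

lemma cmod_lead [simp]: "cmod (lead \<phi>) = 1"
  by (simp add: lead_def)

lemma s_fun_eq_iff:
  "- lead \<phi> * w + q x * v = lam * v \<longleftrightarrow> w = s_fun \<phi> q lam x * v"
proof -
  have "- lead \<phi> * w + q x * v = lam * v \<longleftrightarrow> lead \<phi> * w = (q x - lam) * v"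
    by (auto simp: algebra_simps)
  also have "\<dots> \<longleftrightarrow> w = s_fun \<phi> q lam x * v"
    by (auto simp: s_fun_def field_simps)
  finally show ?thesis .
qed

lemma continuous_on_s_fun:
  assumes "continuous_on A q"
  shows "continuous_on A (s_fun \<phi> q lam)"
  unfolding s_fun_def[abs_def] by (intro continuous_intros assms)

text \<open>The equation has continuous coefficients, so its Caratheodory solutions are classical.\<close>

lemma solution_iff_sol:
  assumes q: "continuous_on {a..} q"
  shows "solution a \<phi> q lam v \<longleftrightarrow> (\<exists>v'. sol a (s_fun \<phi> q lam) v v')"
proof
  let ?s = "s_fun \<phi> q lam"
  note s = continuous_on_s_fun[OF q, of \<phi> lam]
  {
    assume "\<exists>v'. sol a ?s v v'"
    then obtain v' where v: "sol a ?s v v'" ..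
    have "continuous_on {a..} (\<lambda>x. ?s x * v x)"
      by (intro continuous_intros s sol_continuous_on[OF v])
    then have "AC1_loc a v v' (\<lambda>x. ?s x * v x)"
      unfolding AC1_loc_def using AC_loc_C1[OF solD(1)[OF v]] AC_loc_C1[OF solD(2)[OF v]]
        sol_continuous_on[OF v] solD[OF v] by simp
    then show "solution a \<phi> q lam v"
      unfolding solution_def s_fun_eq_iff by (intro exI conjI) auto
  next
    assume "solution a \<phi> q lam v"
    then obtain v' v'' where v: "AC_loc a v" "AC_loc a v'"
      "\<And>x. x \<ge> a \<Longrightarrow> (v has_vector_derivative v' x) (at x within {a..})"
      and ae1: "AE x in lebesgue. x \<ge> a \<longrightarrow> (v' has_vector_derivative v'' x) (at x within {a..})"
      and ae2: "AE x in lebesgue. x \<ge> a \<longrightarrow> v'' x = ?s x * v x"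
      unfolding solution_def s_fun_eq_iff AC1_loc_def by blast
    have cont: "continuous_on {a..} (\<lambda>x. ?s x * v x)"
      by (intro continuous_intros s has_vector_derivative_atLeast_continuous_on[OF v(3)])
    have ae: "AE x in lebesgue. x \<ge> a \<longrightarrow> (v' has_vector_derivative ?s x * v x) (at x within {a..})"
      using ae1 ae2 by eventually_elim auto
    \<comment> \<open>Absolute continuity turns the equation almost everywhere into an integral
      equation with continuous integrand, which can be differentiated at every point.\<close>
    have eq: "v' x = v' a + integral {a..x} (\<lambda>x. ?s x * v x)" if "x \<in> {a..}" for x
      using AC_loc_has_integral[OF v(2) ae order_refl, of x] that by (simp add: has_integral_iff)
    have "sol a ?s v v'"
      unfolding sol_def
    proof (intro allI impI conjI v)
      fix x
      assume x: "x \<ge> a"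
      have "((\<lambda>x. v' a + integral {a..x} (\<lambda>x. ?s x * v x)) has_vector_derivative ?s x * v x) (at x within {a..})"
        using has_vector_derivative_add[OF has_vector_derivative_const[of "v' a"]
            integral_has_vector_derivative_atLeast[OF cont x]] by simp
      then show "(v' has_vector_derivative ?s x * v x) (at x within {a..})"
        by (rule has_vector_derivative_transform[OF _ eq, rotated 2]) (use x in auto)
    qed
    then show "\<exists>v'. sol a ?s v v'" by blast
  }
qed

lemma vector_derivative_atLeast:
  fixes t :: real
  assumes "(v has_vector_derivative d) (at t within {a..})" "t \<ge> a"
  shows "vector_derivative v (at t within {a..}) = d"
proof (rule vector_derivative_within[OF _ assms(1)])
  have "t islimpt {a..t + 1}"
    using assms(2) by (simp add: islimpt_Icc)
  then have "t islimpt {a..}"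
    by (rule islimpt_subset) auto
  then show "at t within {a..} \<noteq> bot"
    using trivial_limit_within by blast
qed

lemma in_L2_iff_fin_int:
  assumes "continuous_on {a..} v"
  shows "in_L2 a v \<longleftrightarrow> fin_int a (\<lambda>t. (cmod (v t))\<^sup>2)"
  unfolding in_L2_def by (intro absolutely_integrable_iff_fin_int continuous_intros assms) auto

lemma cond_C_iff_fin_int:
  assumes v: "sol a s v v'" and q: "continuous_on {a..} q"
    and P: "0 \<le> Re (cis \<theta> * lead \<phi>)" and R: "\<And>x. x \<ge> a \<Longrightarrow> 0 \<le> Re (cis \<theta> * (q x - K))"
  shows "cond_C a \<phi> q \<theta> K v \<longleftrightarrow> fin_int a (\<lambda>t. Re (cis \<theta> * lead \<phi>) * (cmod (v' t))\<^sup>2) \<and>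
     fin_int a (\<lambda>t. Re (cis \<theta> * (q t - K)) * (cmod (v t))\<^sup>2) \<and> fin_int a (\<lambda>t. (cmod (v t))\<^sup>2)"
proof -
  note c = sol_continuous_on[OF v]
  have "(\<integral>\<^sup>+t\<in>{a..}. ennreal (Re (cis \<theta> * lead \<phi>)
          * (cmod (vector_derivative v (at t within {a..})))\<^sup>2) \<partial>lebesgue)
      = (\<integral>\<^sup>+t\<in>{a..}. ennreal (Re (cis \<theta> * lead \<phi>) * (cmod (v' t))\<^sup>2) \<partial>lebesgue)"
    by (rule nn_integral_cong)
      (use vector_derivative_atLeast[OF solD(1)[OF v]] in \<open>auto simp: indicator_def\<close>)
  moreover have "(\<integral>\<^sup>+t\<in>{a..}. ennreal (Re (cis \<theta> * lead \<phi>) * (cmod (v' t))\<^sup>2) \<partial>lebesgue) < \<infinity>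
      \<longleftrightarrow> fin_int a (\<lambda>t. Re (cis \<theta> * lead \<phi>) * (cmod (v' t))\<^sup>2)"
    by (intro nn_integral_finite_iff_fin_int continuous_intros c mult_nonneg_nonneg P) auto
  moreover have "(\<integral>\<^sup>+t\<in>{a..}. ennreal (Re (cis \<theta> * (q t - K)) * (cmod (v t))\<^sup>2) \<partial>lebesgue) < \<infinity>
      \<longleftrightarrow> fin_int a (\<lambda>t. Re (cis \<theta> * (q t - K)) * (cmod (v t))\<^sup>2)"
    by (intro nn_integral_finite_iff_fin_int continuous_intros c q mult_nonneg_nonneg R) auto
  moreover have "(\<integral>\<^sup>+t\<in>{a..}. ennreal ((cmod (v t))\<^sup>2) \<partial>lebesgue) < \<infinity>
      \<longleftrightarrow> fin_int a (\<lambda>t. (cmod (v t))\<^sup>2)"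
    by (intro nn_integral_finite_iff_fin_int continuous_intros c) auto
  ultimately show ?thesis
    unfolding cond_C_def by (simp add: ennreal_add_less_top conj_assoc)
qed

lemma Qset_nonneg:
  assumes adm: "(\<theta>, K) \<in> admissible (Qset a \<phi> q)" and "x \<ge> a" "0 < r"
  shows "0 \<le> Re (cis \<theta> * (q x - K)) + r * Re (cis \<theta> * lead \<phi>)"
proof -
  have "q x + of_real r * lead \<phi> \<in> Qset a \<phi> q"
    unfolding Qset_def using assms(2,3)
    by (intro subsetD[OF closure_subset] hull_inc) auto
  then have "0 \<le> Re (cis \<theta> * (q x + of_real r * lead \<phi> - K))"
    using adm by (auto simp: admissible_def)
  then show ?thesis
    by (simp add: algebra_simps)
qed

text \<open>The set Q contains q(x) + r p for all r > 0. Letting r tend to infinity gives the sign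
  of the coefficient of r, letting r tend to 0 the sign of the constant term.\<close>

lemma admissible_nonneg:
  assumes adm: "(\<theta>, K) \<in> admissible (Qset a \<phi> q)"
  shows "0 \<le> Re (cis \<theta> * lead \<phi>)" "\<And>x. x \<ge> a \<Longrightarrow> 0 \<le> Re (cis \<theta> * (q x - K))"
proof -
  let ?P = "Re (cis \<theta> * lead \<phi>)"
  have "0 \<le> P" if "\<And>r. 0 < r \<Longrightarrow> 0 \<le> R + r * P" for R P :: real
  proof (rule ccontr)
    assume "\<not> 0 \<le> P"
    then have "0 < (\<bar>R\<bar> + 1) / (- P)" "(\<bar>R\<bar> + 1) / (- P) * P = - (\<bar>R\<bar> + 1)"
      by (simp_all add: divide_less_0_iff)
    then show False
      using that[of "(\<bar>R\<bar> + 1) / (- P)"] by linarith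
  qed
  then show "0 \<le> ?P"
    using Qset_nonneg[OF adm order_refl] by blast
  fix x
  assume "x \<ge> a"
  have "((\<lambda>r. Re (cis \<theta> * (q x - K)) + r * ?P) \<longlongrightarrow> Re (cis \<theta> * (q x - K)) + 0 * ?P) (at_right 0)"
    by (intro tendsto_intros)
  from tendsto_lowerbound[OF this _ trivial_limit_at_right_real]
  have "0 \<le> Re (cis \<theta> * (q x - K)) + 0 * ?P"
    if "\<forall>\<^sub>F r in at_right 0. 0 \<le> Re (cis \<theta> * (q x - K)) + r * ?P"
    using that .
  moreover have "\<forall>\<^sub>F r in at_right 0. 0 \<le> Re (cis \<theta> * (q x - K)) + r * ?P"
    using eventually_at_right_less[of "0::real"] by eventually_elim (rule Qset_nonneg[OF adm \<open>x \<ge> a\<close>])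
  ultimately show "0 \<le> Re (cis \<theta> * (q x - K))"
    by simp
qed

text \<open>Weyl's nesting argument: solutions with \<open>v'(X) = 0\<close> and normalised initial data have energy
  on \<open>[a, X]\<close> bounded independently of \<open>X\<close>; a limit point of their initial data gives a solution
  of finite energy.\<close>

lemma weyl_solution:
  assumes q: "continuous_on {a..} q"
    and P: "0 \<le> Re (cis \<theta> * lead \<phi>)" and R: "\<And>x. x \<ge> a \<Longrightarrow> 0 \<le> Re (cis \<theta> * (q x - K))"
    and \<mu>: "\<mu> \<in> half_plane K \<theta>"
  obtains v v' where "sol a (s_fun \<phi> q \<mu>) v v'" "v a \<noteq> 0 \<or> v' a \<noteq> 0"
    "cond_C a \<phi> q \<theta> K v"
proof -
  let ?s = "s_fun \<phi> q \<mu>"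
  define \<delta> where "\<delta> = - Re (cis \<theta> * (\<mu> - K))"
  have \<delta>: "\<delta> > 0"
    using \<mu> by (simp add: half_plane_def \<delta>_def)
  define h where "h v v' x = Re (cis \<theta> * lead \<phi>) * (cmod (v' x))\<^sup>2
      + Re (cis \<theta> * (q x - K)) * (cmod (v x))\<^sup>2 + \<delta> * (cmod (v x))\<^sup>2"
    for v v' :: "real \<Rightarrow> complex" and x
  \<comment> \<open>The boundary term that arises from multiplying the equation by e^(i theta) and
    the conjugate of v and integrating by parts. Its derivative is \<open>h\<close>, in which
    \<open>\<delta>\<close> is the distance of \<mu> from the line bounding the half plane.\<close>
  define E where "E v v' x = Re (cis \<theta> * lead \<phi> * (v' x * cnj (v x)))"
    for v v' :: "real \<Rightarrow> complex" and x
  have h_nonneg: "0 \<le> h v v' x" if "x \<ge> a" for v v' x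
    using P R[OF that] \<delta> by (simp add: h_def)
  have h_cont: "continuous_on {a..} (h v v')" if "sol a ?s v v'" for v v'
    unfolding h_def by (intro continuous_intros sol_continuous_on[OF that] q)
  have E_h: "integral {a..X} (h v v') = E v v' X - E v v' a" if v: "sol a ?s v v'" and "X \<ge> a" for v v' X
  proof (rule integral_unique, rule fundamental_theorem_of_calculus[OF \<open>X \<ge> a\<close>])
    fix x
    assume "x \<in> {a..X}"
    then have x: "x \<ge> a" by simp
    have cnj: "((\<lambda>x. cnj (v x)) has_vector_derivative cnj (v' x)) (at x within {a..})"
      by (rule bounded_linear.has_vector_derivative[OF bounded_linear_cnj solD(1)[OF v x]])
    have "((\<lambda>x. v' x * cnj (v x)) has_vector_derivative (v' x * cnj (v' x) + ?s x * v x * cnj (v x)))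
        (at x within {a..})"
      by (rule has_vector_derivative_mult[OF solD(2)[OF v x] cnj])
    from bounded_linear.has_vector_derivative[OF bounded_linear_Re 
        bounded_linear.has_vector_derivative[OF bounded_linear_mult_right[of "cis \<theta> * lead \<phi>"] this]]
    have "(E v v' has_vector_derivative
        Re (cis \<theta> * lead \<phi> * (v' x * cnj (v' x) + ?s x * v x * cnj (v x)))) (at x within {a..})"
      by (simp add: E_def[abs_def])
    moreover have "cis \<theta> * lead \<phi> * (v' x * cnj (v' x) + ?s x * v x * cnj (v x))
        = cis \<theta> * lead \<phi> * (v' x * cnj (v' x)) + cis \<theta> * ((q x - K) - (\<mu> - K)) * (v x * cnj (v x))"
      by (simp add: s_fun_def algebra_simps)
    then have "Re (cis \<theta> * lead \<phi> * (v' x * cnj (v' x) + ?s x * v x * cnj (v x))) = h v v' x"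
      unfolding complex_norm_square[symmetric] h_def \<delta>_def
      by (simp add: ring_distribs)
    ultimately have "(E v v' has_vector_derivative h v v' x) (at x within {a..})"
      by simp
    then show "(E v v' has_vector_derivative h v v' x) (at x within {a..X})"
      by (rule has_vector_derivative_within_subset) auto
  qed
  obtain u u' v v' where f: "fundamental_system a ?s u u' v v'"
    using fund_exists[OF continuous_on_s_fun[OF q]] .
  then have u: "sol a ?s u u'" and v: "sol a ?s v v'" 
    and W: "\<And>x. x \<ge> a \<Longrightarrow> u x * v' x - u' x * v x = 1" and ini: "u a = 1" "u' a = 0" "v a = 0" "v' a = 1"
    by (simp_all add: fundamental_system_def)
  define y where "y c x = fst c * u x + snd c * v x" for c x
  define y' where "y' c x = fst c * u' x + snd c * v' x" for c x
  have y: "sol a ?s (y c) (y' c)" for c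
    unfolding y_def y'_def by (rule sol_lincomb[OF u v])
  define F where "F c X = integral {a..X} (h (y c) (y' c))" for c X
  have F_mono: "F c X \<le> F c Y" if "a \<le> X" "X \<le> Y" for c X Y
    unfolding F_def using that h_nonneg 
    by (intro integral_subset_le continuous_on_imp_integrable[OF h_cont[OF y]]) auto
  have "\<exists>c. norm c = 1 \<and> F c (a + real n) \<le> 1" for n
  proof -
    define X where "X = a + real n"
    \<comment> \<open>These initial data make the derivative vanish at X, which removes the boundary
      term there; the boundary term at a is at most 1 in modulus after normalisation.\<close>
    define d where "d = (v' X, - u' X)"
    have "X \<ge> a" by (simp add: X_def)
    then have "d \<noteq> 0"
      using W[of X] by (auto simp: d_def zero_prod_def)
    define c where "c = (1 / norm d) *\<^sub>R d"
    have c: "norm c = 1"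
      using \<open>d \<noteq> 0\<close> by (simp add: c_def)
    have "y' c X = 0"
      by (simp add: y'_def c_def d_def)
    then have "F c X = - Re (cis \<theta> * lead \<phi> * (snd c * cnj (fst c)))"
      using E_h[OF y \<open>X \<ge> a\<close>, of c] by (simp add: F_def E_def y_def y'_def ini)
    also have "\<dots> \<le> cmod (cis \<theta> * lead \<phi> * (snd c * cnj (fst c)))"
      using abs_Re_le_cmod[of "cis \<theta> * lead \<phi> * (snd c * cnj (fst c))"] by linarith
    also have "\<dots> = cmod (snd c) * cmod (fst c)"
      by (simp add: norm_mult)
    also have "\<dots> \<le> 1 * 1"
      using norm_fst_le[of "fst c" "snd c"] norm_snd_le[of "snd c" "fst c"] c
      by (intro mult_mono) auto
    finally show ?thesis
      using c unfolding X_def by (intro exI[of _ c] conjI) simp_all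
  qed
  then obtain c where c: "\<And>n. norm (c n) = 1" "\<And>n. F (c n) (a + real n) \<le> 1"
    by metis
  have "\<forall>n. c n \<in> sphere 0 1"
    using c(1) by simp
  then obtain l r where lr: "l \<in> sphere 0 1" "strict_mono r" "(c \<circ> r) \<longlonglongrightarrow> l"
    using compact_sphere[of "0::complex \<times> complex" 1] unfolding compact_def by metis
  have "F l X \<le> 1" if X: "X \<ge> a" for X
  proof (rule LIMSEQ_le_const2)
    \<comment> \<open>Written as a difference of boundary terms, the energy on a fixed interval is
      visibly continuous in the initial data, so no limit has to be taken under the
      integral.\<close>
    have F_eq: "F d X = Re (cis \<theta> * lead \<phi> * ((fst d * u' X + snd d * v' X) * cnj (fst d * u X + snd d * v X)))
        - Re (cis \<theta> * lead \<phi> * (snd d * cnj (fst d)))" for d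
      using E_h[OF y X, of d] by (simp add: F_def E_def y_def y'_def ini)
    show "(\<lambda>n. F ((c \<circ> r) n) X) \<longlonglongrightarrow> F l X"
      unfolding F_eq by (intro tendsto_intros lr)
    obtain N where N: "X - a \<le> real N"
      using real_arch_simple by blast
    show "\<exists>N. \<forall>n\<ge>N. F ((c \<circ> r) n) X \<le> 1"
    proof (intro exI allI impI)
      fix n
      assume "n \<ge> N"
      then have "N \<le> r n"
        using seq_suble[OF lr(2), of n] by simp
      then have "X \<le> a + real (r n)"
        using N by linarith
      from F_mono[OF X this, of "c (r n)"] c(2)[of "r n"] show "F ((c \<circ> r) n) X \<le> 1"
        by simp
    qed
  qed
  then have fin: "fin_int a (h (y l) (y' l))"
    unfolding fin_int_def F_def by blast
  note co = sol_continuous_on[OF y, of l]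
  have "cond_C a \<phi> q \<theta> K (y l)"
  proof (subst cond_C_iff_fin_int[OF y q P], erule R, intro conjI)
    show "fin_int a (\<lambda>t. Re (cis \<theta> * lead \<phi>) * (cmod (y' l t))\<^sup>2)"
      by (rule fin_int_mono[OF _ _ h_cont[OF y] h_nonneg _ _ fin, where C = 1])
        (use P R \<delta> less_imp_le[OF \<delta>] in \<open>auto intro!: continuous_intros co eventually_at_top_linorderI[of a] simp: h_def\<close>)
    show "fin_int a (\<lambda>t. Re (cis \<theta> * (q t - K)) * (cmod (y l t))\<^sup>2)"
      by (rule fin_int_mono[OF _ _ h_cont[OF y] h_nonneg _ _ fin, where C = 1])
        (use P R \<delta> in \<open>auto intro!: continuous_intros co q eventually_at_top_linorderI[of a] simp: h_def\<close>)
    show "fin_int a (\<lambda>t. (cmod (y l t))\<^sup>2)"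
    proof (rule fin_int_mono[OF _ _ h_cont[OF y] h_nonneg _ _ fin, where C = "1 / \<delta>"])
      have "(cmod (y l x))\<^sup>2 \<le> 1 / \<delta> * h (y l) (y' l) x" if "x \<ge> a" for x
      proof -
        have "\<delta> * (cmod (y l x))\<^sup>2 \<le> h (y l) (y' l) x"
          unfolding h_def using mult_nonneg_nonneg[OF P zero_le_power2[of "cmod (y' l x)"]]
            mult_nonneg_nonneg[OF R[OF that] zero_le_power2[of "cmod (y l x)"]] by linarith
        then show ?thesis
          using \<delta> by (simp add: pos_le_divide_eq mult.commute)
      qed
      then show "\<forall>\<^sub>F x in at_top. (cmod (y l x))\<^sup>2 \<le> 1 / \<delta> * h (y l) (y' l) x"
        by (rule eventually_at_top_linorderI)
    qed (use \<delta> in \<open>auto intro!: continuous_intros co\<close>)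
  qed
  moreover have "y l a \<noteq> 0 \<or> y' l a \<noteq> 0"
    using lr(1) by (cases l) (auto simp: y_def y'_def ini)
  ultimately show thesis
    using that[OF y] by blast
qed

section \<open>Perturbation by a constant\<close>


lemma has_integral_norm_le:
  fixes g :: "real \<Rightarrow> 'a::banach"
  assumes "(g has_integral d) {b..x}" "k integrable_on {b..x}"
    and "\<And>t. t \<in> {b..x} \<Longrightarrow> norm (g t) \<le> M * k t"
  shows "norm d \<le> M * integral {b..x} k"
proof -
  have "norm (integral {b..x} g) \<le> integral {b..x} (\<lambda>t. M * k t)"
    using assms by (intro integral_norm_bound_integral integrable_on_mult_right) auto
  then show ?thesis
    using assms(1) by (simp add: integral_unique)
qed

text \<open>Variation of constants: w = u A2 - v A1, where the Wronskians A1 and A2 of w with u and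
  v have derivatives -\<kappa> w u and -\<kappa> w v. These are bounded by |\<kappa>| k T with k
  integrable, so from a suitable point on the growth of T = |A1| + |A2| can be absorbed and T stays
  bounded. The conclusion is pointwise, which makes it usable under any weight.\<close>

lemma perturbed_sol_bound:
  assumes s2: "\<And>x. x \<ge> a \<Longrightarrow> s2 x = s1 x + \<kappa>"
    and f: "fundamental_system a s1 u u' v v'" and w: "sol a s2 w w'"
    and fu: "fin_int a (\<lambda>x. (cmod (u x))\<^sup>2)" and fv: "fin_int a (\<lambda>x. (cmod (v x))\<^sup>2)"
  shows "\<exists>C\<ge>0. \<forall>\<^sub>F x in at_top. (cmod (w x))\<^sup>2 \<le> C * ((cmod (u x))\<^sup>2 + (cmod (v x))\<^sup>2)"
proof -
  have u: "sol a s1 u u'" and v: "sol a s1 v v'" and W: "\<And>x. x \<ge> a \<Longrightarrow> u x * v' x - u' x * v x = 1"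
    using f by (simp_all add: fundamental_system_def)
  note cu = sol_continuous_on[OF u] and cv = sol_continuous_on[OF v] and cw = sol_continuous_on[OF w]
  define A1 where "A1 x = w x * u' x - w' x * u x" for x
  define A2 where "A2 x = w x * v' x - w' x * v x" for x
  define T where "T x = cmod (A1 x) + cmod (A2 x)" for x
  \<comment> \<open>The factor 2 comes from (|u| + |v|)^2 \<le> 2 (|u|^2 + |v|^2).\<close>
  define k where "k x = 2 * ((cmod (u x))\<^sup>2 + (cmod (v x))\<^sup>2)" for x
  have contk: "continuous_on {a..} k"
    unfolding k_def by (intro continuous_intros cu cv)
  have contT: "continuous_on {a..} T"
    unfolding T_def A1_def A2_def by (intro continuous_intros cu cv cw)
  have A_int: "((\<lambda>x. - \<kappa> * w x * y x) has_integral
      (w x * y' x - w' x * y x - (w b * y' b - w' b * y b))) {b..x}"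
    if y: "sol a s1 y y'" and "a \<le> b" "b \<le> x" for y y' b x
  proof (rule fundamental_theorem_of_calculus[OF \<open>b \<le> x\<close>])
    fix t
    assume "t \<in> {b..x}"
    then have t: "t \<ge> a"
      using \<open>a \<le> b\<close> by simp
    have "((\<lambda>x. w x * y' x - w' x * y x) has_vector_derivative - \<kappa> * w t * y t) (at t within {a..})"
      using has_vector_derivative_diff[OF has_vector_derivative_mult[OF solD(1)[OF w t] solD(2)[OF y t]]
          has_vector_derivative_mult[OF solD(2)[OF w t] solD(1)[OF y t]]]
      by (simp add: s2[OF t] algebra_simps)
    then show "((\<lambda>x. w x * y' x - w' x * y x) has_vector_derivative - \<kappa> * w t * y t) (at t within {b..x})"
      by (rule has_vector_derivative_within_subset) (use \<open>a \<le> b\<close> in auto)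
  qed
  have U_le: "(cmod (u x) + cmod (v x))\<^sup>2 \<le> k x" for x
    using sum_squares_bound[of "cmod (u x)" "cmod (v x)"]
    by (simp add: k_def power2_sum)
  have wT: "cmod (w x) \<le> (cmod (u x) + cmod (v x)) * T x" if "x \<ge> a" for x
  proof -
    have "w x = w x * (u x * v' x - u' x * v x)"
      using W[OF that] by simp
    also have "\<dots> = u x * A2 x - v x * A1 x"
      by (simp add: A1_def A2_def algebra_simps)
    finally have "cmod (w x) \<le> cmod (u x) * cmod (A2 x) + cmod (v x) * cmod (A1 x)"
      using norm_triangle_ineq4[of "u x * A2 x" "v x * A1 x"] by (simp add: norm_mult)
    also have "\<dots> \<le> (cmod (u x) + cmod (v x)) * T x"
      by (simp add: T_def algebra_simps)
    finally show ?thesis .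
  qed
  have "fin_int a (\<lambda>x. (cmod (u x))\<^sup>2 + (cmod (v x))\<^sup>2)"
    by (intro fin_int_add fu fv continuous_intros cu cv)
  then have fk: "fin_int a k"
    by (rule fin_int_mono[where C = 2, rotated -1])
      (use contk in \<open>auto simp: k_def intro!: continuous_intros cu cv\<close>)
  \<comment> \<open>A quarter of the maximum for each of the two Wronskians gives the half that
    \<open>le_absorb\<close> admits; the summand 1 covers \<kappa> = 0.\<close>
  have eps: "1 / (4 * (cmod \<kappa> + 1)) > 0"
    by (simp add: add_nonneg_pos)
  have k0: "0 \<le> k x" for x
    by (simp add: k_def)
  obtain b where b: "b \<ge> a" "\<And>X. X \<ge> b \<Longrightarrow> integral {b..X} k \<le> 1 / (4 * (cmod \<kappa> + 1))"
    by (rule fin_int_tail[OF continuous_on_imp_integrable[OF contk order_refl] k0 fk eps]) blast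
  have T_le: "T x \<le> 2 * T b" if "x \<ge> b" for x
  proof (rule le_absorb[OF _ _ that])
    show "continuous_on {b..} T"
      by (rule continuous_on_subset[OF contT]) (use b in auto)
    fix X M x
    assume M: "\<And>y. y \<in> {b..X} \<Longrightarrow> T y \<le> M" and x: "x \<in> {b..X}"
    have "0 \<le> M"
      using M[OF x] norm_ge_zero[of "A1 x"] norm_ge_zero[of "A2 x"] unfolding T_def by linarith
    have inc: "cmod ((w x * y' x - w' x * y x) - (w b * y' b - w' b * y b)) \<le> M / 4"
      if y: "sol a s1 y y'" and yk: "\<And>t. cmod (y t) \<le> cmod (u t) + cmod (v t)" for y y'
    proof -
      have "cmod ((w x * y' x - w' x * y x) - (w b * y' b - w' b * y b))
          \<le> cmod \<kappa> * M * integral {b..x} k"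
      proof (rule has_integral_norm_le[OF A_int[OF y]])
        fix t
        assume t: "t \<in> {b..x}"
        have "cmod (w t) \<le> (cmod (u t) + cmod (v t)) * M"
          using t x b M[of t] by (intro order_trans[OF wT mult_left_mono]) auto
        then have "cmod (w t) * cmod (y t) \<le> (cmod (u t) + cmod (v t)) * M * (cmod (u t) + cmod (v t))"
          using yk \<open>0 \<le> M\<close> by (intro mult_mono) auto
        also have "\<dots> = M * (cmod (u t) + cmod (v t))\<^sup>2"
          by (simp add: power2_eq_square)
        also have "\<dots> \<le> M * k t"
          using U_le \<open>0 \<le> M\<close> by (rule mult_left_mono)
        finally have "cmod \<kappa> * (cmod (w t) * cmod (y t)) \<le> cmod \<kappa> * (M * k t)"
          by (rule mult_left_mono) simp
        then show "cmod (- \<kappa> * w t * y t) \<le> cmod \<kappa> * M * k t"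
          by (simp add: norm_mult mult.assoc)
      qed (use b x continuous_on_imp_integrable[OF contk] in auto)
      also have "\<dots> \<le> cmod \<kappa> * M * (1 / (4 * (cmod \<kappa> + 1)))"
        using b(2)[of x] x \<open>0 \<le> M\<close> by (intro mult_left_mono) auto
      also have "\<dots> = (cmod \<kappa> / (cmod \<kappa> + 1)) * (M / 4)"
        by (simp add: field_simps)
      also have "\<dots> \<le> 1 * (M / 4)"
        using \<open>0 \<le> M\<close> by (intro mult_right_mono) (auto simp: add_nonneg_pos)
      finally show ?thesis by simp
    qed
    have "cmod (A1 x - A1 b) \<le> M / 4" "cmod (A2 x - A2 b) \<le> M / 4"
      unfolding A1_def A2_def by (intro inc u v; simp)+
    moreover have "cmod (A1 x) \<le> cmod (A1 b) + cmod (A1 x - A1 b)" "cmod (A2 x) \<le> cmod (A2 b) + cmod (A2 x - A2 b)"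
      by (metis add.commute diff_add_cancel norm_triangle_ineq)+
    ultimately show "T x \<le> T b + M / 2"
      by (simp add: T_def)
  qed
  have "(cmod (w x))\<^sup>2 \<le> 8 * (T b)\<^sup>2 * ((cmod (u x))\<^sup>2 + (cmod (v x))\<^sup>2)" if "x \<ge> b" for x
  proof -
    have "(cmod (w x))\<^sup>2 \<le> ((cmod (u x) + cmod (v x)) * T x)\<^sup>2"
      using wT[of x] b that by (intro power_mono) auto
    also have "\<dots> = (cmod (u x) + cmod (v x))\<^sup>2 * (T x)\<^sup>2"
      by (rule power_mult_distrib)
    also have "\<dots> \<le> k x * (2 * T b)\<^sup>2"
      using T_le[OF that] U_le[of x] by (intro mult_mono power_mono) (auto simp: k_def T_def)
    finally show ?thesis
      by (simp add: k_def algebra_simps power_mult_distrib)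
  qed
  then have "\<forall>\<^sub>F x in at_top. (cmod (w x))\<^sup>2 \<le> 8 * (T b)\<^sup>2 * ((cmod (u x))\<^sup>2 + (cmod (v x))\<^sup>2)"
    by (rule eventually_at_top_linorderI)
  then show ?thesis
    by (intro exI[of _ "8 * (T b)\<^sup>2"]) simp
qed

text \<open>The common form of the two properties that decide the classification: weight 1 expresses
  membership in L^2, and if Re (e^(i theta) p) = 0 then the weight Re (e^(i theta) (q - K)) + 1
  expresses (C).\<close>

definition all_fin :: "real \<Rightarrow> (real \<Rightarrow> complex) \<Rightarrow> (real \<Rightarrow> real) \<Rightarrow> bool" where
  "all_fin a s W \<longleftrightarrow> (\<forall>y y'. sol a s y y' \<longrightarrow> fin_int a (\<lambda>x. W x * (cmod (y x))\<^sup>2))"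

text \<open>Unweighted square integrability gives the pointwise domination by the fundamental
  solutions of the first equation; multiplying it by W transfers the weighted integrals.\<close>

lemma all_fin_perturb:
  assumes s1: "continuous_on {a..} s1" and s2: "\<And>x. x \<ge> a \<Longrightarrow> s2 x = s1 x + \<kappa>"
    and W: "continuous_on {a..} W" "\<And>x. x \<ge> a \<Longrightarrow> 0 \<le> W x"
    and L2: "all_fin a s1 (\<lambda>_. 1)" and fin: "all_fin a s1 W"
  shows "all_fin a s2 W"
  unfolding all_fin_def
proof (intro allI impI)
  fix w w'
  assume w: "sol a s2 w w'"
  obtain u u' v v' where f: "fundamental_system a s1 u u' v v'"
    using fund_exists[OF s1] .
  then have u: "sol a s1 u u'" and v: "sol a s1 v v'"
    by (simp_all add: fundamental_system_def)
  note cu = sol_continuous_on[OF u] and cv = sol_continuous_on[OF v] and cw = sol_continuous_on[OF w]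
  have L: "fin_int a (\<lambda>x. (cmod (u x))\<^sup>2)" "fin_int a (\<lambda>x. (cmod (v x))\<^sup>2)"
    using L2 u v by (auto simp: all_fin_def)
  obtain C where C: "C \<ge> 0" "\<forall>\<^sub>F x in at_top. (cmod (w x))\<^sup>2 \<le> C * ((cmod (u x))\<^sup>2 + (cmod (v x))\<^sup>2)"
    using perturbed_sol_bound[OF s2 f w L] by blast
  have "fin_int a (\<lambda>x. W x * (cmod (u x))\<^sup>2 + W x * (cmod (v x))\<^sup>2)"
    using fin u v by (intro fin_int_add continuous_intros W cu cv) (auto simp: all_fin_def)
  then show "fin_int a (\<lambda>x. W x * (cmod (w x))\<^sup>2)"
  proof (rule fin_int_mono[rotated -1])
    show "\<forall>\<^sub>F x in at_top. W x * (cmod (w x))\<^sup>2 \<le> C * (W x * (cmod (u x))\<^sup>2 + W x * (cmod (v x))\<^sup>2)"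
      using C(2) eventually_ge_at_top[of a]
    proof eventually_elim
      case (elim x)
      have "W x * (cmod (w x))\<^sup>2 \<le> W x * (C * ((cmod (u x))\<^sup>2 + (cmod (v x))\<^sup>2))"
        using elim W(2) by (intro mult_left_mono) auto
      then show ?case
        by (simp add: algebra_simps)
    qed
  qed (use C W cu cv cw in \<open>auto intro!: continuous_intros\<close>)
qed

section \<open>Liouville--Green asymptotics\<close>


lemma abs_cont_on_continuous_on:
  assumes "abs_cont_on c d f"
  shows "continuous_on {c..d} f"
  unfolding continuous_on_iff
proof (intro ballI allI impI)
  fix x e :: real
  assume x: "x \<in> {c..d}" and "e > 0"
  obtain r where r: "r > 0" "\<And>D. finite D \<Longrightarrow> (\<And>I. I \<in> D \<Longrightarrow> c \<le> fst I \<and> fst I \<le> snd I \<and> snd I \<le> d) \<Longrightarrow>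
        pairwise (\<lambda>I J. {fst I<..<snd I} \<inter> {fst J<..<snd J} = {}) D \<Longrightarrow>
        (\<Sum>I\<in>D. snd I - fst I) < r \<Longrightarrow> (\<Sum>I\<in>D. norm (f (snd I) - f (fst I))) < e"
    using abs_cont_onE[OF assms \<open>e > 0\<close>] by blast
  have "dist (f y) (f x) < e" if y: "y \<in> {c..d}" "dist y x < r" for y
  proof -
    have key: "norm (f v - f u) < e" if "c \<le> u" "u \<le> v" "v \<le> d" "v - u < r" for u v
      using r(2)[of "{(u, v)}"] that by simp
    show ?thesis
      using key[of x y] key[of y x] x y
      by (cases "x \<le> y") (auto simp: dist_norm norm_minus_commute)
  qed
  with r(1) show "\<exists>r>0. \<forall>y\<in>{c..d}. dist y x < r \<longrightarrow> dist (f y) (f x) < e"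
    by blast
qed

lemma AC_loc_continuous_on:
  assumes "AC_loc a f"
  shows "continuous_on {a..} f"
proof (rule continuous_on_atLeastI)
  fix T
  show "continuous_on {a..T} f"
  proof (cases "a \<le> T")
    case True
    then have "abs_cont_on a T f"
      using assms by (simp add: AC_loc_def)
    then show ?thesis by (rule abs_cont_on_continuous_on)
  qed simp
qed

lemma AC_loc_add: "AC_loc a f \<Longrightarrow> AC_loc a g \<Longrightarrow> AC_loc a (\<lambda>x. f x + g x)"
  by (simp add: AC_loc_def abs_cont_on_add)

lemma AC_loc_mult:
  fixes f g :: "real \<Rightarrow> 'a::real_normed_algebra"
  shows "AC_loc a f \<Longrightarrow> AC_loc a g \<Longrightarrow> AC_loc a (\<lambda>x. f x * g x)"
  by (simp add: AC_loc_def abs_cont_on_mult abs_cont_on_continuous_on)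

lemma AC_loc_const: "AC_loc a (\<lambda>_. c)"
  by (rule AC_loc_C1[where f' = "\<lambda>_. 0"]) auto

text \<open>Here \<rho> = s^(1/2), p = s', w = s'', and the left-hand side is the Riccati defect m'
  + m^2 - s of m = e \<rho> - s' / (4 s), the logarithmic derivative of a Liouville-Green function.
  The terms linear in e cancel, and 5/16 is 1/4 from m' plus 1/16 from m^2.\<close>

lemma liouville_green_identity:
  fixes \<rho> p w e :: complex
  assumes "\<rho> \<noteq> 0"
  shows "e * (p / (2 * \<rho>)) - (p * - (p / (\<rho>\<^sup>2)\<^sup>2) + w * inverse (\<rho>\<^sup>2)) / 4 + (e * \<rho> - p / (4 * \<rho>\<^sup>2))\<^sup>2 - \<rho>\<^sup>2
    = (e\<^sup>2 - 1) * \<rho>\<^sup>2 + (5 * p\<^sup>2 / (16 * \<rho> ^ 5) - w / (4 * \<rho> ^ 3)) * \<rho>"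
proof -
  define i where "i = inverse \<rho>"
  have i: "\<rho> * i = 1" using assms by (simp add: i_def)
  have "e * (p * i / 2) - (p * - (p * i^4) + w * i^2) / 4 + (e * \<rho> - p * i^2 / 4)^2 - \<rho>^2 
    = (e\<^sup>2 - 1) * \<rho>\<^sup>2 + (5 * p\<^sup>2 * i^5 / 16  - w * i^3 / 4) * \<rho>"
    using i by algebra
  moreover have "p / (2 * \<rho>) = p * i / 2" "p / (\<rho>\<^sup>2)\<^sup>2 = p * i ^ 4" "inverse (\<rho>\<^sup>2) = i\<^sup>2" "p / (4 * \<rho>\<^sup>2) = p * i\<^sup>2 / 4" "5 * p\<^sup>2 / (16 * \<rho> ^ 5) = 5 * p\<^sup>2 * i ^ 5 / 16" "w / (4 * \<rho> ^ 3) = w * i ^ 3 / 4"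
    using assms by (simp_all add: i_def field_simps)
  ultimately show ?thesis by (simp only:)
qed

text \<open>Principal powers of \<open>s\<close> are differentiable because \<open>s\<close> avoids the cut \<open>(-\<infinity>, 0]\<close>.\<close>

locale liouville_green =
  fixes a :: real and s s' s'' :: "real \<Rightarrow> complex" and \<psi> :: "real \<Rightarrow> complex"
  assumes ac: "AC1_loc a s s' s''"
    and cut: "\<And>x. x \<ge> a \<Longrightarrow> s x \<notin> \<real>\<^sub>\<le>\<^sub>0"
    and \<psi>_def: "\<And>x. \<psi> x = 5 * (s' x)\<^sup>2 / (16 * csqrt (s x) ^ 5) - s'' x / (4 * csqrt (s x) ^ 3)"
    and \<psi>_int: "\<psi> absolutely_integrable_on {a..}"
begin

text \<open>\<open>Y 1\<close> and \<open>Y (-1)\<close> are the Liouville--Green functions \<open>s\<^bsup>-1/4\<^esup> e\<^bsup>\<plusminus>\<zeta>\<^esup>\<close>, \<open>m\<close> their logarithmic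
  derivatives, \<open>G y y' \<epsilon>\<close> the Wronskian of \<open>y\<close> and \<open>Y \<epsilon>\<close>, and \<open>g\<close> is \<open>|Y 1|\<^sup>2\<close>.\<close>

definition r where "r x = csqrt (s x)"
definition \<zeta> where "\<zeta> x = integral {a..x} r"
definition m where "m \<epsilon> x = \<epsilon> * r x - s' x / (4 * s x)" for \<epsilon> :: complex
definition Y where "Y \<epsilon> x = exp (\<epsilon> * \<zeta> x - Ln (s x) / 4)" for \<epsilon> :: complex
definition G where "G y y' \<epsilon> x = Y \<epsilon> x * (m \<epsilon> x * y x - y' x)"
  for y y' :: "real \<Rightarrow> complex" and \<epsilon> :: complex
definition g where "g x = exp (2 * integral {a..x} (\<lambda>t. Re (r t))) / sqrt (cmod (s x))"

lemma s_der: "x \<ge> a \<Longrightarrow> (s has_vector_derivative s' x) (at x within {a..})"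
  using ac by (simp add: AC1_loc_def)

lemma s_cont: "continuous_on {a..} s"
  using s_der by (rule has_vector_derivative_atLeast_continuous_on)

lemma s'_ac: "AC_loc a s'"
  using ac by (simp add: AC1_loc_def)

lemma s'_cont: "continuous_on {a..} s'"
  using s'_ac by (rule AC_loc_continuous_on)

lemma s_nz: "x \<ge> a \<Longrightarrow> s x \<noteq> 0"
  using cut by fastforce

lemma r_sq: "(r x)\<^sup>2 = s x"
  by (simp add: r_def)

lemma r_nz: "x \<ge> a \<Longrightarrow> r x \<noteq> 0"
  using s_nz by (simp add: r_def)

lemma Re_r_pos:
  assumes "x \<ge> a"
  shows "0 < Re (r x)"
proof (rule ccontr)
  assume "\<not> 0 < Re (r x)"
  then have "Re (r x) = 0"
    using csqrt_principal[of "s x"] unfolding r_def by blast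
  moreover have sx: "s x = r x * r x"
    using r_sq[of x] by (simp only: power2_eq_square)
  ultimately have "Re (s x) = - (Im (r x) * Im (r x))" "Im (s x) = 0"
    unfolding sx times_complex.sel by simp_all
  then have "Re (s x) \<le> 0" "Im (s x) = 0"
    using zero_le_square[of "Im (r x)"] by linarith+
  then show False
    using cut[OF assms] unfolding complex_nonpos_Reals_iff by blast
qed

lemma r_der:
  assumes x: "x \<ge> a"
  shows "(r has_vector_derivative s' x / (2 * r x)) (at x within {a..})"
proof -
  have "((csqrt \<circ> s) has_vector_derivative s' x * inverse (2 * csqrt (s x))) (at x within {a..})"
    by (rule field_vector_diff_chain_within[OF s_der[OF x]
        has_field_derivative_csqrt[OF cut[OF x], THEN has_field_derivative_at_within]])
  moreover have "csqrt \<circ> s = r"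
    by (simp add: fun_eq_iff r_def)
  ultimately show ?thesis
    unfolding divide_inverse by (simp only: r_def)
qed

lemma r_cont: "continuous_on {a..} r"
  using r_der by (rule has_vector_derivative_atLeast_continuous_on)

lemma \<zeta>_der: "x \<ge> a \<Longrightarrow> (\<zeta> has_vector_derivative r x) (at x within {a..})"
  using integral_has_vector_derivative_atLeast[OF r_cont] by (simp add: \<zeta>_def[abs_def])

lemma Y_der: 
  assumes x: "x \<ge> a"
  shows "(Y \<epsilon> has_vector_derivative m \<epsilon> x * Y \<epsilon> x) (at x within {a..})"
proof -
  have "((\<lambda>x. Ln (s x)) has_vector_derivative s' x / s x) (at x within {a..})"
    using field_vector_diff_chain_within[OF s_der[OF x] has_field_derivative_Ln[OF cut[OF x], THEN has_field_derivative_at_within]]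
    unfolding o_def divide_inverse .
  from bounded_linear.has_vector_derivative[OF bounded_linear_divide[of 4] this]
  have "((\<lambda>x. Ln (s x) / 4) has_vector_derivative s' x / s x / 4) (at x within {a..})" .
  from has_vector_derivative_diff[OF bounded_linear.has_vector_derivative[OF bounded_linear_mult_right \<zeta>_der[OF x]] this]
  have "((\<lambda>x. \<epsilon> * \<zeta> x - Ln (s x) / 4) has_vector_derivative m \<epsilon> x) (at x within {a..})"
    by (simp add: m_def mult.commute)
  from field_vector_diff_chain_within[OF this DERIV_exp[THEN has_field_derivative_at_within]]
  show ?thesis
    by (simp add: o_def Y_def[abs_def])
qed

lemma Y_nz [simp]: "Y \<epsilon> x \<noteq> 0"
  by (simp add: Y_def)

lemma inverse_s_der:
  assumes x: "x \<ge> a"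
  shows "((\<lambda>x. inverse (s x)) has_vector_derivative - (s' x / (s x)\<^sup>2)) (at x within {a..})"
  using field_vector_diff_chain_within[OF s_der[OF x] DERIV_inverse[OF s_nz[OF x]], unfolded o_def]
  by (simp add: power2_eq_square field_simps)

lemma m_cont: "continuous_on {a..} (m \<epsilon>)"
  unfolding m_def by (intro continuous_intros r_cont s'_cont s_cont) (use s_nz in auto)

text \<open>All ingredients are continuously differentiable except s', which is only absolutely
  continuous. It enters \<open>m\<close> through a product with 1 / s, so the closure under sums and
  products suffices.\<close>

lemma G_AC:
  assumes y: "sol a s y y'"
  shows "AC_loc a (G y y' \<epsilon>)"
proof -
  have 1: "AC_loc a y" "AC_loc a y'"
    by (rule AC_loc_C1[OF solD(1)[OF y]], simp, rule sol_continuous_on[OF y])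
       (rule AC_loc_C1[OF solD(2)[OF y]], simp, intro continuous_intros sol_continuous_on[OF y] s_cont)
  have 2: "AC_loc a r"
    by (rule AC_loc_C1[OF r_der]) (use r_nz in \<open>auto intro!: continuous_intros s'_cont r_cont\<close>)
  have 3: "AC_loc a (Y \<epsilon>)"
    by (rule AC_loc_C1[OF Y_der])
      (auto intro!: continuous_intros m_cont has_vector_derivative_atLeast_continuous_on[OF Y_der])
  have 4: "AC_loc a (\<lambda>x. inverse (s x))"
    by (rule AC_loc_C1[OF inverse_s_der]) (use s_nz in \<open>auto intro!: continuous_intros s'_cont s_cont\<close>)
  have "G y y' \<epsilon> = (\<lambda>x. Y \<epsilon> x * ((\<epsilon> * r x + (- 1 / 4) * (s' x * inverse (s x))) * y x + (-1) * y' x))"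
    by (simp add: fun_eq_iff G_def m_def field_simps)
  then show ?thesis
    by (simp only:) (intro AC_loc_mult AC_loc_add AC_loc_const s'_ac 1 2 3 4)
qed

text \<open>By the Riccati identity \<open>Y \<epsilon>\<close> solves Y'' = (s + \<psi> r) Y almost
  everywhere, and \<open>G\<close> equals Y' y - Y y'. Its derivative therefore retains only the
  defect \<psi> r Y y.\<close>

lemma G_has_integral:
  assumes y: "sol a s y y'" and \<epsilon>: "\<epsilon>\<^sup>2 = 1" and "a \<le> c" "c \<le> d"
  shows "((\<lambda>x. \<psi> x * r x * Y \<epsilon> x * y x) has_integral (G y y' \<epsilon> d - G y y' \<epsilon> c)) {c..d}"
proof (rule AC_loc_has_integral[OF G_AC[OF y] _ \<open>a \<le> c\<close> \<open>c \<le> d\<close>])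
  have "AE x in lebesgue. x \<ge> a \<longrightarrow> (s' has_vector_derivative s'' x) (at x within {a..})"
    using ac by (simp add: AC1_loc_def)
  then show "AE x in lebesgue. x \<ge> a \<longrightarrow>
      (G y y' \<epsilon> has_vector_derivative \<psi> x * r x * Y \<epsilon> x * y x) (at x within {a..})"
  proof eventually_elim
    case (elim x)
    show ?case
    proof
      assume x: "x \<ge> a"
      with elim have s': "(s' has_vector_derivative s'' x) (at x within {a..})" by simp
      define m' where "m' = \<epsilon> * (s' x / (2 * r x)) - (s' x * - (s' x / (s x)\<^sup>2) + s'' x * inverse (s x)) / 4"
      from bounded_linear.has_vector_derivative[OF bounded_linear_divide[of 4]
          has_vector_derivative_mult[OF s' inverse_s_der[OF x]]]
      have "((\<lambda>x. s' x * inverse (s x) / 4) has_vector_derivative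
          (s' x * - (s' x / (s x)\<^sup>2) + s'' x * inverse (s x)) / 4) (at x within {a..})" .
      from has_vector_derivative_diff[OF 
          bounded_linear.has_vector_derivative[OF bounded_linear_mult_right[of \<epsilon>] r_der[OF x]] this]
      have m: "(m \<epsilon> has_vector_derivative m') (at x within {a..})"
        unfolding m_def[abs_def] m'_def by (simp add: field_simps)
      have "(G y y' \<epsilon> has_vector_derivative
          Y \<epsilon> x * ((m \<epsilon> x * y' x + m' * y x) - s x * y x) + m \<epsilon> x * Y \<epsilon> x * (m \<epsilon> x * y x - y' x)) (at x within {a..})"
        unfolding G_def[abs_def]
        by (rule has_vector_derivative_mult[OF Y_der[OF x] 
            has_vector_derivative_diff[OF has_vector_derivative_mult[OF m solD(1)[OF y x]] solD(2)[OF y x]]])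
      moreover have "Y \<epsilon> x * ((m \<epsilon> x * y' x + m' * y x) - s x * y x) + m \<epsilon> x * Y \<epsilon> x * (m \<epsilon> x * y x - y' x)
          = \<psi> x * r x * Y \<epsilon> x * y x"
      proof -
        have ce: "csqrt (s x) = r x" by (simp add: r_def)
        have id: "m' + (m \<epsilon> x)\<^sup>2 - s x = \<psi> x * r x"
          using liouville_green_identity[OF r_nz[OF x], of \<epsilon> "s' x" "s'' x"]
          unfolding m'_def m_def \<psi>_def ce r_sq \<epsilon> diff_self mult_zero_left add_0_left .
        have "Y \<epsilon> x * ((m \<epsilon> x * y' x + m' * y x) - s x * y x) + m \<epsilon> x * Y \<epsilon> x * (m \<epsilon> x * y x - y' x)
            = (m' + (m \<epsilon> x)\<^sup>2 - s x) * Y \<epsilon> x * y x"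
          by (simp add: algebra_simps power2_eq_square)
        then show ?thesis
          unfolding id .
      qed
      ultimately show "(G y y' \<epsilon> has_vector_derivative \<psi> x * r x * Y \<epsilon> x * y x) (at x within {a..})"
        by simp
    qed
  qed
qed

lemma Re_\<zeta>: "x \<ge> a \<Longrightarrow> Re (\<zeta> x) = integral {a..x} (\<lambda>t. Re (r t))"
  using integral_linear[OF continuous_on_imp_integrable[OF r_cont order_refl] bounded_linear_Re, of x]
  by (simp add: \<zeta>_def o_def)

lemma Re_\<zeta>_mono:
  assumes "a \<le> x" "x \<le> y"
  shows "Re (\<zeta> x) \<le> Re (\<zeta> y)"
proof -
  have "continuous_on {a..} (\<lambda>t. Re (r t))"
    by (intro continuous_intros r_cont)
  then have "integral {a..x} (\<lambda>t. Re (r t)) \<le> integral {a..y} (\<lambda>t. Re (r t))"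
    using assms(2) Re_r_pos by (intro integral_subset_le continuous_on_imp_integrable) (auto intro: less_imp_le)
  then show ?thesis
    using assms by (simp add: Re_\<zeta>)
qed

section \<open>Size of the Liouville-Green functions and comparison with exact solutions\<close>

lemma norm_r: "cmod (r x) = sqrt (cmod (s x))"
  by (simp add: r_def)

lemma exp_half_Ln: "x \<ge> a \<Longrightarrow> exp (Ln (s x) / 2) = r x"
  using csqrt_exp_Ln[OF s_nz] by (simp add: r_def)

lemma YY: "x \<ge> a \<Longrightarrow> r x * (Y 1 x * Y (-1) x) = 1"
proof -
  assume x: "x \<ge> a"
  have "Y 1 x * Y (-1) x = exp (- (Ln (s x) / 2))"
    by (simp add: Y_def flip: exp_add)
  then show ?thesis
    using exp_half_Ln[OF x] r_nz[OF x] by (simp add: exp_minus)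
qed

lemma Y1_eq: "x \<ge> a \<Longrightarrow> r x * (Y 1 x)\<^sup>2 = exp (2 * \<zeta> x)"
proof -
  assume x: "x \<ge> a"
  have "(Y 1 x)\<^sup>2 * exp (Ln (s x) / 2) = exp (2 * \<zeta> x)"
    by (simp add: Y_def power2_eq_square flip: exp_add)
  then show ?thesis
    using exp_half_Ln[OF x] by (simp add: mult.commute)
qed

lemma norm_Y1: "x \<ge> a \<Longrightarrow> (cmod (Y 1 x))\<^sup>2 = g x"
  using arg_cong[OF Y1_eq, of x cmod] r_nz[of x]
  by (simp add: norm_mult norm_power g_def Re_\<zeta> norm_r field_simps s_nz)

lemma g_pos: "x \<ge> a \<Longrightarrow> 0 < g x"
  using s_nz by (simp add: g_def)

lemma Y_quot: "x \<ge> a \<Longrightarrow> Y (-1) x = exp (- 2 * \<zeta> x) * Y 1 x"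
  by (simp add: Y_def flip: exp_add)

text \<open>\<open>Y 1\<close> and \<open>Y (-1)\<close> have Y 1' Y (-1) - Y 1 Y (-1)' = 2 r Y 1 Y
  (-1) = 2, so y is recovered from its two Wronskians. Division by \<open>Y 1\<close> leaves the
  single exponential e^(-2 \<zeta>), of modulus at most 1 since Re \<zeta> is nonnegative.\<close>

lemma sol_eq:
  assumes x: "x \<ge> a"
  shows "2 * (y x / Y 1 x) = G y y' 1 x * exp (- 2 * \<zeta> x) - G y y' (-1) x"
proof -
  have "G y y' 1 x * Y (-1) x - G y y' (-1) x * Y 1 x = 2 * (r x * (Y 1 x * Y (-1) x)) * y x"
    by (simp add: G_def m_def algebra_simps)
  also have "\<dots> = 2 * y x"
    using YY[OF x] by simp
  finally show ?thesis
    unfolding Y_quot[OF x] by (simp add: field_simps)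
qed

lemma norm_\<psi>_int: "(\<lambda>x. cmod (\<psi> x)) absolutely_integrable_on {a..}"
  using absolutely_integrable_norm[OF \<psi>_int] by (simp add: o_def)

lemma \<psi>_integrable: "a \<le> b \<Longrightarrow> (\<lambda>x. cmod (\<psi> x)) integrable_on {b..X}"
  by (rule integrable_on_subinterval[OF set_lebesgue_integral_eq_integral(1)[OF norm_\<psi>_int]]) auto

lemma \<psi>_tail:
  assumes "e > 0"
  obtains b where "b \<ge> a" "\<And>X. X \<ge> b \<Longrightarrow> integral {b..X} (\<lambda>x. cmod (\<psi> x)) \<le> e"
  by (rule fin_int_tail[OF \<psi>_integrable[OF order_refl] norm_ge_zero
        absolutely_integrable_imp_fin_int[OF norm_\<psi>_int norm_ge_zero] assms]) blast

text \<open>Both Wronskians are replaced by their values at b. In the integral for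
  \<open>G y y' (-1)\<close> the factor r Y 1 Y (-1) equals 1. In the one for
  \<open>G y y' 1\<close> the factor r (Y 1)^2 equals e^(2 \<zeta>), whose modulus increases and is
  therefore compensated by e^(-2 \<zeta>) at x. Each error is at most M times the integral of
  |\<psi>|.\<close>

lemma quotient_step:
  assumes y: "sol a s y y'" and bx: "a \<le> b" "b \<le> x"
    and M: "\<And>t. t \<in> {b..x} \<Longrightarrow> cmod (y t / Y 1 t) \<le> M"
  shows "cmod (2 * (y x / Y 1 x) - (G y y' 1 b * exp (- 2 * \<zeta> x) - G y y' (-1) b))
      \<le> 2 * M * integral {b..x} (\<lambda>t. cmod (\<psi> t))"
proof -
  let ?I = "integral {b..x} (\<lambda>t. cmod (\<psi> t))"
  have x: "x \<ge> a" using bx by simp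
  have 1: "cmod (G y y' (-1) x - G y y' (-1) b) \<le> M * ?I"
  proof (rule has_integral_norm_le[OF G_has_integral[OF y _ bx] \<psi>_integrable[OF bx(1)]])
    fix t
    assume t: "t \<in> {b..x}"
    then have ta: "t \<ge> a" using bx by simp
    have "\<psi> t * r t * Y (-1) t * y t = (r t * (Y 1 t * Y (-1) t)) * (\<psi> t * (y t / Y 1 t))"
      by simp
    also have "\<dots> = \<psi> t * (y t / Y 1 t)"
      by (simp only: YY[OF ta] mult_1)
    finally have eq: "\<psi> t * r t * Y (-1) t * y t = \<psi> t * (y t / Y 1 t)" .
    show "cmod (\<psi> t * r t * Y (-1) t * y t) \<le> M * cmod (\<psi> t)"
      unfolding eq norm_mult using mult_right_mono[OF M[OF t] norm_ge_zero[of "\<psi> t"]]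
      by (subst mult.commute)
  qed simp
  have 2: "cmod (G y y' 1 x - G y y' 1 b) \<le> (exp (2 * Re (\<zeta> x)) * M) * ?I"
  proof (rule has_integral_norm_le[OF G_has_integral[OF y _ bx] \<psi>_integrable[OF bx(1)]])
    fix t
    assume t: "t \<in> {b..x}"
    then have ta: "t \<ge> a" and tx: "t \<le> x" using bx by simp_all
    have "\<psi> t * r t * Y 1 t * y t = (r t * (Y 1 t)\<^sup>2) * (\<psi> t * (y t / Y 1 t))"
      by (simp add: power2_eq_square)
    also have "\<dots> = exp (2 * \<zeta> t) * (\<psi> t * (y t / Y 1 t))"
      by (simp only: Y1_eq[OF ta])
    also have "cmod \<dots> = exp (2 * Re (\<zeta> t)) * cmod (y t / Y 1 t) * cmod (\<psi> t)"
      by (simp add: norm_mult norm_divide)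
    also have "\<dots> \<le> exp (2 * Re (\<zeta> x)) * M * cmod (\<psi> t)"
      using M[OF t] Re_\<zeta>_mono[OF ta tx] order_trans[OF norm_ge_zero M[OF t]]
      by (intro mult_mono) auto
    finally show "cmod (\<psi> t * r t * Y 1 t * y t) \<le> exp (2 * Re (\<zeta> x)) * M * cmod (\<psi> t)" .
  qed simp
  have "cmod ((G y y' 1 x - G y y' 1 b) * exp (- 2 * \<zeta> x)) 
      = cmod (G y y' 1 x - G y y' 1 b) * exp (- 2 * Re (\<zeta> x))"
    by (simp add: norm_mult)
  also have "\<dots> \<le> (exp (2 * Re (\<zeta> x)) * M) * ?I * exp (- 2 * Re (\<zeta> x))"
    using 2 by (rule mult_right_mono) simp
  also have "\<dots> = M * ?I"
    by (simp add: exp_minus field_simps)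
  finally have 3: "cmod ((G y y' 1 x - G y y' 1 b) * exp (- 2 * \<zeta> x)) \<le> M * ?I" .
  have "2 * (y x / Y 1 x) - (G y y' 1 b * exp (- 2 * \<zeta> x) - G y y' (-1) b)
      = (G y y' 1 x - G y y' 1 b) * exp (- 2 * \<zeta> x) - (G y y' (-1) x - G y y' (-1) b)"
    unfolding sol_eq[OF x, of y y'] by (simp add: algebra_simps)
  also have "cmod \<dots> \<le> M * ?I + M * ?I"
    using norm_triangle_ineq4 3 1 by (meson add_mono order_trans)
  finally show ?thesis by simp
qed

lemma quotient_cont:
  assumes y: "sol a s y y'" and "a \<le> b"
  shows "continuous_on {b..} (\<lambda>x. cmod (y x / Y 1 x))"
proof (rule continuous_on_subset[of "{a..}"])
  show "continuous_on {a..} (\<lambda>x. cmod (y x / Y 1 x))"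
    by (intro continuous_intros sol_continuous_on[OF y] has_vector_derivative_atLeast_continuous_on[OF Y_der]) auto
qed (use \<open>a \<le> b\<close> in auto)

lemma norm_sol_sq: "x \<ge> a \<Longrightarrow> (cmod (y x))\<^sup>2 = (cmod (y x / Y 1 x))\<^sup>2 * g x"
  using norm_Y1[of x] g_pos[of x] by (simp add: norm_divide power_divide)

lemma sol_upper_bound:
  assumes y: "sol a s y y'"
  shows "\<exists>C\<ge>0. \<forall>\<^sub>F x in at_top. (cmod (y x))\<^sup>2 \<le> C * g x"
proof -
  \<comment> \<open>With this tail the error for twice the quotient is at most M, which is M / 2 for
    the quotient, as \<open>le_absorb\<close> requires.\<close>
  obtain b where b: "b \<ge> a" "\<And>X. X \<ge> b \<Longrightarrow> integral {b..X} (\<lambda>x. cmod (\<psi> x)) \<le> 1 / 2"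
    using \<psi>_tail[of "1/2"] by auto
  define C where "C = (cmod (G y y' 1 b) + cmod (G y y' (-1) b)) / 2"
  have z: "cmod (y x / Y 1 x) \<le> 2 * C" if "x \<ge> b" for x
  proof (rule le_absorb[OF quotient_cont[OF y b(1)] _ that])
    fix X M x
    assume M: "\<And>t. t \<in> {b..X} \<Longrightarrow> cmod (y t / Y 1 t) \<le> M" and x: "x \<in> {b..X}"
    have "0 \<le> M"
      using M[OF x] norm_ge_zero order_trans by blast
    have step: "cmod (2 * (y x / Y 1 x) - (G y y' 1 b * exp (- 2 * \<zeta> x) - G y y' (-1) b))
      \<le> 2 * M * integral {b..x} (\<lambda>t. cmod (\<psi> t))"
      using x by (intro quotient_step y b M) auto
    have "Re (\<zeta> x) \<ge> 0"
      using Re_\<zeta>_mono[of a x] x b by (simp add: \<zeta>_def)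
    then have "cmod (G y y' 1 b * exp (- 2 * \<zeta> x)) \<le> cmod (G y y' 1 b) * 1"
      unfolding norm_mult by (intro mult_left_mono) auto
    then have "cmod (G y y' 1 b * exp (- 2 * \<zeta> x) - G y y' (-1) b) \<le> 2 * C"
      using norm_triangle_ineq4[of "G y y' 1 b * exp (- 2 * \<zeta> x)" "G y y' (-1) b"] by (simp add: C_def)
    moreover have "2 * M * integral {b..x} (\<lambda>t. cmod (\<psi> t)) \<le> 2 * M * (1 / 2)"
      using b(2)[of x] x \<open>0 \<le> M\<close> by (intro mult_left_mono) auto
    ultimately have "cmod (2 * (y x / Y 1 x)) \<le> 2 * C + M"
      using step norm_triangle_sub[of "2 * (y x / Y 1 x)" "G y y' 1 b * exp (- 2 * \<zeta> x) - G y y' (-1) b"]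
      by linarith
    then show "cmod (y x / Y 1 x) \<le> C + M / 2"
      unfolding norm_mult by simp
  qed
  have "(cmod (y x))\<^sup>2 \<le> (2 * C)\<^sup>2 * g x" if "x \<ge> b" for x
    using mult_right_mono[OF power_mono[OF z[OF that] norm_ge_zero, of 2], of "g x"]
      g_pos[of x] b(1) that norm_sol_sq[of x y] by simp
  then show ?thesis
    by (intro exI[of _ "(2 * C)\<^sup>2"] conjI eventually_at_top_linorderI[of b]) auto
qed

text \<open>A solution that agrees with \<open>Y 1\<close> to first order at b has Wronskians 0 and
  -2 there, so the quotient y / Y 1 starts at 1. With a tail of 1/4 the quotient is at most 2 by
  absorption, hence it deviates from 1 by at most 1/2 and its square modulus is at least
  1/4.\<close>

lemma growing_solution:
  obtains y y' where "sol a s y y'" "\<forall>\<^sub>F x in at_top. g x / 4 \<le> (cmod (y x))\<^sup>2"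
proof -
  obtain b where b: "b \<ge> a" "\<And>X. X \<ge> b \<Longrightarrow> integral {b..X} (\<lambda>x. cmod (\<psi> x)) \<le> 1 / 4"
    using \<psi>_tail[of "1/4"] by auto
  obtain y y' where y: "sol a s y y'" and ini: "y b = Y 1 b" "y' b = m 1 b * Y 1 b"
    using sol_exists_at[OF s_cont b(1)] .
  have G1: "G y y' 1 b = 0"
    by (simp add: G_def ini)
  have "G y y' (-1) b = - 2 * (r b * (Y 1 b * Y (-1) b))"
    by (simp add: G_def ini m_def algebra_simps)
  then have G2: "G y y' (-1) b = - 2"
    using YY[OF b(1)] by simp
  have step: "cmod (2 * (y x / Y 1 x) - 2) \<le> M / 2"
    if M: "\<And>t. t \<in> {b..x} \<Longrightarrow> cmod (y t / Y 1 t) \<le> M" and x: "b \<le> x" for x M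
  proof -
    have "0 \<le> M"
      using M[of x] x norm_ge_zero[of "y x / Y 1 x"] by (simp add: order_trans[OF norm_ge_zero])
    have "cmod (2 * (y x / Y 1 x) - 2) \<le> 2 * M * integral {b..x} (\<lambda>t. cmod (\<psi> t))"
      using quotient_step[OF y b(1) x M] by (simp add: G1 G2)
    also have "\<dots> \<le> 2 * M * (1 / 4)"
      using b(2)[OF x] \<open>0 \<le> M\<close> by (intro mult_left_mono) auto
    finally show ?thesis by simp
  qed
  have le2: "cmod (y x / Y 1 x) \<le> 2 * 1" if "x \<ge> b" for x
  proof (rule le_absorb[OF quotient_cont[OF y b(1)] _ that])
    fix X M x
    assume M: "\<And>t. t \<in> {b..X} \<Longrightarrow> cmod (y t / Y 1 t) \<le> M" and x: "x \<in> {b..X}"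
    have "0 \<le> M"
      using M[OF x] norm_ge_zero order_trans by blast
    have "cmod (2 * (y x / Y 1 x) - 2) \<le> M / 2"
      using M x by (intro step) auto
    then have "cmod (2 * (y x / Y 1 x)) \<le> 2 + M / 2"
      using norm_triangle_sub[of "2 * (y x / Y 1 x)" 2] by simp
    then have "2 * cmod (y x / Y 1 x) \<le> 2 + M / 2"
      unfolding norm_mult by simp
    with \<open>0 \<le> M\<close> show "cmod (y x / Y 1 x) \<le> 1 + M / 2"
      by linarith
  qed
  have "g x / 4 \<le> (cmod (y x))\<^sup>2" if x: "x \<ge> b" for x
  proof -
    have "cmod (2 * (y x / Y 1 x) - 2) \<le> 2 / 2"
      using le2 x by (intro step) auto
    then have "2 - cmod (2 * (y x / Y 1 x)) \<le> 1"
      using norm_triangle_ineq2[of 2 "2 * (y x / Y 1 x)"] by (simp add: norm_minus_commute)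
    then have "2 - 2 * cmod (y x / Y 1 x) \<le> 1"
      unfolding norm_mult by simp
    then have "(1 / 2)\<^sup>2 \<le> (cmod (y x / Y 1 x))\<^sup>2"
      by (intro power_mono) auto
    then have "(1 / 2)\<^sup>2 * g x \<le> (cmod (y x / Y 1 x))\<^sup>2 * g x"
      by (rule mult_right_mono) (use g_pos[of x] b x in simp)
    then show ?thesis
      using norm_sol_sq[of x y] b x by (simp add: power2_eq_square)
  qed
  then show thesis
    by (intro that[OF y] eventually_at_top_linorderI)
qed

end

section \<open>Weyl classification in terms of weights\<close>


lemma sol_init_nonzero:
  assumes v: "sol a s v v'" and nz: "v a \<noteq> 0 \<or> v' a \<noteq> 0"
  shows "\<exists>x\<ge>a. v x \<noteq> 0"
proof (rule ccontr)
  assume "\<not> (\<exists>x\<ge>a. v x \<noteq> 0)"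
  then have z: "v x = 0" if "x \<ge> a" for x
    using that by blast
  have "((\<lambda>_. 0) has_vector_derivative v' a) (at a within {a..})"
    by (rule has_vector_derivative_transform[OF _ _ solD(1)[OF v order_refl]]) (auto simp: z)
  then have "v' a = 0"
    using vector_derivative_atLeast[of "\<lambda>_. 0" "v' a" a a]
      vector_derivative_atLeast[of "\<lambda>_. 0::complex" 0 a a] by simp
  with nz z show False by blast
qed

lemma cmod_lincomb_sq_le:
  "(cmod (\<alpha> * y + \<beta> * z))\<^sup>2 \<le> 2 * (cmod \<alpha>)\<^sup>2 * (cmod y)\<^sup>2 + 2 * (cmod \<beta>)\<^sup>2 * (cmod z)\<^sup>2"
proof -
  have "(cmod (\<alpha> * y + \<beta> * z))\<^sup>2 \<le> (cmod \<alpha> * cmod y + cmod \<beta> * cmod z)\<^sup>2"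
    by (intro power_mono) (metis norm_mult norm_triangle_ineq, simp)
  also have "\<dots> \<le> 2 * (cmod \<alpha> * cmod y)\<^sup>2 + 2 * (cmod \<beta> * cmod z)\<^sup>2"
    using sum_squares_bound[of "cmod \<alpha> * cmod y" "cmod \<beta> * cmod z"] by (simp add: power2_sum)
  finally show ?thesis
    by (simp add: power_mult_distrib)
qed

lemma fin_int_scale:
  assumes "fin_int a f" "0 \<le> C"
  shows "fin_int a (\<lambda>x. C * f x)"
proof -
  obtain B where "\<And>X. X \<ge> a \<Longrightarrow> integral {a..X} f \<le> B"
    using assms(1) unfolding fin_int_def by blast
  then have "\<And>X. X \<ge> a \<Longrightarrow> integral {a..X} (\<lambda>x. C * f x) \<le> C * B"
    using assms(2) by (simp add: mult_left_mono)
  then show ?thesis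
    unfolding fin_int_def by blast
qed

lemma fin_int_lincomb:
  assumes s: "sol a s v v'" "sol a s w w'" and W: "continuous_on {a..} W" "\<And>x. x \<ge> a \<Longrightarrow> 0 \<le> W x"
    and fv: "fin_int a (\<lambda>x. W x * (cmod (v x))\<^sup>2)" and fw: "fin_int a (\<lambda>x. W x * (cmod (w x))\<^sup>2)"
  shows "fin_int a (\<lambda>x. W x * (cmod (\<alpha> * v x + \<beta> * w x))\<^sup>2)"
proof -
  note c = sol_continuous_on[OF s(1)] sol_continuous_on[OF s(2)]
  let ?h = "\<lambda>x. (2 * (cmod \<alpha>)\<^sup>2) * (W x * (cmod (v x))\<^sup>2) + (2 * (cmod \<beta>)\<^sup>2) * (W x * (cmod (w x))\<^sup>2)"
  have "fin_int a ?h"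
    by (intro fin_int_add fin_int_scale fv fw continuous_intros W c) auto
  then show ?thesis
  proof (rule fin_int_mono[where C = 1, rotated -1])
    show "\<forall>\<^sub>F x in at_top. W x * (cmod (\<alpha> * v x + \<beta> * w x))\<^sup>2 \<le> 1 * ?h x"
    proof (rule eventually_at_top_linorderI[of a])
      fix x
      assume "x \<ge> a"
      then show "W x * (cmod (\<alpha> * v x + \<beta> * w x))\<^sup>2 \<le> 1 * ?h x"
        using mult_left_mono[OF cmod_lincomb_sq_le W(2), of x \<alpha> "v x" \<beta> "w x"]
        by (simp add: algebra_simps)
    qed
    show "continuous_on {a..} ?h"
      by (intro continuous_intros W c)
    show "continuous_on {a..} (\<lambda>x. W x * (cmod (\<alpha> * v x + \<beta> * w x))\<^sup>2)"
      by (intro continuous_intros W c)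
  qed (use W(2) in auto)
qed

text \<open>If v and w had a nonzero Wronskian they would span all solutions, and then every
  solution would have a finite weighted integral. So the Wronskian vanishes and the initial data are
  proportional.\<close>

lemma weighted_sol_unique:
  assumes s: "continuous_on {a..} s" and W: "continuous_on {a..} W" "\<And>x. x \<ge> a \<Longrightarrow> 0 \<le> W x"
    and v: "sol a s v v'" and nz: "v a \<noteq> 0 \<or> v' a \<noteq> 0"
    and fv: "fin_int a (\<lambda>x. W x * (cmod (v x))\<^sup>2)" and nall: "\<not> all_fin a s W"
    and w: "sol a s w w'" and fw: "fin_int a (\<lambda>x. W x * (cmod (w x))\<^sup>2)"
  shows "\<exists>c. \<forall>x\<ge>a. w x = c * v x"
proof -
  obtain U U' V V' where f: "fundamental_system a s U U' V V'"
    using fund_exists[OF s] .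
  define D where "D = v a * w' a - v' a * w a"
  have "D = 0"
  proof (rule ccontr)
    assume D: "D \<noteq> 0"
    have "fin_int a (\<lambda>x. W x * (cmod (y x))\<^sup>2)" if y: "sol a s y y'" for y y'
    proof -
      \<comment> \<open>Cramer's rule for the initial data of \<open>y\<close> in terms of those of
        \<open>v\<close> and \<open>w\<close>.\<close>
      define \<alpha> where "\<alpha> = (y a * w' a - y' a * w a) / D"
      define \<beta> where "\<beta> = (v a * y' a - v' a * y a) / D"
      have "\<alpha> * v a + \<beta> * w a = y a * D / D" "\<alpha> * v' a + \<beta> * w' a = y' a * D / D"
        unfolding \<alpha>_def \<beta>_def times_divide_eq_left add_divide_distrib[symmetric] D_def
        by (rule arg_cong2[of _ _ _ _ "(/)"], simp_all add: algebra_simps)+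
      then have ab: "\<alpha> * v a + \<beta> * w a = y a" "\<alpha> * v' a + \<beta> * w' a = y' a"
        using D by simp_all
      have "y x = \<alpha> * v x + \<beta> * w x" if "x \<ge> a" for x
        unfolding fund_sol_eq[OF f y that] fund_sol_eq[OF f v that] fund_sol_eq[OF f w that] ab[symmetric]
        by (simp add: algebra_simps)
      then have "fin_int a (\<lambda>x. W x * (cmod (y x))\<^sup>2)
          \<longleftrightarrow> fin_int a (\<lambda>x. W x * (cmod (\<alpha> * v x + \<beta> * w x))\<^sup>2)"
        by (intro fin_int_cong) simp
      then show ?thesis
        using fin_int_lincomb[OF v w W fv fw] by simp
    qed
    then show False
      using nall by (auto simp: all_fin_def)
  qed
  define c where "c = (if v a \<noteq> 0 then w a / v a else w' a / v' a)"
  have "w a = c * v a \<and> w' a = c * v' a"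
    using \<open>D = 0\<close> nz by (auto simp: c_def D_def field_simps)
  then have "w x = c * v x" if "x \<ge> a" for x
    unfolding fund_sol_eq[OF f w that] fund_sol_eq[OF f v that] by (simp add: algebra_simps)
  then show ?thesis by blast
qed

lemma all_fin_mono:
  assumes s: "continuous_on {a..} s"
    and W: "continuous_on {a..} W" "\<And>x. x \<ge> a \<Longrightarrow> 0 \<le> W x"
    and W': "continuous_on {a..} W'" "\<And>x. x \<ge> a \<Longrightarrow> 0 \<le> W' x"
    and C: "0 \<le> C" "\<And>x. x \<ge> a \<Longrightarrow> W x \<le> C * W' x" and fin: "all_fin a s W'"
  shows "all_fin a s W"
  unfolding all_fin_def
proof (intro allI impI)
  fix y y'
  assume y: "sol a s y y'"
  have "fin_int a (\<lambda>x. W' x * (cmod (y x))\<^sup>2)"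
    using fin y by (auto simp: all_fin_def)
  then show "fin_int a (\<lambda>x. W x * (cmod (y x))\<^sup>2)"
  proof (rule fin_int_mono[rotated -1])
    show "\<forall>\<^sub>F x in at_top. W x * (cmod (y x))\<^sup>2 \<le> C * (W' x * (cmod (y x))\<^sup>2)"
    proof (rule eventually_at_top_linorderI[of a])
      fix x
      assume "x \<ge> a"
      then show "W x * (cmod (y x))\<^sup>2 \<le> C * (W' x * (cmod (y x))\<^sup>2)"
        using mult_right_mono[OF C(2), of x "(cmod (y x))\<^sup>2"] by (simp add: mult.assoc)
    qed
  qed (use C W W' sol_continuous_on[OF y] in \<open>auto intro!: continuous_intros\<close>)
qed

text \<open>The solution space is two-dimensional: if U and V were both multiples of v, then U(a) =
  1 gives v(a) \<noteq> 0, and V(a) = 0 would make V vanish identically.\<close>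

lemma only_solution_not_all:
  assumes q: "continuous_on {a..} q" and v: "only_solution_with a \<phi> q lam Pr v"
    and all: "\<And>w. solution a \<phi> q lam w \<Longrightarrow> Pr w"
  shows False
proof -
  obtain U U' V V' where f: "fundamental_system a (s_fun \<phi> q lam) U U' V V'"
    using fund_exists[OF continuous_on_s_fun[OF q]] .
  then have U: "solution a \<phi> q lam U" and V: "solution a \<phi> q lam V" and V': "sol a (s_fun \<phi> q lam) V V'"
    unfolding solution_iff_sol[OF q] fundamental_system_def by blast+
  have ex: "\<exists>c. \<forall>x\<ge>a. w x = c * v x" if "solution a \<phi> q lam w" for w
    using v that all[OF that] unfolding only_solution_with_def by blast
  obtain c where c: "\<And>x. x \<ge> a \<Longrightarrow> U x = c * v x"
    using ex[OF U] by blast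
  obtain d where d: "\<And>x. x \<ge> a \<Longrightarrow> V x = d * v x"
    using ex[OF V] by blast
  have "c * v a = 1" "d * v a = 0"
    using c[of a] d[of a] f by (simp_all add: fundamental_system_def)
  then have "d = 0" by auto
  moreover obtain x where "x \<ge> a" "V x \<noteq> 0"
    using sol_init_nonzero[OF V'] f by (auto simp: fundamental_system_def)
  ultimately show False
    using d by simp
qed

section \<open>The three cases expressed by weighted integrability of all solutions\<close>

context
  fixes a \<phi> :: real and q :: "real \<Rightarrow> complex" and \<theta> :: real and K \<mu> :: complex
  assumes q: "continuous_on {a..} q"
    and adm: "(\<theta>, K) \<in> admissible (Qset a \<phi> q)" and \<mu>: "\<mu> \<in> half_plane K \<theta>"
begin

lemma in_L2_iff: "sol a s v v' \<Longrightarrow> in_L2 a v \<longleftrightarrow> fin_int a (\<lambda>x. 1 * (cmod (v x))\<^sup>2)"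
  by (simp add: in_L2_iff_fin_int sol_continuous_on)

lemma cond_C_iff:
  "sol a s v v' \<Longrightarrow> cond_C a \<phi> q \<theta> K v \<longleftrightarrow> fin_int a (\<lambda>t. Re (cis \<theta> * lead \<phi>) * (cmod (v' t))\<^sup>2) \<and>
     fin_int a (\<lambda>t. Re (cis \<theta> * (q t - K)) * (cmod (v t))\<^sup>2) \<and> fin_int a (\<lambda>t. (cmod (v t))\<^sup>2)"
  by (rule cond_C_iff_fin_int[OF _ q admissible_nonneg(1)[OF adm] admissible_nonneg(2)[OF adm]])

lemma cond_C_imp_L2: "sol a s v v' \<Longrightarrow> cond_C a \<phi> q \<theta> K v \<Longrightarrow> in_L2 a v"
  unfolding cond_C_iff in_L2_iff by simp

lemma obtain_weyl:
  obtains v v' where "sol a (s_fun \<phi> q \<mu>) v v'" "v a \<noteq> 0 \<or> v' a \<noteq> 0" "cond_C a \<phi> q \<theta> K v"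
  using weyl_solution[OF q admissible_nonneg(1)[OF adm] admissible_nonneg(2)[OF adm] \<mu>] by blast

text \<open>The Weyl solution satisfies (C) and so lies in L^2. If some solution is outside L^2, all
  solutions in L^2 are multiples of the Weyl solution, and so are those with (C), because (C)
  implies L^2; one function thus serves both requirements of the definition.\<close>

lemma limit_point_I_iff:
  "limit_point_I a \<phi> q \<mu> \<theta> K \<longleftrightarrow> \<not> all_fin a (s_fun \<phi> q \<mu>) (\<lambda>_. 1)"
proof
  assume "limit_point_I a \<phi> q \<mu> \<theta> K"
  then obtain v where v: "only_solution_with a \<phi> q \<mu> (in_L2 a) v"
    unfolding limit_point_I_def by blast
  show "\<not> all_fin a (s_fun \<phi> q \<mu>) (\<lambda>_. 1)"
  proof
    assume "all_fin a (s_fun \<phi> q \<mu>) (\<lambda>_. 1)"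
    then have "in_L2 a w" if "solution a \<phi> q \<mu> w" for w
      using that in_L2_iff unfolding solution_iff_sol[OF q] all_fin_def by blast
    then show False
      by (rule only_solution_not_all[OF q v])
  qed
next
  assume n: "\<not> all_fin a (s_fun \<phi> q \<mu>) (\<lambda>_. 1)"
  obtain v v' where v: "sol a (s_fun \<phi> q \<mu>) v v'" "v a \<noteq> 0 \<or> v' a \<noteq> 0" "cond_C a \<phi> q \<theta> K v"
    using obtain_weyl .
  have L2: "in_L2 a v"
    by (rule cond_C_imp_L2[OF v(1,3)])
  have uniq: "\<exists>c. \<forall>x\<ge>a. w x = c * v x" if w: "solution a \<phi> q \<mu> w" "in_L2 a w" for w
  proof -
    obtain w' where w': "sol a (s_fun \<phi> q \<mu>) w w'"
      using w(1) unfolding solution_iff_sol[OF q] by blast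
    show ?thesis
      by (rule weighted_sol_unique[OF continuous_on_s_fun[OF q] _ _ v(1,2) _ n w'])
        (use L2 w(2) in_L2_iff[OF v(1)] in_L2_iff[OF w'] in auto)
  qed
  have "solution a \<phi> q \<mu> v"
    using v(1) unfolding solution_iff_sol[OF q] by blast
  moreover have "in_L2 a w" if "solution a \<phi> q \<mu> w" "cond_C a \<phi> q \<theta> K w" for w
    using that cond_C_imp_L2 unfolding solution_iff_sol[OF q] by blast
  ultimately show "limit_point_I a \<phi> q \<mu> \<theta> K"
    unfolding limit_point_I_def only_solution_with_def
    using L2 v(3) sol_init_nonzero[OF v(1,2)] uniq by blast
qed

lemma limit_circle_iff:
  "limit_circle a \<phi> q \<mu> \<theta> K \<longleftrightarrow> (\<forall>v. solution a \<phi> q \<mu> v \<longrightarrow> cond_C a \<phi> q \<theta> K v)"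
  using cond_C_imp_L2 unfolding limit_circle_def solution_iff_sol[OF q] by blast

lemma all_fin_1_iff: "(\<forall>v. solution a \<phi> q \<mu> v \<longrightarrow> in_L2 a v) \<longleftrightarrow> all_fin a (s_fun \<phi> q \<mu>) (\<lambda>_. 1)"
  unfolding solution_iff_sol[OF q] all_fin_def using in_L2_iff by blast

lemma limit_point_II_imp_all_fin:
  "limit_point_II a \<phi> q \<mu> \<theta> K \<Longrightarrow> all_fin a (s_fun \<phi> q \<mu>) (\<lambda>_. 1)"
  unfolding limit_point_II_def all_fin_1_iff by blast

lemma limit_circle_imp_all_fin: "limit_circle a \<phi> q \<mu> \<theta> K \<Longrightarrow> all_fin a (s_fun \<phi> q \<mu>) (\<lambda>_. 1)"
  unfolding all_fin_1_iff[symmetric] limit_circle_def by blast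

context
  assumes P0: "Re (cis \<theta> * lead \<phi>) = 0"
begin

text \<open>The derivative term of (C) has coefficient 0, and the two remaining terms are
  nonnegative, so they are both finite exactly when their sum is.\<close>

lemma cond_C_iff_weighted:
  assumes v: "sol a s v v'"
  shows "cond_C a \<phi> q \<theta> K v \<longleftrightarrow> fin_int a (\<lambda>t. (Re (cis \<theta> * (q t - K)) + 1) * (cmod (v t))\<^sup>2)"
    (is "_ \<longleftrightarrow> fin_int a ?h")
proof -
  note R = admissible_nonneg(2)[OF adm]
  note c = sol_continuous_on[OF v]
  have z: "fin_int a (\<lambda>t. Re (cis \<theta> * lead \<phi>) * (cmod (v' t))\<^sup>2)"
    unfolding P0 fin_int_def by auto
  have h: "continuous_on {a..} ?h"
    by (intro continuous_intros c q)
  have h0: "0 \<le> ?h x" if "x \<ge> a" for x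
    using R[OF that] by simp
  have 1: "fin_int a (\<lambda>t. Re (cis \<theta> * (q t - K)) * (cmod (v t))\<^sup>2)" if "fin_int a ?h"
  proof (rule fin_int_mono[OF _ _ h h0, where C = 1])
    show "continuous_on {a..} (\<lambda>t. Re (cis \<theta> * (q t - K)) * (cmod (v t))\<^sup>2)"
      by (intro continuous_intros c q)
    show "0 \<le> Re (cis \<theta> * (q x - K)) * (cmod (v x))\<^sup>2" if "x \<ge> a" for x
      using R[OF that] by (rule mult_nonneg_nonneg) simp
    show "\<forall>\<^sub>F x in at_top. Re (cis \<theta> * (q x - K)) * (cmod (v x))\<^sup>2 \<le> 1 * ?h x"
      by (simp add: distrib_right del: times_complex.sel)
  qed (use that in auto)
  have 2: "fin_int a (\<lambda>t. (cmod (v t))\<^sup>2)" if "fin_int a ?h"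
  proof (rule fin_int_mono[OF _ _ h h0, where C = 1])
    show "continuous_on {a..} (\<lambda>t. (cmod (v t))\<^sup>2)"
      by (intro continuous_intros c q)
    show "\<forall>\<^sub>F x in at_top. (cmod (v x))\<^sup>2 \<le> 1 * ?h x"
    proof (rule eventually_at_top_linorderI[of a])
      fix x
      assume "x \<ge> a"
      then show "(cmod (v x))\<^sup>2 \<le> 1 * ?h x"
        using mult_nonneg_nonneg[OF R zero_le_power2, of x "cmod (v x)"] 
        by (simp add: distrib_right del: times_complex.sel)
    qed
  qed (use that in auto)
  have "fin_int a ?h" if "fin_int a (\<lambda>t. Re (cis \<theta> * (q t - K)) * (cmod (v t))\<^sup>2)" "fin_int a (\<lambda>t. (cmod (v t))\<^sup>2)"
    unfolding distrib_right mult_1 by (intro fin_int_add that continuous_intros c q)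
  with 1 2 z show ?thesis
    unfolding cond_C_iff[OF v] by blast
qed

lemma limit_circle_iff_weighted:
  "limit_circle a \<phi> q \<mu> \<theta> K \<longleftrightarrow> all_fin a (s_fun \<phi> q \<mu>) (\<lambda>t. Re (cis \<theta> * (q t - K)) + 1)"
  unfolding limit_circle_iff solution_iff_sol[OF q] all_fin_def using cond_C_iff_weighted by blast

text \<open>When not every solution satisfies (C), those that do are multiples of the Weyl solution,
  which provides a nonzero one.\<close>

lemma limit_point_II_iff_weighted:
  "limit_point_II a \<phi> q \<mu> \<theta> K \<longleftrightarrow> all_fin a (s_fun \<phi> q \<mu>) (\<lambda>_. 1) \<and>
     \<not> all_fin a (s_fun \<phi> q \<mu>) (\<lambda>t. Re (cis \<theta> * (q t - K)) + 1)"
proof (intro iffI conjI)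
  assume L: "limit_point_II a \<phi> q \<mu> \<theta> K"
  then show "all_fin a (s_fun \<phi> q \<mu>) (\<lambda>_. 1)"
    by (rule limit_point_II_imp_all_fin)
  obtain v where v: "only_solution_with a \<phi> q \<mu> (cond_C a \<phi> q \<theta> K) v"
    using L unfolding limit_point_II_def by blast
  show "\<not> all_fin a (s_fun \<phi> q \<mu>) (\<lambda>t. Re (cis \<theta> * (q t - K)) + 1)"
    using only_solution_not_all[OF q v] unfolding limit_circle_iff_weighted[symmetric] limit_circle_iff
    by blast
next
  assume *: "all_fin a (s_fun \<phi> q \<mu>) (\<lambda>_. 1) \<and>
     \<not> all_fin a (s_fun \<phi> q \<mu>) (\<lambda>t. Re (cis \<theta> * (q t - K)) + 1)"
  obtain v v' where v: "sol a (s_fun \<phi> q \<mu>) v v'" "v a \<noteq> 0 \<or> v' a \<noteq> 0" "cond_C a \<phi> q \<theta> K v"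
    using obtain_weyl .
  have uniq: "\<exists>c. \<forall>x\<ge>a. w x = c * v x" if w: "solution a \<phi> q \<mu> w" "cond_C a \<phi> q \<theta> K w" for w
  proof -
    obtain w' where w': "sol a (s_fun \<phi> q \<mu>) w w'"
      using w(1) unfolding solution_iff_sol[OF q] by blast
    have W: "continuous_on {a..} (\<lambda>t. Re (cis \<theta> * (q t - K)) + 1)"
      by (intro continuous_intros q)
    have W0: "0 \<le> Re (cis \<theta> * (q t - K)) + 1" if "t \<ge> a" for t
      using admissible_nonneg(2)[OF adm that] by simp
    show ?thesis
      using weighted_sol_unique[OF continuous_on_s_fun[OF q] W W0 v(1,2) _ conjunct2[OF *] w']
        w(2) v(3) cond_C_iff_weighted[OF v(1)] cond_C_iff_weighted[OF w'] by blast
  qed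
  have "solution a \<phi> q \<mu> v"
    using v(1) unfolding solution_iff_sol[OF q] by blast
  then show "limit_point_II a \<phi> q \<mu> \<theta> K"
    unfolding limit_point_II_def only_solution_with_def all_fin_1_iff
    using * v(3) sol_init_nonzero[OF v(1,2)] uniq by blast
qed

end

end

section \<open>Integrability of the Liouville--Green amplitude\<close>


context liouville_green
begin

text \<open>This is |e^\<zeta>|^2 on [a, \<infinity>), the exponential part of \<open>g\<close>. The
  relation F' = 2 Re(r) F makes integrals of Re(r) F and of Re(r) / F explicit.\<close>

definition F where "F x = exp (2 * integral {a..x} (\<lambda>t. Re (r t)))"

lemma g_eq: "g x = F x / sqrt (cmod (s x))"
  by (simp add: g_def F_def)

lemma F_pos: "0 < F x"
  by (simp add: F_def)

lemma Re_r_cont: "continuous_on {a..} (\<lambda>t. Re (r t))"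
  by (intro continuous_intros r_cont)

lemma F_der:
  assumes x: "x \<ge> a"
  shows "(F has_real_derivative 2 * Re (r x) * F x) (at x within {a..})"
proof -
  have "((\<lambda>x. integral {a..x} (\<lambda>t. Re (r t))) has_real_derivative Re (r x)) (at x within {a..})"
    using integral_has_vector_derivative_atLeast[OF Re_r_cont x]
    by (simp only: has_real_derivative_iff_has_vector_derivative)
  from DERIV_chain2[OF DERIV_exp DERIV_cmult[OF this, of 2]] show ?thesis
    by (simp add: F_def[abs_def] mult_ac)
qed

lemma F_cont: "continuous_on {a..} F"
  using F_der by (intro has_vector_derivative_atLeast_continuous_on[where f' = "\<lambda>x. 2 * Re (r x) * F x"])
    (simp only: has_real_derivative_iff_has_vector_derivative)

lemma g_cont: "continuous_on {a..} g"
  unfolding g_eq[abs_def] by (intro continuous_intros F_cont s_cont) (use s_nz in auto)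

lemma all_fin_iff_g:
  assumes W: "continuous_on {a..} W" "\<And>x. x \<ge> a \<Longrightarrow> 0 \<le> W x"
  shows "all_fin a s W \<longleftrightarrow> fin_int a (\<lambda>x. W x * g x)"
proof
  have Wg: "continuous_on {a..} (\<lambda>x. W x * g x)" "\<And>x. x \<ge> a \<Longrightarrow> 0 \<le> W x * g x"
    using mult_nonneg_nonneg[OF W(2) less_imp_le[OF g_pos]] by (simp_all add: continuous_on_mult W g_cont)
  {
    assume A: "all_fin a s W"
    obtain y y' where y: "sol a s y y'" "\<forall>\<^sub>F x in at_top. g x / 4 \<le> (cmod (y x))\<^sup>2"
      using growing_solution .
    have "fin_int a (\<lambda>x. W x * (cmod (y x))\<^sup>2)"
      using A y(1) by (auto simp: all_fin_def)
    then show "fin_int a (\<lambda>x. W x * g x)"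
    proof (rule fin_int_mono[where C = 4, rotated -1])
      show "\<forall>\<^sub>F x in at_top. W x * g x \<le> 4 * (W x * (cmod (y x))\<^sup>2)"
        using y(2) eventually_ge_at_top[of a]
      proof eventually_elim
        case (elim x)
        show ?case
          using mult_left_mono[OF elim(1) W(2)[OF elim(2)]] by simp
      qed
    qed (use Wg W in \<open>auto intro!: continuous_intros sol_continuous_on[OF y(1)]\<close>)
  next
    assume fin: "fin_int a (\<lambda>x. W x * g x)"
    show "all_fin a s W"
      unfolding all_fin_def
    proof (intro allI impI)
      fix y y'
      assume y: "sol a s y y'"
      obtain C where C: "C \<ge> 0" "\<forall>\<^sub>F x in at_top. (cmod (y x))\<^sup>2 \<le> C * g x"
        using sol_upper_bound[OF y] by blast
      show "fin_int a (\<lambda>x. W x * (cmod (y x))\<^sup>2)"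
      proof (rule fin_int_mono[OF _ _ Wg C(1) _ fin])
        show "\<forall>\<^sub>F x in at_top. W x * (cmod (y x))\<^sup>2 \<le> C * (W x * g x)"
          using C(2) eventually_ge_at_top[of a]
        proof eventually_elim
          case (elim x)
          show ?case
            using mult_left_mono[OF elim(1) W(2)[OF elim(2)]] by (simp add: mult_ac)
        qed
      qed (use W in \<open>auto intro!: continuous_intros sol_continuous_on[OF y]\<close>)
    qed
  }
qed

lemma all_fin_1_iff_g: "all_fin a s (\<lambda>_. 1) \<longleftrightarrow> fin_int a g"
  using all_fin_iff_g[OF continuous_on_const[of _ "1::real"]] by simp

text \<open>AM-GM applied to \<open>g\<close> and the integrable function \<open>F' / F\<^sup>2\<close>, whose product is bounded below.\<close>

lemma not_fin_g:
  assumes "c > 0" and ev: "\<forall>\<^sub>F x in at_top. c * sqrt (cmod (s x)) \<le> Re (r x)"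
  shows "\<not> fin_int a g"
proof
  assume "fin_int a g"
  then obtain B where B: "\<And>X. X \<ge> a \<Longrightarrow> integral {a..X} g \<le> B"
    unfolding fin_int_def by blast
  obtain b0 where b0: "\<And>x. x \<ge> b0 \<Longrightarrow> c * sqrt (cmod (s x)) \<le> Re (r x)"
    using ev unfolding eventually_at_top_linorder by blast
  define b where "b = max a b0"
  have b: "b \<ge> a" "\<And>x. x \<ge> b \<Longrightarrow> c * sqrt (cmod (s x)) \<le> Re (r x)"
    using b0 by (auto simp: b_def)
  \<comment> \<open>With u = \<open>g x\<close> the integrand below is at least u + 2 c / u, which
    is at least 1 if u \<ge> 1 and at least 2 c if u < 1.\<close>
  define k where "k = min 1 (2 * c)"
  have "k > 0"
    using \<open>c > 0\<close> by (simp add: k_def)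
  have low: "k \<le> g x + 2 * Re (r x) / F x" if x: "x \<ge> b" for x
  proof -
    define u where "u = g x"
    have "sqrt (cmod (s x)) > 0"
      using s_nz[of x] x b(1) by simp
    then have u: "u > 0" "sqrt (cmod (s x)) / F x = 1 / u"
      using F_pos[of x] by (simp_all add: u_def g_eq)
    have "c * (sqrt (cmod (s x)) / F x) \<le> Re (r x) / F x"
      using divide_right_mono[OF b(2)[OF x] less_imp_le[OF F_pos]] by simp
    then have 1: "c / u \<le> Re (r x) / F x"
      unfolding u(2) by simp
    have "k \<le> u + 2 * (c / u)"
    proof (cases "u \<ge> 1")
      case True
      have "k \<le> 1" "0 \<le> c / u"
        using \<open>c > 0\<close> u(1) by (simp_all add: k_def)
      with True show ?thesis
        by linarith
    next
      case False
      then have "c * u \<le> c * 1"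
        using \<open>c > 0\<close> by (intro mult_left_mono) auto
      then have "c \<le> c / u"
        using u(1) by (simp add: pos_le_divide_eq)
      moreover have "k \<le> 2 * c"
        by (simp add: k_def)
      ultimately show ?thesis
        using u(1) by linarith
    qed
    then show ?thesis
      using 1 by (simp add: u_def)
  qed
  have bound: "k * (X - b) \<le> B + 1 / F b" if X: "X \<ge> b" for X
  proof -
    \<comment> \<open>The antiderivative -1 / F bounds this integral by 1 / F b for every X, whereas
      the lower bound \<open>k\<close> makes the total grow linearly.\<close>
    have I: "((\<lambda>x. 2 * Re (r x) / F x) has_integral (- (1 / F X) - (- (1 / F b)))) {b..X}"
    proof (rule fundamental_theorem_of_calculus[OF X])
      fix x
      assume "x \<in> {b..X}"
      then have x: "x \<ge> a" using b by simp
      have "((\<lambda>x. - (1 / F x)) has_real_derivative 2 * Re (r x) / F x) (at x within {a..})"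
        using DERIV_minus[OF DERIV_inverse'[OF F_der[OF x]]] F_pos[of x] by (simp add: field_simps)
      then show "((\<lambda>x. - (1 / F x)) has_vector_derivative 2 * Re (r x) / F x) (at x within {b..X})"
        unfolding has_real_derivative_iff_has_vector_derivative
        by (rule has_vector_derivative_within_subset) (use b in auto)
    qed
    have gi: "g integrable_on {b..X}"
      by (rule continuous_on_imp_integrable[OF g_cont b(1)])
    have "k * (X - b) = integral {b..X} (\<lambda>_. k)"
      using X by simp
    also have "\<dots> \<le> integral {b..X} (\<lambda>x. g x + 2 * Re (r x) / F x)"
      using low by (intro integral_le integrable_add gi has_integral_integrable[OF I]) auto
    also have "\<dots> = integral {b..X} g + (1 / F b - 1 / F X)"
      using I gi by (subst integral_add) (auto simp: has_integral_iff)
    also have "integral {b..X} g \<le> integral {a..X} g"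
      using b g_pos by (intro integral_subset_le continuous_on_imp_integrable[OF g_cont]) (auto intro: less_imp_le)
    also have "\<dots> \<le> B"
      using B X b by simp
    finally have "k * (X - b) \<le> B + (1 / F b - 1 / F X)"
      by simp
    moreover have "0 < 1 / F X"
      using F_pos by simp
    ultimately show ?thesis
      by linarith
  qed
  define X where "X = b + (\<bar>B + 1 / F b\<bar> + 1) / k"
  have "X \<ge> b"
    using \<open>k > 0\<close> by (simp add: X_def)
  from bound[OF this] \<open>k > 0\<close> show False
    by (simp add: X_def)
qed

text \<open>The left integral equals (F(X) - 1) / 2 and F(X) = e^(2 J) with J the right integral. So
  one is bounded if and only if the other is; 1 + 2 J \<le> e^(2 J) gives the bound for J without a
  logarithm.\<close>

lemma fin_Re_r_F: "fin_int a (\<lambda>x. Re (r x) * F x) \<longleftrightarrow> fin_int a (\<lambda>x. Re (r x))"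
proof -
  have I: "integral {a..X} (\<lambda>x. Re (r x) * F x) = (F X - 1) / 2" if "X \<ge> a" for X
  proof -
    have "((\<lambda>x. 2 * Re (r x) * F x) has_integral (F X - F a)) {a..X}"
    proof (rule fundamental_theorem_of_calculus[OF that])
      fix x
      assume "x \<in> {a..X}"
      then have "x \<ge> a" by simp
      from F_der[OF this, unfolded has_real_derivative_iff_has_vector_derivative]
      show "(F has_vector_derivative 2 * Re (r x) * F x) (at x within {a..X})"
        by (rule has_vector_derivative_within_subset) auto
    qed
    moreover have "F a = 1"
      by (simp add: F_def)
    ultimately have "integral {a..X} (\<lambda>x. 2 * (Re (r x) * F x)) = F X - 1"
      by (simp only: mult.assoc integral_unique)
    then show ?thesis by simp
  qed
  show ?thesis
  proof
    assume "fin_int a (\<lambda>x. Re (r x) * F x)"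
    then obtain B where B0: "\<forall>X\<ge>a. integral {a..X} (\<lambda>x. Re (r x) * F x) \<le> B"
      unfolding fin_int_def by blast
    have B: "(F X - 1) / 2 \<le> B" if "X \<ge> a" for X
      using B0[rule_format, OF that] unfolding I[OF that] .
    have "integral {a..X} (\<lambda>x. Re (r x)) \<le> B" if "X \<ge> a" for X
    proof -
      define J where "J = integral {a..X} (\<lambda>x. Re (r x))"
      have aux: "J \<le> B" if "(E - 1) / 2 \<le> B" "1 + 2 * J \<le> E" for E
        using that by (simp add: field_simps)
      have "(exp (2 * J) - 1) / 2 \<le> B"
        using B[OF that] by (simp only: F_def J_def)
      from aux[OF this exp_ge_add_one_self] show ?thesis
        by (simp only: J_def)
    qed
    then show "fin_int a (\<lambda>x. Re (r x))"
      unfolding fin_int_def by blast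
  next
    assume "fin_int a (\<lambda>x. Re (r x))"
    then obtain B where B: "\<And>X. X \<ge> a \<Longrightarrow> integral {a..X} (\<lambda>x. Re (r x)) \<le> B"
      unfolding fin_int_def by blast
    have "integral {a..X} (\<lambda>x. Re (r x) * F x) \<le> (exp (2 * B) - 1) / 2" if "X \<ge> a" for X
    proof -
      have "F X \<le> exp (2 * B)"
        using B[OF that] by (simp add: F_def)
      then show ?thesis
        unfolding I[OF that] by simp
    qed
    then show "fin_int a (\<lambda>x. Re (r x) * F x)"
      unfolding fin_int_def by blast
  qed
qed

lemma Im_s: "Im (s x) = 2 * Re (r x) * Im (r x)"
  using arg_cong[OF r_sq[of x], of Im] by (simp only: Im_power2)

section \<open>Amplitudes when the imaginary part of the root dominates\<close>

context
  assumes Im_nz: "\<And>x. x \<ge> a \<Longrightarrow> Im (r x) \<noteq> 0"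
    and Im_ev: "\<forall>\<^sub>F x in at_top. sqrt (cmod (s x)) / 2 \<le> \<bar>Im (r x)\<bar>"
begin

lemma Im_le: "\<bar>Im (r x)\<bar> \<le> sqrt (cmod (s x))"
  unfolding norm_r[symmetric] by (rule abs_Im_le_cmod)

lemma F_Im_cont: "continuous_on {a..} (\<lambda>x. F x / \<bar>Im (r x)\<bar>)"
  by (intro continuous_intros F_cont r_cont) (use Im_nz in auto)

text \<open>Since |Im r| \<le> |r| = |s|^(1/2), with at least half of it eventually, replacing
  |s|^(1/2) by |Im r| in the denominator changes the integrand by a factor of at most 2 near
  infinity.\<close>

lemma fin_g_iff: "fin_int a g \<longleftrightarrow> fin_int a (\<lambda>x. F x / \<bar>Im (r x)\<bar>)"
proof
  have F0: "0 \<le> F x / \<bar>Im (r x)\<bar>" for x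
    using F_pos[of x] by simp
  have g0: "x \<ge> a \<Longrightarrow> 0 \<le> g x" for x
    using g_pos[of x] by simp
  {
    assume "fin_int a g"
    show "fin_int a (\<lambda>x. F x / \<bar>Im (r x)\<bar>)"
    proof (rule fin_int_mono[OF F_Im_cont F0 g_cont g0 _ _ \<open>fin_int a g\<close>, where C = 2])
      show "\<forall>\<^sub>F x in at_top. F x / \<bar>Im (r x)\<bar> \<le> 2 * g x"
        using Im_ev eventually_ge_at_top[of a]
      proof eventually_elim
        case (elim x)
        have "F x / \<bar>Im (r x)\<bar> \<le> F x / (sqrt (cmod (s x)) / 2)"
          using elim F_pos[of x] s_nz[of x] Im_nz[of x] by (intro divide_left_mono mult_pos_pos) auto
        then show ?case
          by (simp add: g_eq mult.commute)
      qed
    qed auto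
  next
    assume fin: "fin_int a (\<lambda>x. F x / \<bar>Im (r x)\<bar>)"
    show "fin_int a g"
    proof (rule fin_int_mono[OF g_cont g0 F_Im_cont F0 _ _ fin, where C = 1])
      show "\<forall>\<^sub>F x in at_top. g x \<le> 1 * (F x / \<bar>Im (r x)\<bar>)"
      proof (rule eventually_at_top_linorderI[of a])
        fix x
        assume "x \<ge> a"
        then have "F x / sqrt (cmod (s x)) \<le> F x / \<bar>Im (r x)\<bar>"
          using Im_le[of x] Im_nz[of x] F_pos[of x] s_nz[of x]
            by (intro divide_left_mono mult_pos_pos) auto
        then show "g x \<le> 1 * (F x / \<bar>Im (r x)\<bar>)"
          by (simp add: g_eq)
      qed
    qed auto
  }
qed

text \<open>From |Im s| = 2 Re(r) |Im r| the quotient of the two integrands is 2 |Im r| / |s|^(1/2),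
  which never exceeds 2 and is eventually at least 1.\<close>

lemma fin_Im_s_g: "fin_int a (\<lambda>x. \<bar>Im (s x)\<bar> * g x) \<longleftrightarrow> fin_int a (\<lambda>x. Re (r x) * F x)"
proof
  have c: "continuous_on {a..} (\<lambda>x. \<bar>Im (s x)\<bar> * g x)" "continuous_on {a..} (\<lambda>x. Re (r x) * F x)"
    by (intro continuous_on_mult continuous_on_rabs continuous_on_Im continuous_on_Re s_cont g_cont r_cont F_cont)+
  have n: "0 \<le> \<bar>Im (s x)\<bar> * g x" "0 \<le> Re (r x) * F x" if "x \<ge> a" for x
    using less_imp_le[OF g_pos[OF that]] less_imp_le[OF F_pos[of x]] less_imp_le[OF Re_r_pos[OF that]]
    by simp_all
  have eq: "\<bar>Im (s x)\<bar> * g x = 2 * (Re (r x) * F x) * (\<bar>Im (r x)\<bar> / sqrt (cmod (s x)))" if "x \<ge> a" for x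
  proof -
    have "\<bar>Im (s x)\<bar> = 2 * Re (r x) * \<bar>Im (r x)\<bar>"
      unfolding Im_s abs_mult using Re_r_pos[OF that] by simp
    then show ?thesis
      unfolding g_eq by simp
  qed
  {
    assume fin: "fin_int a (\<lambda>x. \<bar>Im (s x)\<bar> * g x)"
    show "fin_int a (\<lambda>x. Re (r x) * F x)"
    proof (rule fin_int_mono[OF c(2) n(2) c(1) n(1) _ _ fin, where C = 1])
      show "\<forall>\<^sub>F x in at_top. Re (r x) * F x \<le> 1 * (\<bar>Im (s x)\<bar> * g x)"
        using Im_ev eventually_ge_at_top[of a]
      proof eventually_elim
        case (elim x)
        have "1 / 2 \<le> \<bar>Im (r x)\<bar> / sqrt (cmod (s x))"
          using elim s_nz[of x] by (simp add: pos_le_divide_eq)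
        from mult_left_mono[OF this n(2)[OF elim(2)]] show ?case
          unfolding eq[OF elim(2)] by linarith
      qed
    qed auto
  next
    assume fin: "fin_int a (\<lambda>x. Re (r x) * F x)"
    show "fin_int a (\<lambda>x. \<bar>Im (s x)\<bar> * g x)"
    proof (rule fin_int_mono[OF c(1) n(1) c(2) n(2) _ _ fin, where C = 2])
      show "\<forall>\<^sub>F x in at_top. \<bar>Im (s x)\<bar> * g x \<le> 2 * (Re (r x) * F x)"
      proof (rule eventually_at_top_linorderI[of a])
        fix x
        assume x: "x \<ge> a"
        have "\<bar>Im (r x)\<bar> / sqrt (cmod (s x)) \<le> 1"
          using Im_le[of x] s_nz[OF x] by (simp add: pos_divide_le_eq)
        from mult_left_mono[OF this n(2)[OF x]] show "\<bar>Im (s x)\<bar> * g x \<le> 2 * (Re (r x) * F x)"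
          unfolding eq[OF x] by linarith
      qed
    qed auto
  }
qed

lemma all_fin_1_iff_F: "all_fin a s (\<lambda>_. 1) \<longleftrightarrow> fin_int a (\<lambda>x. F x / \<bar>Im (r x)\<bar>)"
  unfolding all_fin_1_iff_g by (rule fin_g_iff)

lemma all_fin_Im_iff: "all_fin a s (\<lambda>x. \<bar>Im (s x)\<bar>) \<longleftrightarrow> fin_int a (\<lambda>x. Re (r x))"
  unfolding fin_Re_r_F[symmetric] fin_Im_s_g[symmetric]
  by (rule all_fin_iff_g, intro continuous_on_rabs continuous_on_Im s_cont, simp)

end

end

section \<open>Admissible angles\<close>


text \<open>The half-angle formula for the cosine. It converts limits of principal roots into limits
  of directions.\<close>

lemma Re_csqrt_ratio_sq:
  assumes "z \<noteq> 0"
  shows "(Re (csqrt z) / sqrt (cmod z))\<^sup>2 = (1 + Re z / cmod z) / 2"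
proof -
  have "0 \<le> cmod z + Re z"
    using abs_Re_le_cmod[of z] by linarith
  then show ?thesis
    using assms by (simp add: power_divide field_simps)
qed

lemma tendsto_Re_div_cmod:
  assumes "((\<lambda>x. Re (csqrt (f x)) / sqrt (cmod (f x))) \<longlongrightarrow> L) F" "\<forall>\<^sub>F x in F. f x \<noteq> 0"
  shows "((\<lambda>x. Re (f x) / cmod (f x)) \<longlongrightarrow> 2 * L\<^sup>2 - 1) F"
proof (rule Lim_transform_eventually)
  show "((\<lambda>x. 2 * (Re (csqrt (f x)) / sqrt (cmod (f x)))\<^sup>2 - 1) \<longlongrightarrow> 2 * L\<^sup>2 - 1) F"
    by (intro tendsto_intros assms)
  show "\<forall>\<^sub>F x in F. 2 * (Re (csqrt (f x)) / sqrt (cmod (f x)))\<^sup>2 - 1 = Re (f x) / cmod (f x)"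
    using assms(2)
  proof eventually_elim
    case (elim x)
    show ?case
      unfolding Re_csqrt_ratio_sq[OF elim] by (simp add: add_divide_distrib)
  qed
qed

text \<open>Dividing z - l by |z| instead of |z - l| changes it by at most |l| / |z|, and omitting l
  / |z| afterwards costs the same again.\<close>

lemma normalized_diff_le:
  fixes z l :: complex
  assumes "z \<noteq> 0"
  shows "cmod ((z - l) / cmod (z - l) - z / cmod z) \<le> 2 * cmod l / cmod z"
proof -
  have 1: "cmod ((z - l) / cmod (z - l) - (z - l) / cmod z) \<le> cmod l / cmod z"
  \<comment> \<open>For z = l both quotients are 0 and the claim is only that the bound is
    nonnegative.\<close>
  proof (cases "z = l")
    case False
    have "(z - l) / cmod (z - l) - (z - l) / cmod z
        = ((z - l) / cmod (z - l)) * of_real ((cmod z - cmod (z - l)) / cmod z)"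
      using False assms by (simp add: field_simps)
    moreover have "cmod ((z - l) / cmod (z - l)) = 1"
      using False by (simp add: norm_divide)
    ultimately have "cmod ((z - l) / cmod (z - l) - (z - l) / cmod z) = \<bar>cmod z - cmod (z - l)\<bar> / cmod z"
      by (simp only: norm_mult norm_of_real abs_divide abs_norm_cancel mult_1)
    also have "\<dots> \<le> cmod l / cmod z"
      using norm_triangle_ineq3[of z "z - l"] by (intro divide_right_mono) auto
    finally show ?thesis .
  qed simp
  have "(z - l) / cmod (z - l) - z / cmod z
      = ((z - l) / cmod (z - l) - (z - l) / cmod z) - l / cmod z"
    by (simp add: diff_divide_distrib)
  also have "cmod \<dots> \<le> cmod ((z - l) / cmod (z - l) - (z - l) / cmod z) + cmod (l / cmod z)"
    by (rule norm_triangle_ineq4)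
  also have "\<dots> \<le> cmod l / cmod z + cmod l / cmod z"
    using 1 by (intro add_mono) (auto simp: norm_divide)
  finally show ?thesis by simp
qed

lemma s_fun_cis: "s_fun \<phi> q lam x = cis (2 * \<phi>) * (q x - lam)"
  by (simp add: s_fun_def lead_def cis_inverse)

lemma cis_lead: "cis (2 * \<phi>) * lead \<phi> = 1"
  by (simp add: lead_def cis_mult)

text \<open>As |q| grows, subtracting \<open>lam\<close> no longer affects the direction, so s
  points asymptotically in the direction of q rotated by 2 \<phi>.\<close>

lemma s_fun_direction:
  assumes "filterlim (\<lambda>x. cmod (q x)) at_top at_top"
  shows "((\<lambda>x. s_fun \<phi> q lam x / cmod (s_fun \<phi> q lam x) - cis (2 * \<phi>) * (q x / cmod (q x))) \<longlongrightarrow> 0) at_top"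
proof (rule Lim_null_comparison)
  have "((\<lambda>x. 2 * cmod lam / cmod (q x)) \<longlongrightarrow> 0) at_top"
    by (rule real_tendsto_divide_at_top[OF tendsto_const assms])
  then show "((\<lambda>x. 2 * cmod lam / cmod (q x)) \<longlongrightarrow> 0) at_top" .
  show "\<forall>\<^sub>F x in at_top. cmod (s_fun \<phi> q lam x / cmod (s_fun \<phi> q lam x) - cis (2 * \<phi>) * (q x / cmod (q x)))
      \<le> 2 * cmod lam / cmod (q x)"
    using filterlim_at_top_dense[THEN iffD1, OF assms, rule_format, of 0]
  proof eventually_elim
    case (elim x)
    have "s_fun \<phi> q lam x / cmod (s_fun \<phi> q lam x) - cis (2 * \<phi>) * (q x / cmod (q x))
        = cis (2 * \<phi>) * ((q x - lam) / cmod (q x - lam) - q x / cmod (q x))"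
    proof -
      have n: "cmod (cis (2 * \<phi>) * (q x - lam)) = cmod (q x - lam)"
        by (simp add: norm_mult)
      show ?thesis
        unfolding s_fun_cis n by (simp only: right_diff_distrib times_divide_eq_right diff_divide_distrib)
    qed
    then show ?case
      using normalized_diff_le[of "q x" lam] elim by (simp add: norm_mult)
  qed
qed

text \<open>Both limits are encoded by \<open>unit_q = q / |q|\<close>: \<open>2 q\<^sub>0\<^sup>2 - 1\<close> is the limit of \<open>Re unit_q\<close> and
  \<open>2 \<sigma>\<^sup>2 - 1\<close> that of \<open>Re (e\<^bsup>2i\<phi>\<^esup> unit_q)\<close>, so \<open>\<sigma> = 0\<close> says that \<open>unit_q\<close> tends to \<open>-p\<close>.\<close>

context
  fixes \<phi> q0 \<sigma> :: real and q :: "real \<Rightarrow> complex" and lam :: complex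
  assumes \<phi>: "- (pi / 2) < \<phi>" "\<phi> < pi / 2"
    and q_inf: "filterlim (\<lambda>x. cmod (q x)) at_top at_top"
    and q0: "((\<lambda>x. Re (csqrt (q x)) / sqrt (cmod (q x))) \<longlongrightarrow> q0) at_top"
    and \<sigma>: "((\<lambda>x. Re (csqrt (s_fun \<phi> q lam x)) / sqrt (cmod (s_fun \<phi> q lam x))) \<longlongrightarrow> \<sigma>) at_top"
begin

lemma q_large: "\<forall>\<^sub>F x in at_top. c < cmod (q x)"
  using filterlim_at_top_dense[THEN iffD1, OF q_inf] by blast

lemma s_large: "\<forall>\<^sub>F x in at_top. c < cmod (s_fun \<phi> q lam x)"
  using q_large[of "c + cmod lam"]
proof eventually_elim
  case (elim x)
  then show ?case
    using norm_triangle_ineq2[of "q x" lam] by (simp add: s_fun_cis norm_mult)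
qed

definition unit_q where "unit_q x = q x / cmod (q x)"

lemma u_norm: "\<forall>\<^sub>F x in at_top. cmod (unit_q x) = 1"
  using q_large[of 0] by eventually_elim (simp add: unit_q_def norm_divide)

lemma Re_u: "((\<lambda>x. Re (unit_q x)) \<longlongrightarrow> 2 * q0\<^sup>2 - 1) at_top"
proof -
  have "\<forall>\<^sub>F x in at_top. q x \<noteq> 0"
    using q_large[of 0] by eventually_elim auto
  from tendsto_Re_div_cmod[OF q0 this] show ?thesis
    by (simp add: unit_q_def)
qed

lemma Re_cis_u: "((\<lambda>x. Re (cis (2 * \<phi>) * unit_q x)) \<longlongrightarrow> 2 * \<sigma>\<^sup>2 - 1) at_top"
proof -
  have nz: "\<forall>\<^sub>F x in at_top. s_fun \<phi> q lam x \<noteq> 0"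
    using s_large[of 0] by eventually_elim auto
  have "((\<lambda>x. Re (s_fun \<phi> q lam x) / cmod (s_fun \<phi> q lam x)
      - Re (s_fun \<phi> q lam x / cmod (s_fun \<phi> q lam x) - cis (2 * \<phi>) * unit_q x)) \<longlongrightarrow> 2 * \<sigma>\<^sup>2 - 1 - Re 0) at_top"
    unfolding unit_q_def by (intro tendsto_diff tendsto_Re_div_cmod[OF \<sigma> nz] tendsto_Re[OF s_fun_direction[OF q_inf]])
  moreover have "Re (s_fun \<phi> q lam x) / cmod (s_fun \<phi> q lam x)
      - Re (s_fun \<phi> q lam x / cmod (s_fun \<phi> q lam x) - cis (2 * \<phi>) * unit_q x) = Re (cis (2 * \<phi>) * unit_q x)" for x
    by (simp only: minus_complex.sel Re_divide_of_real)
  ultimately show ?thesis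
    by simp
qed

text \<open>The rotated direction e^(2 i \<phi>) unit_q lies on the unit circle eventually and its
  real part tends to -1, so its imaginary part tends to 0; rotating back gives the limit -p.\<close>

lemma u_tendsto:
  assumes "\<sigma> = 0"
  shows "(unit_q \<longlongrightarrow> - lead \<phi>) at_top"
proof -
  let ?w = "\<lambda>x. cis (2 * \<phi>) * unit_q x"
  have R: "((\<lambda>x. Re (?w x)) \<longlongrightarrow> - 1) at_top"
    using Re_cis_u assms by simp
  have "((\<lambda>x. sqrt (1 - (Re (?w x))\<^sup>2)) \<longlongrightarrow> sqrt (1 - (-1)\<^sup>2)) at_top"
    by (intro tendsto_intros R)
  then have "((\<lambda>x. sqrt (1 - (Re (?w x))\<^sup>2)) \<longlongrightarrow> 0) at_top"
    by simp
  moreover have "\<forall>\<^sub>F x in at_top. norm (Im (?w x)) \<le> sqrt (1 - (Re (?w x))\<^sup>2)"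
    using u_norm
  proof eventually_elim
    case (elim x)
    have "(Re (?w x))\<^sup>2 + (Im (?w x))\<^sup>2 = (cmod (?w x))\<^sup>2"
      by (rule cmod_power2[symmetric])
    also have "\<dots> = 1"
      using elim by (simp add: norm_mult)
    finally have "(Im (?w x))\<^sup>2 = 1 - (Re (?w x))\<^sup>2"
      by linarith
    then show ?case
      by (metis order_refl real_norm_def real_sqrt_abs)
  qed
  ultimately have I: "((\<lambda>x. Im (?w x)) \<longlongrightarrow> 0) at_top"
    by (rule Lim_null_comparison[rotated])
  have "(?w \<longlongrightarrow> Complex (-1) 0) at_top"
    using tendsto_Complex[OF R I] by (simp only: complex_surj)
  then have "((\<lambda>x. lead \<phi> * ?w x) \<longlongrightarrow> lead \<phi> * Complex (-1) 0) at_top"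
    by (intro tendsto_intros)
  moreover have "lead \<phi> * ?w x = unit_q x" for x
  proof -
    have "lead \<phi> * ?w x = (cis (2 * \<phi>) * lead \<phi>) * unit_q x"
      by (simp only: mult_ac)
    then show ?thesis
      by (simp only: cis_lead mult_1)
  qed
  moreover have "lead \<phi> * Complex (-1) 0 = - lead \<phi>"
    by (simp add: complex_eq_iff)
  ultimately show ?thesis
    by simp
qed

lemma Re_lead: "Re (lead \<phi>) = cos (2 * \<phi>)" and Im_lead: "Im (lead \<phi>) = - sin (2 * \<phi>)"
  by (simp_all add: lead_def)

lemma sin_sign: "\<phi> > 0 \<Longrightarrow> sin (2 * \<phi>) > 0" "\<phi> < 0 \<Longrightarrow> sin (2 * \<phi>) < 0"
  using sin_gt_zero[of "2 * \<phi>"] sin_gt_zero[of "- (2 * \<phi>)"] \<phi> by simp_all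

lemma \<phi>_Im_q: "(0 \<le> \<phi> * Im (q x)) \<longleftrightarrow> (0 \<le> \<phi> * Im (unit_q x))" if "0 < cmod (q x)"
proof -
  have "\<phi> * Im (unit_q x) = \<phi> * Im (q x) / cmod (q x)"
    by (simp add: unit_q_def)
  then show ?thesis
    using that by (simp only: zero_le_divide_iff) auto
qed

text \<open>The value of q0 fixes only the real part of the limiting direction of q, that is, the
  direction up to conjugation. The sign condition on Im q selects -p = -cos(2 \<phi>) + i sin(2
  \<phi>) rather than its conjugate, since sin(2 \<phi>) has the sign of \<phi>. The absolute value
  appears because principal roots have nonnegative real part.\<close>

lemma sigma_zero_iff:
  "\<sigma> = 0 \<longleftrightarrow> q0 = \<bar>sin \<phi>\<bar> \<and> (\<forall>\<^sub>F x in at_top. 0 \<le> \<phi> * Im (q x))"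
proof
  assume "\<sigma> = 0"
  note u = u_tendsto[OF this]
  have "((\<lambda>x. Re (unit_q x)) \<longlongrightarrow> - cos (2 * \<phi>)) at_top"
    using tendsto_Re[OF u] by (simp add: Re_lead)
  from tendsto_unique[OF trivial_limit_at_top_linorder Re_u this]
  have "2 * q0\<^sup>2 - 1 = - cos (2 * \<phi>)" .
  then have "q0\<^sup>2 = \<bar>sin \<phi>\<bar>\<^sup>2"
    using cos_double_sin[of \<phi>] by simp
  moreover have "0 \<le> q0"
  proof (rule tendsto_lowerbound[OF q0])
    show "\<forall>\<^sub>F x in at_top. 0 \<le> Re (csqrt (q x)) / sqrt (cmod (q x))"
      by (rule always_eventually, rule allI,
          rule divide_nonneg_nonneg[OF Re_csqrt real_sqrt_ge_zero[OF norm_ge_zero]])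
  qed simp
  ultimately have 1: "q0 = \<bar>sin \<phi>\<bar>"
    by (rule power2_eq_imp_eq) simp
  have "\<forall>\<^sub>F x in at_top. 0 \<le> \<phi> * Im (unit_q x)"
  proof (cases "\<phi> = 0")
    case False
    then have "0 < \<phi> * sin (2 * \<phi>)"
      using sin_sign by (cases "\<phi> > 0") (auto intro: mult_neg_neg)
    moreover have "((\<lambda>x. \<phi> * Im (unit_q x)) \<longlongrightarrow> \<phi> * sin (2 * \<phi>)) at_top"
      using tendsto_mult_left[OF tendsto_Im[OF u], of \<phi>] by (simp add: Im_lead)
    ultimately have "\<forall>\<^sub>F x in at_top. 0 < \<phi> * Im (unit_q x)"
      by (intro order_tendstoD(1))
    then show ?thesis
      by eventually_elim simp
  qed simp
  then have "\<forall>\<^sub>F x in at_top. 0 \<le> \<phi> * Im (q x)"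
    using q_large[of 0] by eventually_elim (simp only: \<phi>_Im_q)
  with 1 show "q0 = \<bar>sin \<phi>\<bar> \<and> (\<forall>\<^sub>F x in at_top. 0 \<le> \<phi> * Im (q x))" ..
next
  assume *: "q0 = \<bar>sin \<phi>\<bar> \<and> (\<forall>\<^sub>F x in at_top. 0 \<le> \<phi> * Im (q x))"
  have "2 * q0\<^sup>2 - 1 = - cos (2 * \<phi>)"
    using * cos_double_sin[of \<phi>] by simp
  then have R: "((\<lambda>x. Re (unit_q x)) \<longlongrightarrow> - cos (2 * \<phi>)) at_top"
    using Re_u by simp
  \<comment> \<open>The real part determines |Im| in the limit; multiplication by the sign of \<phi>
    recovers Im itself. For \<phi> = 0 the limit is 0 and the absolute value already
    suffices.\<close>
  define e where "e = sgn \<phi>"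
  have es: "e * \<bar>sin (2 * \<phi>)\<bar> = sin (2 * \<phi>)"
    using sin_sign by (cases "\<phi> > 0"; cases "\<phi> < 0") (auto simp: e_def)
  have "((\<lambda>x. sqrt (1 - (Re (unit_q x))\<^sup>2)) \<longlongrightarrow> sqrt (1 - (- cos (2 * \<phi>))\<^sup>2)) at_top"
    by (intro tendsto_intros R)
  moreover have "sqrt (1 - (- cos (2 * \<phi>))\<^sup>2) = \<bar>sin (2 * \<phi>)\<bar>"
    by (simp add: sin_squared_eq[symmetric])
  moreover have abs: "\<forall>\<^sub>F x in at_top. sqrt (1 - (Re (unit_q x))\<^sup>2) = \<bar>Im (unit_q x)\<bar>"
    using u_norm
  proof eventually_elim
    case (elim x)
    have "(Re (unit_q x))\<^sup>2 + (Im (unit_q x))\<^sup>2 = 1"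
      using elim cmod_power2[of "unit_q x"] by simp
    then have "1 - (Re (unit_q x))\<^sup>2 = (Im (unit_q x))\<^sup>2"
      by linarith
    then show ?case by simp
  qed
  ultimately have A: "((\<lambda>x. \<bar>Im (unit_q x)\<bar>) \<longlongrightarrow> \<bar>sin (2 * \<phi>)\<bar>) at_top"
    using Lim_transform_eventually by fastforce
  have I: "((\<lambda>x. Im (unit_q x)) \<longlongrightarrow> sin (2 * \<phi>)) at_top"
  proof (cases "\<phi> = 0")
    case True
    then show ?thesis
      using A by (simp add: tendsto_rabs_zero_iff)
  next
    case False
    have "((\<lambda>x. e * \<bar>Im (unit_q x)\<bar>) \<longlongrightarrow> sin (2 * \<phi>)) at_top"
      using tendsto_mult_left[OF A, of e] unfolding es .
    moreover have "\<forall>\<^sub>F x in at_top. e * \<bar>Im (unit_q x)\<bar> = Im (unit_q x)"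
      using conjunct2[OF *] q_large[of 0]
    proof eventually_elim
      case (elim x)
      then have "0 \<le> \<phi> * Im (unit_q x)"
        by (simp only: \<phi>_Im_q)
      then show ?case
        using False by (cases "\<phi> > 0") (auto simp: e_def zero_le_mult_iff)
    qed
    ultimately show ?thesis
      by (rule Lim_transform_eventually)
  qed
  have "((\<lambda>x. cos (2 * \<phi>) * Re (unit_q x) - sin (2 * \<phi>) * Im (unit_q x))
      \<longlongrightarrow> cos (2 * \<phi>) * - cos (2 * \<phi>) - sin (2 * \<phi>) * sin (2 * \<phi>)) at_top"
    by (intro tendsto_intros R I)
  moreover have "cos (2 * \<phi>) * - cos (2 * \<phi>) - sin (2 * \<phi>) * sin (2 * \<phi>) = - 1"
    using sin_cos_squared_add3[of "2 * \<phi>"] by linarith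
  ultimately have "((\<lambda>x. Re (cis (2 * \<phi>) * unit_q x)) \<longlongrightarrow> - 1) at_top"
    by simp
  then have "2 * \<sigma>\<^sup>2 - 1 = - 1"
    using tendsto_unique[OF trivial_limit_at_top_linorder Re_cis_u] by blast
  then show "\<sigma> = 0"
    by simp
qed

text \<open>All q(x) lie in the half plane given by (\<theta>, K). Dividing by |q(x)| removes K in
  the limit, so the limiting direction -p satisfies the same inequality as p and the real part must
  be 0.\<close>

lemma admissible_Re_zero:
  assumes "\<sigma> = 0" and adm: "(\<theta>, K) \<in> admissible (Qset a \<phi> q)"
  shows "Re (cis \<theta> * lead \<phi>) = 0"
proof (rule antisym)
  show "0 \<le> Re (cis \<theta> * lead \<phi>)"
    by (rule admissible_nonneg(1)[OF adm])
  have "((\<lambda>x. Re (cis \<theta> * unit_q x) - Re (cis \<theta> * K) / cmod (q x)) \<longlongrightarrow> Re (cis \<theta> * - lead \<phi>) - 0) at_top"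
    by (intro tendsto_intros u_tendsto[OF assms(1)] real_tendsto_divide_at_top[OF tendsto_const q_inf])
  then have "0 \<le> Re (cis \<theta> * - lead \<phi>) - 0"
  proof (rule tendsto_lowerbound)
    show "\<forall>\<^sub>F x in at_top. 0 \<le> Re (cis \<theta> * unit_q x) - Re (cis \<theta> * K) / cmod (q x)"
      using q_large[of 0] eventually_ge_at_top[of a]
    proof eventually_elim
      case (elim x)
      have "Re (cis \<theta> * unit_q x) - Re (cis \<theta> * K) / cmod (q x) = Re (cis \<theta> * (q x - K)) / cmod (q x)"
        unfolding unit_q_def times_divide_eq_right Re_divide_of_real right_diff_distrib minus_complex.sel
        by (rule diff_divide_distrib[symmetric])
      then show ?case
        using admissible_nonneg(2)[OF adm elim(2)] elim(1) by (metis divide_nonneg_pos)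
    qed
  qed simp
  then show "Re (cis \<theta> * lead \<phi>) \<le> 0"
    by simp
qed

text \<open>The angle is an arbitrary real number, so the two values are reached only modulo 2 pi;
  the parity of the zero of the cosine decides between them.\<close>

lemma admissible_angle:
  assumes "\<sigma> = 0" and adm: "(\<theta>, K) \<in> admissible (Qset a \<phi> q)"
  shows "\<exists>n::int. \<theta> = pi / 2 + 2 * \<phi> + 2 * pi * of_int n \<or> \<theta> = - (pi / 2) + 2 * \<phi> + 2 * pi * of_int n"
proof -
  have "cos (\<theta> - 2 * \<phi>) = 0"
    using admissible_Re_zero[OF assms] by (simp only: lead_def cis_mult cis.sel) simp
  then obtain n :: int where n: "\<theta> - 2 * \<phi> = of_int n * pi + pi / 2"
    unfolding cos_zero_iff_int2 by blast
  show ?thesis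
  proof (cases "even n")
    case True
    then obtain k where "n = 2 * k" ..
    with n have "\<theta> = pi / 2 + 2 * \<phi> + 2 * pi * of_int k"
      by (simp add: algebra_simps)
    then show ?thesis by blast
  next
    case False
    then obtain k where "n = 2 * k + 1" ..
    with n have "\<theta> = - (pi / 2) + 2 * \<phi> + 2 * pi * of_int (k + 1)"
      by (simp add: algebra_simps)
    then show ?thesis by blast
  qed
qed

end

text \<open>The normal is the direction from \<mu> to its nearest point K: by convexity Q lies on
  the far side of the line through K orthogonal to it, while \<mu> lies strictly on the near
  side.\<close>

lemma supporting_half_plane:
  assumes "\<mu> \<notin> Qset a \<phi> q"
  obtains \<theta> where "(\<theta>, closest_point (Qset a \<phi> q) \<mu>) \<in> admissible (Qset a \<phi> q)"
    "\<mu> \<in> half_plane (closest_point (Qset a \<phi> q) \<mu>) \<theta>"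
proof -
  let ?Q = "Qset a \<phi> q"
  define K where "K = closest_point ?Q \<mu>"
  have conv: "convex ?Q" and cl: "closed ?Q"
    by (simp_all add: Qset_def convex_closure)
  have "q a + of_real 1 * lead \<phi> \<in> ?Q"
    unfolding Qset_def by (rule subsetD[OF closure_subset], rule hull_inc) (auto intro: exI[of _ a] exI[of _ 1])
  then have "K \<in> ?Q"
    unfolding K_def using closest_point_in_set[OF cl] by blast
  define d where "d = K - \<mu>"
  have "d \<noteq> 0"
    using \<open>K \<in> ?Q\<close> assms by (auto simp: d_def)
  \<comment> \<open>For this angle the real part of \<open>cis \<theta> * w\<close> is the component
    of w along \<open>d\<close>.\<close>
  define \<theta> where "\<theta> = - Arg d"
  have cis: "cis \<theta> = cnj d / cmod d"
    using \<open>d \<noteq> 0\<close> by (simp add: \<theta>_def cis_Arg sgn_eq flip: cis_cnj)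
  have Re_eq: "Re (cis \<theta> * w) = inner d w / cmod d" for w
    by (simp add: cis inner_complex_def)
  have "(\<theta>, K) \<in> admissible ?Q"
    unfolding admissible_def
  proof (clarify)
    fix z
    assume "z \<in> ?Q"
    then have "inner (\<mu> - K) (z - K) \<le> 0"
      unfolding K_def by (rule closest_point_dot[OF conv cl])
    then have "0 \<le> inner d (z - K)"
      unfolding d_def by (simp add: inner_diff_left)
    then show "0 \<le> Re (cis \<theta> * (z - K))"
      unfolding Re_eq by simp
  qed
  moreover have "\<mu> \<in> half_plane K \<theta>"
  proof -
    have "inner d (\<mu> - K) = - (inner d d)"
      by (simp add: d_def inner_diff_right)
    also have "\<dots> < 0"
      using \<open>d \<noteq> 0\<close> by simp
    finally have "inner d (\<mu> - K) / cmod d < 0"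
      using \<open>d \<noteq> 0\<close> by (simp add: divide_neg_pos)
    then show ?thesis
      unfolding half_plane_def Re_eq[symmetric] by simp
  qed
  ultimately show thesis
    using that unfolding K_def by blast
qed

section \<open>Classification\<close>


text \<open>Meant for an integrand divided by Im r, which has a constant but unspecified sign;
  \<eta> is that sign.\<close>

lemma absolutely_integrable_iff_fin_int_signed:
  fixes h k :: "real \<Rightarrow> real"
  assumes k: "continuous_on {a..} k" "\<And>x. x \<ge> a \<Longrightarrow> 0 \<le> k x"
    and h: "\<And>x. x \<ge> a \<Longrightarrow> h x = \<eta> * k x" and \<eta>: "\<bar>\<eta>\<bar> = 1"
  shows "h absolutely_integrable_on {a..} \<longleftrightarrow> fin_int a k"
proof -
  have "h absolutely_integrable_on {a..} \<longleftrightarrow> (\<lambda>x. \<eta> * k x) absolutely_integrable_on {a..}"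
    using h by (intro set_integrable_cong) auto
  also have "\<dots> \<longleftrightarrow> k absolutely_integrable_on {a..}"
  proof
    assume "(\<lambda>x. \<eta> * k x) absolutely_integrable_on {a..}"
    then have "(\<lambda>x. \<eta> * (\<eta> * k x)) absolutely_integrable_on {a..}"
      by (rule set_integrable_mult_right)
    moreover have "\<eta> * (\<eta> * z) = z" for z
      using \<eta> by (cases "\<eta> \<ge> 0") auto
    ultimately show "k absolutely_integrable_on {a..}"
      by simp
  qed (rule set_integrable_mult_right)
  also have "\<dots> \<longleftrightarrow> fin_int a k"
    by (rule absolutely_integrable_iff_fin_int[OF k])
  finally show ?thesis .
qed

text \<open>The number e^(i theta) p has modulus 1 and real part 0, so it is i \<epsilon> with
  \<epsilon> = 1 or -1, and z = p (e^(2 i \<phi>) z).\<close>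

lemma cis_lead_Re_zero:
  assumes "Re (cis \<theta> * lead \<phi>) = 0"
  obtains \<epsilon> :: real where "\<bar>\<epsilon>\<bar> = 1" "\<And>z. Re (cis \<theta> * z) = - \<epsilon> * Im (cis (2 * \<phi>) * z)"
proof -
  define \<epsilon> where "\<epsilon> = Im (cis \<theta> * lead \<phi>)"
  have e: "cis \<theta> * lead \<phi> = Complex 0 \<epsilon>"
    using assms by (simp only: complex_eq_iff complex.sel \<epsilon>_def)
  have "cmod (cis \<theta> * lead \<phi>) = 1"
    by (simp add: norm_mult)
  then have "\<bar>\<epsilon>\<bar> = 1"
    unfolding e by (simp add: cmod_def)
  moreover have "Re (cis \<theta> * z) = - \<epsilon> * Im (cis (2 * \<phi>) * z)" for z
  proof -
    have "cis \<theta> * z = (cis \<theta> * lead \<phi>) * (cis (2 * \<phi>) * z)"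
    proof -
      have "(cis \<theta> * lead \<phi>) * (cis (2 * \<phi>) * z) = cis \<theta> * (cis (2 * \<phi>) * lead \<phi>) * z"
        by (simp only: mult_ac)
      then show ?thesis
        by (simp only: cis_lead mult_1_right)
    qed
    also have "Re \<dots> = - \<epsilon> * Im (cis (2 * \<phi>) * z)"
      unfolding e by simp
    finally show ?thesis .
  qed
  ultimately show thesis
    by (rule that)
qed

lemma all_fin_s_fun_shift:
  assumes q: "continuous_on {a..} q" and W: "continuous_on {a..} W" "\<And>x. x \<ge> a \<Longrightarrow> 0 \<le> W x"
    and L2: "all_fin a (s_fun \<phi> q lam) (\<lambda>_. 1)" and fin: "all_fin a (s_fun \<phi> q lam) W"
  shows "all_fin a (s_fun \<phi> q \<mu>) W"
proof (rule all_fin_perturb[OF continuous_on_s_fun[OF q] _ W L2 fin])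
  show "s_fun \<phi> q \<mu> x = s_fun \<phi> q lam x + inverse (lead \<phi>) * (lam - \<mu>)" for x
    by (simp add: s_fun_def algebra_simps)
qed

lemma all_fin_1_s_fun_iff:
  assumes q: "continuous_on {a..} q"
  shows "all_fin a (s_fun \<phi> q lam) (\<lambda>_. 1) \<longleftrightarrow> all_fin a (s_fun \<phi> q \<mu>) (\<lambda>_. 1)"
  using all_fin_s_fun_shift[OF q continuous_on_const, of "1::real"] by (metis zero_le_one)

text \<open>Both real parts of the rotated q - K are plus or minus Im (e^(2 i \<phi>) (q - K)). The
  first is nonnegative, so it dominates the second whichever signs occur. Replacing K by K' adds a
  constant, absorbed by the summand 1 in the weight.\<close>

lemma weights_comparable:
  assumes z: "Re (cis \<theta> * lead \<phi>) = 0" "Re (cis \<theta>' * lead \<phi>) = 0"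
    and R: "\<And>x. x \<ge> a \<Longrightarrow> 0 \<le> Re (cis \<theta> * (q x - K))" "\<And>x. x \<ge> a \<Longrightarrow> 0 \<le> Re (cis \<theta>' * (q x - K'))"
  shows "\<exists>C\<ge>0. \<forall>x\<ge>a. Re (cis \<theta>' * (q x - K')) + 1 \<le> C * (Re (cis \<theta> * (q x - K)) + 1)"
proof -
  obtain \<epsilon> where e: "\<bar>\<epsilon>\<bar> = 1" "\<And>z. Re (cis \<theta> * z) = - \<epsilon> * Im (cis (2 * \<phi>) * z)"
    using cis_lead_Re_zero[OF z(1)] by blast
  obtain \<epsilon>' where e': "\<bar>\<epsilon>'\<bar> = 1" "\<And>z. Re (cis \<theta>' * z) = - \<epsilon>' * Im (cis (2 * \<phi>) * z)"
    using cis_lead_Re_zero[OF z(2)] by blast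
  define c where "c = Re (cis \<theta>' * (K - K'))"
  have split: "Re (cis \<theta>' * (q x - K')) = Re (cis \<theta>' * (q x - K)) + c" for x
    unfolding c_def plus_complex.sel[symmetric] by (simp add: algebra_simps del: times_complex.sel plus_complex.sel)
  have same: "Re (cis \<theta>' * (q x - K)) \<le> Re (cis \<theta> * (q x - K))" if "x \<ge> a" for x
  proof -
    have "\<epsilon>' = \<epsilon> \<or> \<epsilon>' = - \<epsilon>"
      using e(1) e'(1) by linarith
    then show ?thesis
      using R(1)[OF that] unfolding e(2) e'(2) by auto
  qed
  have "Re (cis \<theta>' * (q x - K')) + 1 \<le> (1 + \<bar>c\<bar>) * (Re (cis \<theta> * (q x - K)) + 1)" if "x \<ge> a" for x
  proof -
    define w where "w = Re (cis \<theta> * (q x - K))"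
    have "w \<ge> 0"
      using R(1)[OF that] by (simp only: w_def)
    then have "w + \<bar>c\<bar> + 1 \<le> (1 + \<bar>c\<bar>) * (w + 1)"
      by (simp add: algebra_simps)
    moreover have "Re (cis \<theta>' * (q x - K')) \<le> w + \<bar>c\<bar>"
      unfolding split w_def using same[OF that] by linarith
    ultimately show ?thesis
      unfolding w_def by linarith
  qed
  then show ?thesis
    by (intro exI[of _ "1 + \<bar>c\<bar>"]) auto
qed

section \<open>The Schroedinger setting as an instance of the Liouville-Green estimates\<close>

locale wkb_setting =
  fixes a \<phi> q0 \<sigma> :: real and q q' q'' :: "real \<Rightarrow> complex" and lam :: complex
  assumes \<phi>: "- (pi / 2) < \<phi>" "\<phi> < pi / 2"
    and lam: "lam \<notin> Qset a \<phi> q"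
    and ac: "AC1_loc a q q' q''"
    and int: "(\<lambda>x. 5 * (cis (2 * \<phi>) * q' x)\<^sup>2 / (16 * csqrt (cis (2 * \<phi>) * (q x - lam)) ^ 5)
            - cis (2 * \<phi>) * q'' x / (4 * csqrt (cis (2 * \<phi>) * (q x - lam)) ^ 3))
          absolutely_integrable_on {a..}"
    and q_inf: "filterlim (\<lambda>x. cmod (q x)) at_top at_top"
    and q0: "((\<lambda>x. Re (csqrt (q x)) / sqrt (cmod (q x))) \<longlongrightarrow> q0) at_top"
    and \<sigma>: "((\<lambda>x. Re (csqrt (s_fun \<phi> q lam x)) / sqrt (cmod (s_fun \<phi> q lam x))) \<longlongrightarrow> \<sigma>) at_top"
begin

abbreviation s where "s \<equiv> s_fun \<phi> q lam"

lemma q_cont: "continuous_on {a..} q"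
  using ac has_vector_derivative_atLeast_continuous_on[of a q q'] by (simp add: AC1_loc_def)

text \<open>If s(x) = -t with t \<ge> 0 then lam = q(x) + t p, a point of the closed ray that Q
  contains. The half plane separating lam from Q treats t = 0 and t > 0 alike.\<close>

lemma s_cut:
  assumes x: "x \<ge> a"
  shows "s x \<notin> \<real>\<^sub>\<le>\<^sub>0"
proof
  assume "s x \<in> \<real>\<^sub>\<le>\<^sub>0"
  then obtain t where t: "s x = - of_real t" "t \<ge> 0"
    by (auto simp: nonpos_Reals_def elim!: nonpos_Reals_cases intro!: that[of "- _"])
  obtain \<theta> where \<theta>: "(\<theta>, closest_point (Qset a \<phi> q) lam) \<in> admissible (Qset a \<phi> q)"
    "lam \<in> half_plane (closest_point (Qset a \<phi> q) lam) \<theta>"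
    using supporting_half_plane[OF lam] .
  let ?K = "closest_point (Qset a \<phi> q) lam"
  have "lead \<phi> * s x = q x - lam"
    by (simp add: s_fun_def)
  then have "cis \<theta> * (q x - ?K) = cis \<theta> * (lam - ?K) - of_real t * (cis \<theta> * lead \<phi>)"
    unfolding t(1) by (simp add: algebra_simps)
  then have "Re (cis \<theta> * (q x - ?K)) = Re (cis \<theta> * (lam - ?K)) - t * Re (cis \<theta> * lead \<phi>)"
    by (simp only: minus_complex.sel Re_complex_of_real times_complex.sel[of "of_real t"] Im_complex_of_real mult_zero_left diff_zero)
  moreover have "0 \<le> t * Re (cis \<theta> * lead \<phi>)"
    using t(2) admissible_nonneg(1)[OF \<theta>(1)] by (rule mult_nonneg_nonneg)
  moreover have "Re (cis \<theta> * (lam - ?K)) < 0"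
    using \<theta>(2) by (simp only: half_plane_def mem_Collect_eq)
  ultimately show False
    using admissible_nonneg(2)[OF \<theta>(1) x] by linarith
qed

text \<open>Multiplication by the constant e^(2 i \<phi>) preserves the regularity of q, so s' and
  s'' are the rotated derivatives of q and \<psi> is the integrand of the hypothesis.\<close>

sublocale lg: liouville_green a s "\<lambda>x. cis (2 * \<phi>) * q' x" "\<lambda>x. cis (2 * \<phi>) * q'' x"
  "\<lambda>x. 5 * (cis (2 * \<phi>) * q' x)\<^sup>2 / (16 * csqrt (cis (2 * \<phi>) * (q x - lam)) ^ 5)
            - cis (2 * \<phi>) * q'' x / (4 * csqrt (cis (2 * \<phi>) * (q x - lam)) ^ 3)"
proof
  let ?c = "cis (2 * \<phi>)"
  have ac': "AC_loc a q" "AC_loc a q'" "\<And>x. x \<ge> a \<Longrightarrow> (q has_vector_derivative q' x) (at x within {a..})"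
    "AE x in lebesgue. x \<ge> a \<longrightarrow> (q' has_vector_derivative q'' x) (at x within {a..})"
    using ac by (auto simp: AC1_loc_def)
  have s_eq: "s = (\<lambda>x. ?c * (q x + (- lam)))"
    by (simp add: fun_eq_iff s_fun_cis)
  have "AC_loc a s"
    unfolding s_eq by (intro AC_loc_mult AC_loc_add AC_loc_const ac')
  moreover have "AC_loc a (\<lambda>x. ?c * q' x)"
    by (intro AC_loc_mult AC_loc_const ac')
  moreover have "(s has_vector_derivative ?c * q' x) (at x within {a..})" if "x \<ge> a" for x
    unfolding s_eq
    using bounded_linear.has_vector_derivative[OF bounded_linear_mult_right[of ?c]
        has_vector_derivative_add[OF ac'(3)[OF that] has_vector_derivative_const[of "- lam"]]] by simp
  moreover have "AE x in lebesgue. x \<ge> a \<longrightarrow> ((\<lambda>x. ?c * q' x) has_vector_derivative ?c * q'' x) (at x within {a..})"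
    using ac'(4)
  proof eventually_elim
    case (elim x)
    show ?case
    proof
      assume "x \<ge> a"
      with elim have "(q' has_vector_derivative q'' x) (at x within {a..})"
        by blast
      from bounded_linear.has_vector_derivative[OF bounded_linear_mult_right this]
      show "((\<lambda>x. ?c * q' x) has_vector_derivative ?c * q'' x) (at x within {a..})" .
    qed
  qed
  ultimately show "AC1_loc a s (\<lambda>x. ?c * q' x) (\<lambda>x. ?c * q'' x)"
    by (simp add: AC1_loc_def)
  show "s x \<notin> \<real>\<^sub>\<le>\<^sub>0" if "x \<ge> a" for x
    by (rule s_cut[OF that])
  show "5 * (?c * q' x)\<^sup>2 / (16 * csqrt (?c * (q x - lam)) ^ 5) - ?c * q'' x / (4 * csqrt (?c * (q x - lam)) ^ 3)
      = 5 * (?c * q' x)\<^sup>2 / (16 * csqrt (s x) ^ 5) - ?c * q'' x / (4 * csqrt (s x) ^ 3)" for x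
    unfolding s_fun_cis ..
qed (rule int)

lemma r_ratio: "((\<lambda>x. Re (lg.r x) / sqrt (cmod (s x))) \<longlongrightarrow> \<sigma>) at_top"
  using \<sigma> by (simp only: lg.r_def)

lemma sigma_nonneg: "0 \<le> \<sigma>"
proof (rule tendsto_lowerbound[OF r_ratio])
  show "\<forall>\<^sub>F x in at_top. 0 \<le> Re (lg.r x) / sqrt (cmod (s x))"
    using eventually_ge_at_top[of a]
    by eventually_elim (rule divide_nonneg_nonneg[OF less_imp_le[OF lg.Re_r_pos] real_sqrt_ge_zero[OF norm_ge_zero]])
qed simp

text \<open>Here \<sigma> is positive, so Re r is eventually at least \<sigma> / 2 times |s|^(1/2),
  the situation in which the amplitude \<open>g\<close> cannot be integrable.\<close>

lemma sigma_nonzero: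
  assumes "\<sigma> \<noteq> 0"
  shows "\<not> all_fin a s (\<lambda>_. 1)"
  unfolding lg.all_fin_1_iff_g
proof (rule lg.not_fin_g)
  show "0 < \<sigma> / 2"
    using sigma_nonneg assms by simp
  have "\<forall>\<^sub>F x in at_top. \<sigma> / 2 < Re (lg.r x) / sqrt (cmod (s x))"
    using r_ratio by (rule order_tendstoD) (use sigma_nonneg assms in simp)
  then show "\<forall>\<^sub>F x in at_top. \<sigma> / 2 * sqrt (cmod (s x)) \<le> Re (lg.r x)"
    using eventually_ge_at_top[of a]
  proof eventually_elim
    case (elim x)
    have "0 < sqrt (cmod (s x))"
      using lg.s_nz[OF elim(2)] by simp
    then show ?case
      using elim(1) by (simp only: pos_less_divide_eq less_imp_le)
  qed
qed

context
  assumes \<sigma>0: "\<sigma> = 0"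
begin

lemma admissible_Re_zero': "(\<theta>, K) \<in> admissible (Qset a \<phi> q) \<Longrightarrow> Re (cis \<theta> * lead \<phi>) = 0"
  by (rule admissible_Re_zero[OF \<phi> q_inf q0 \<sigma> \<sigma>0])

text \<open>The real part of r is eventually less than half of |r|, and |r| \<le> |Re r| + |Im r|
  leaves the other half to the imaginary part.\<close>

lemma Im_ev: "\<forall>\<^sub>F x in at_top. sqrt (cmod (s x)) / 2 \<le> \<bar>Im (lg.r x)\<bar>"
proof -
  have "\<forall>\<^sub>F x in at_top. Re (lg.r x) / sqrt (cmod (s x)) < 1 / 2"
    using r_ratio by (rule order_tendstoD) (simp add: \<sigma>0)
  then show ?thesis
    using eventually_ge_at_top[of a]
  proof eventually_elim
    case (elim x)
    define \<rho> where "\<rho> = sqrt (cmod (s x))"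
    have "0 < \<rho>"
      using lg.s_nz[OF elim(2)] by (simp add: \<rho>_def)
    then have "Re (lg.r x) < \<rho> / 2"
      using elim(1) by (simp add: \<rho>_def[symmetric] pos_divide_less_eq)
    moreover have "\<rho> \<le> \<bar>Re (lg.r x)\<bar> + \<bar>Im (lg.r x)\<bar>"
      using cmod_le[of "lg.r x"] by (simp only: \<rho>_def lg.norm_r)
    ultimately have "\<rho> / 2 \<le> \<bar>Im (lg.r x)\<bar>"
      using lg.Re_r_pos[OF elim(2)] by (simp add: field_simps)
    then show ?case
      by (simp only: \<rho>_def)
  qed
qed

text \<open>Separation of lam from Q makes Re (e^(i theta) (q - lam)) positive on the whole half
  line. This quantity is -\<epsilon> Im s, and Im s = 2 Re(r) Im(r) with Re r > 0, so Im r has the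
  sign of -\<epsilon> everywhere and not only near infinity.\<close>

lemma Im_sign:
  obtains \<eta> :: real where "\<bar>\<eta>\<bar> = 1" "\<And>x. x \<ge> a \<Longrightarrow> 0 < \<eta> * Im (lg.r x)"
proof -
  obtain \<theta> where \<theta>: "(\<theta>, closest_point (Qset a \<phi> q) lam) \<in> admissible (Qset a \<phi> q)"
    "lam \<in> half_plane (closest_point (Qset a \<phi> q) lam) \<theta>"
    using supporting_half_plane[OF lam] .
  let ?K = "closest_point (Qset a \<phi> q) lam"
  obtain \<epsilon> where e: "\<bar>\<epsilon>\<bar> = 1" "\<And>z. Re (cis \<theta> * z) = - \<epsilon> * Im (cis (2 * \<phi>) * z)"
    using cis_lead_Re_zero[OF admissible_Re_zero'[OF \<theta>(1)]] by blast
  have "0 < (- \<epsilon>) * Im (lg.r x)" if x: "x \<ge> a" for x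
  proof -
    have "Re (cis \<theta> * (q x - lam)) = Re (cis \<theta> * (q x - ?K)) - Re (cis \<theta> * (lam - ?K))"
      unfolding minus_complex.sel[symmetric] right_diff_distrib[symmetric] by simp
    moreover have "Re (cis \<theta> * (lam - ?K)) < 0"
      using \<theta>(2) by (simp only: half_plane_def mem_Collect_eq)
    ultimately have "0 < - \<epsilon> * Im (s x)"
      using admissible_nonneg(2)[OF \<theta>(1) x] unfolding e(2)[of "q x - lam"] s_fun_cis by linarith
    then have "0 < Re (lg.r x) * (2 * (- \<epsilon> * Im (lg.r x)))"
      unfolding lg.Im_s by (simp only: mult_ac)
    from zero_less_mult_pos[OF this lg.Re_r_pos[OF x]] show ?thesis
      by linarith
  qed
  with e(1) show thesis
    by (intro that[of "- \<epsilon>"]) auto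
qed

lemma Im_nz: "x \<ge> a \<Longrightarrow> Im (lg.r x) \<noteq> 0"
  using Im_sign by (metis less_irrefl mult_zero_right)

lemma Im_infinity:
  "filterlim (\<lambda>x. Im (csqrt (s x))) at_top at_top \<or> filterlim (\<lambda>x. Im (csqrt (s x))) at_bot at_top"
proof -
  obtain \<eta> where \<eta>: "\<bar>\<eta>\<bar> = 1" "\<And>x. x \<ge> a \<Longrightarrow> 0 < \<eta> * Im (lg.r x)"
    using Im_sign by blast
  have "filterlim (\<lambda>x. \<eta> * Im (lg.r x)) at_top at_top"
    unfolding filterlim_at_top
  proof
    fix Z :: real
    have "\<forall>\<^sub>F x in at_top. (2 * \<bar>Z\<bar>)\<^sup>2 < cmod (s x)"
      by (rule s_large[OF \<phi> q_inf q0 \<sigma>])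
    then show "\<forall>\<^sub>F x in at_top. Z \<le> \<eta> * Im (lg.r x)"
      using Im_ev eventually_ge_at_top[of a]
    proof eventually_elim
      case (elim x)
      have "2 * \<bar>Z\<bar> \<le> sqrt (cmod (s x))"
        using elim(1) by (intro real_le_rsqrt) simp
      then have "\<bar>Z\<bar> \<le> \<bar>Im (lg.r x)\<bar>"
        using elim(2) by simp
      also have "\<dots> = \<bar>\<eta> * Im (lg.r x)\<bar>"
        by (simp only: abs_mult \<eta>(1) mult_1)
      also have "\<dots> = \<eta> * Im (lg.r x)"
        using \<eta>(2)[OF elim(3)] by (simp only: abs_of_pos)
      finally show ?case
        by linarith
    qed
  qed
  moreover have "\<eta> = 1 \<or> \<eta> = -1"
    using \<eta>(1) by linarith
  ultimately show ?thesis
    unfolding lg.r_def by (auto simp: filterlim_uminus_at_top simp del: csqrt.sel)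
qed

lemma F_eq: "lg.F x = exp (2 * integral {a..x} (\<lambda>t. Re (csqrt (s t))))"
  unfolding lg.F_def lg.r_def ..

lemma all_fin_1_iff:
  "all_fin a s (\<lambda>_. 1) \<longleftrightarrow>
    (\<lambda>x. exp (2 * integral {a..x} (\<lambda>t. Re (csqrt (s t)))) / Im (csqrt (s x))) absolutely_integrable_on {a..}"
proof -
  obtain \<eta> where \<eta>: "\<bar>\<eta>\<bar> = 1" "\<And>x. x \<ge> a \<Longrightarrow> 0 < \<eta> * Im (lg.r x)"
    using Im_sign by blast
  have "(\<lambda>x. lg.F x / Im (lg.r x)) absolutely_integrable_on {a..} \<longleftrightarrow> fin_int a (\<lambda>x. lg.F x / \<bar>Im (lg.r x)\<bar>)"
  proof (rule absolutely_integrable_iff_fin_int_signed[OF lg.F_Im_cont[OF Im_nz Im_ev] _ _ \<eta>(1)])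
    fix x
    assume x: "x \<ge> a"
    show "0 \<le> lg.F x / \<bar>Im (lg.r x)\<bar>"
      using lg.F_pos[of x] by simp
    have "\<eta> = 1 \<or> \<eta> = -1"
      using \<eta>(1) by linarith
    then show "lg.F x / Im (lg.r x) = \<eta> * (lg.F x / \<bar>Im (lg.r x)\<bar>)"
      using \<eta>(2)[OF x] by auto
  qed
  moreover have "all_fin a s (\<lambda>_. 1) \<longleftrightarrow> fin_int a (\<lambda>x. lg.F x / \<bar>Im (lg.r x)\<bar>)"
    by (rule lg.all_fin_1_iff_F[OF Im_nz Im_ev])
  ultimately show ?thesis
    unfolding F_eq lg.r_def by blast
qed

lemma Re_iff: "(\<lambda>x. Re (csqrt (s x))) absolutely_integrable_on {a..} \<longleftrightarrow> all_fin a s (\<lambda>x. \<bar>Im (s x)\<bar>)"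
proof -
  have "all_fin a s (\<lambda>x. \<bar>Im (s x)\<bar>) \<longleftrightarrow> fin_int a (\<lambda>x. Re (lg.r x))"
    by (rule lg.all_fin_Im_iff[OF Im_nz Im_ev])
  moreover have "(\<lambda>x. Re (lg.r x)) absolutely_integrable_on {a..} \<longleftrightarrow> fin_int a (\<lambda>x. Re (lg.r x))"
    by (rule absolutely_integrable_iff_fin_int[OF lg.Re_r_cont less_imp_le[OF lg.Re_r_pos]])
  ultimately show ?thesis
    unfolding lg.r_def by blast
qed

lemma weight_cont: "continuous_on {a..} (\<lambda>x. Re (cis \<theta> * (q x - K)) + 1)"
  by (intro continuous_intros q_cont)

lemma weight_nonneg:
  "(\<theta>, K) \<in> admissible (Qset a \<phi> q) \<Longrightarrow> x \<ge> a \<Longrightarrow> 0 \<le> Re (cis \<theta> * (q x - K)) + 1"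
  using admissible_nonneg(2)[of \<theta> K a \<phi> q x] by linarith

text \<open>With R the real part in the weight and \<delta> the distance of lam from the bounding
  line, |Im s| equals R + \<delta> exactly. As R \<ge> 0 and \<delta> > 0, the functions R +
  \<delta> and R + 1 bound each other up to constants.\<close>

lemma weight_iff_Im:
  assumes adm: "(\<theta>, K) \<in> admissible (Qset a \<phi> q)" and hp: "lam \<in> half_plane K \<theta>"
  shows "all_fin a s (\<lambda>x. Re (cis \<theta> * (q x - K)) + 1) \<longleftrightarrow> all_fin a s (\<lambda>x. \<bar>Im (s x)\<bar>)"
proof -
  obtain \<epsilon> where e: "\<bar>\<epsilon>\<bar> = 1" "\<And>z. Re (cis \<theta> * z) = - \<epsilon> * Im (cis (2 * \<phi>) * z)"
    using cis_lead_Re_zero[OF admissible_Re_zero'[OF adm]] by blast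
  define \<delta> where "\<delta> = - Re (cis \<theta> * (lam - K))"
  have \<delta>: "\<delta> > 0"
    using hp by (simp only: half_plane_def mem_Collect_eq \<delta>_def)
  define R where "R x = Re (cis \<theta> * (q x - K))" for x
  have R0: "0 \<le> R x" if "x \<ge> a" for x
    using admissible_nonneg(2)[OF adm that] by (simp only: R_def)
  have Im_eq: "\<bar>Im (s x)\<bar> = R x + \<delta>" if x: "x \<ge> a" for x
  proof -
    have "R x + \<delta> = Re (cis \<theta> * (q x - lam))"
      unfolding R_def \<delta>_def diff_conv_add_uminus[symmetric] minus_complex.sel[symmetric] 
        right_diff_distrib[symmetric] by simp
    also have "\<dots> = - \<epsilon> * Im (s x)"
      unfolding e(2) s_fun_cis ..
    finally have "R x + \<delta> = - \<epsilon> * Im (s x)" .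
    then have "\<bar>R x + \<delta>\<bar> = \<bar>Im (s x)\<bar>"
      by (simp only: abs_mult abs_minus_cancel e(1) mult_1)
    then show ?thesis
      using R0[OF x] \<delta> by simp
  qed
  have cont: "continuous_on {a..} (\<lambda>x. \<bar>Im (s x)\<bar>)"
    by (intro continuous_on_rabs continuous_on_Im lg.s_cont)
  have Wc: "continuous_on {a..} (\<lambda>x. R x + 1)"
    unfolding R_def by (rule weight_cont)
  have W0: "0 \<le> R x + 1" if "x \<ge> a" for x
    using R0[OF that] by simp
  have "all_fin a s (\<lambda>x. R x + 1) \<longleftrightarrow> all_fin a s (\<lambda>x. \<bar>Im (s x)\<bar>)"
  proof
    assume fin: "all_fin a s (\<lambda>x. R x + 1)"
    show "all_fin a s (\<lambda>x. \<bar>Im (s x)\<bar>)"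
    proof (rule all_fin_mono[OF lg.s_cont cont abs_ge_zero Wc W0 _ _ fin, where C = "1 + \<delta>"])
      fix x
      assume x: "x \<ge> a"
      show "\<bar>Im (s x)\<bar> \<le> (1 + \<delta>) * (R x + 1)"
        unfolding Im_eq[OF x] using mult_nonneg_nonneg[OF less_imp_le[OF \<delta>] R0[OF x]]
        by (simp add: algebra_simps)
    qed (use \<delta> in auto)
  next
    assume fin: "all_fin a s (\<lambda>x. \<bar>Im (s x)\<bar>)"
    show "all_fin a s (\<lambda>x. R x + 1)"
    proof (rule all_fin_mono[OF lg.s_cont Wc W0 cont abs_ge_zero _ _ fin, where C = "1 + 1 / \<delta>"])
      fix x
      assume x: "x \<ge> a"
      have "0 \<le> R x / \<delta>"
        using R0[OF x] \<delta> by simp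
      moreover have "(1 + 1 / \<delta>) * (R x + \<delta>) = R x + \<delta> + R x / \<delta> + 1"
        using \<delta> by (simp add: field_simps)
      ultimately show "R x + 1 \<le> (1 + 1 / \<delta>) * \<bar>Im (s x)\<bar>"
        unfolding Im_eq[OF x] using \<delta> by linarith
    qed (use \<delta> in auto)
  qed
  then show ?thesis
    by (simp only: R_def)
qed

lemma weight_mono:
  assumes adm: "(\<theta>, K) \<in> admissible (Qset a \<phi> q)" and adm': "(\<theta>', K') \<in> admissible (Qset a \<phi> q)"
    and fin: "all_fin a (s_fun \<phi> q \<mu>) (\<lambda>x. Re (cis \<theta> * (q x - K)) + 1)"
  shows "all_fin a (s_fun \<phi> q \<mu>) (\<lambda>x. Re (cis \<theta>' * (q x - K')) + 1)"
proof -
  obtain C where C: "C \<ge> 0" "\<And>x. x \<ge> a \<Longrightarrow> Re (cis \<theta>' * (q x - K')) + 1 \<le> C * (Re (cis \<theta> * (q x - K)) + 1)"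
    using weights_comparable[OF admissible_Re_zero'[OF adm] admissible_Re_zero'[OF adm'],
        of a q K K', OF admissible_nonneg(2)[OF adm] admissible_nonneg(2)[OF adm']] by blast
  show ?thesis
    by (rule all_fin_mono[OF continuous_on_s_fun[OF q_cont] weight_cont weight_nonneg[OF adm']
        weight_cont weight_nonneg[OF adm] C(1) C(2) fin])
qed

lemma weight_imp_L2:
  assumes adm: "(\<theta>, K) \<in> admissible (Qset a \<phi> q)"
    and fin: "all_fin a (s_fun \<phi> q \<mu>) (\<lambda>x. Re (cis \<theta> * (q x - K)) + 1)"
  shows "all_fin a (s_fun \<phi> q \<mu>) (\<lambda>_. 1)"
proof (rule all_fin_mono[OF continuous_on_s_fun[OF q_cont] continuous_on_const _ weight_cont
      weight_nonneg[OF adm] _ _ fin, where C = 1])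
  show "1 \<le> 1 * (Re (cis \<theta> * (q x - K)) + 1)" if "x \<ge> a" for x
    unfolding mult_1 using admissible_nonneg(2)[OF adm that] by linarith
qed auto

text \<open>The pair is changed while the parameter stays at \<mu>. The weight is at least 1, so all
  solutions are in L^2 as well, and the perturbation result then moves the new weight from \<mu> to
  \<nu>.\<close>

lemma weight_transfer:
  assumes adm: "(\<theta>, K) \<in> admissible (Qset a \<phi> q)" and adm': "(\<theta>', K') \<in> admissible (Qset a \<phi> q)"
    and fin: "all_fin a (s_fun \<phi> q \<mu>) (\<lambda>x. Re (cis \<theta> * (q x - K)) + 1)"
  shows "all_fin a (s_fun \<phi> q \<nu>) (\<lambda>x. Re (cis \<theta>' * (q x - K')) + 1)"
  by (rule all_fin_s_fun_shift[OF q_cont weight_cont weight_nonneg[OF adm']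
        weight_imp_L2[OF adm fin] weight_mono[OF adm adm' fin]])

end

text \<open>The L^2 alternative is moved from \<mu> to lam, where the Liouville-Green criteria
  apply. The weighted alternative is kept at \<mu> with its own pair.\<close>

lemma classification:
  assumes adm: "(\<theta>, K) \<in> admissible (Qset a \<phi> q)" and \<mu>: "\<mu> \<in> half_plane K \<theta>"
  shows "limit_point_I a \<phi> q \<mu> \<theta> K \<longleftrightarrow> \<not> all_fin a s (\<lambda>_. 1)"
    and "\<sigma> \<noteq> 0 \<Longrightarrow> \<not> limit_point_II a \<phi> q \<mu> \<theta> K" "\<sigma> \<noteq> 0 \<Longrightarrow> \<not> limit_circle a \<phi> q \<mu> \<theta> K"
    and "\<sigma> = 0 \<Longrightarrow> limit_circle a \<phi> q \<mu> \<theta> K \<longleftrightarrow> all_fin a (s_fun \<phi> q \<mu>) (\<lambda>x. Re (cis \<theta> * (q x - K)) + 1)"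
    and "\<sigma> = 0 \<Longrightarrow> limit_point_II a \<phi> q \<mu> \<theta> K \<longleftrightarrow> all_fin a s (\<lambda>_. 1) \<and>
      \<not> all_fin a (s_fun \<phi> q \<mu>) (\<lambda>x. Re (cis \<theta> * (q x - K)) + 1)"
proof -
  have eq: "all_fin a (s_fun \<phi> q \<mu>) (\<lambda>_. 1) \<longleftrightarrow> all_fin a s (\<lambda>_. 1)"
    by (rule all_fin_1_s_fun_iff[OF q_cont])
  show "limit_point_I a \<phi> q \<mu> \<theta> K \<longleftrightarrow> \<not> all_fin a s (\<lambda>_. 1)"
    unfolding limit_point_I_iff[OF q_cont adm \<mu>] eq ..
  show "\<sigma> \<noteq> 0 \<Longrightarrow> \<not> limit_point_II a \<phi> q \<mu> \<theta> K"
    using limit_point_II_imp_all_fin[OF q_cont adm \<mu>] sigma_nonzero unfolding eq by blast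
  show "\<sigma> \<noteq> 0 \<Longrightarrow> \<not> limit_circle a \<phi> q \<mu> \<theta> K"
    using limit_circle_imp_all_fin[OF q_cont adm \<mu>] sigma_nonzero unfolding eq by blast
  show "\<sigma> = 0 \<Longrightarrow> limit_circle a \<phi> q \<mu> \<theta> K \<longleftrightarrow> all_fin a (s_fun \<phi> q \<mu>) (\<lambda>x. Re (cis \<theta> * (q x - K)) + 1)"
    by (rule limit_circle_iff_weighted[OF q_cont adm \<mu> admissible_Re_zero'[OF _ adm]])
  show "\<sigma> = 0 \<Longrightarrow> limit_point_II a \<phi> q \<mu> \<theta> K \<longleftrightarrow> all_fin a s (\<lambda>_. 1) \<and>
      \<not> all_fin a (s_fun \<phi> q \<mu>) (\<lambda>x. Re (cis \<theta> * (q x - K)) + 1)"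
    unfolding eq[symmetric] by (rule limit_point_II_iff_weighted[OF q_cont adm \<mu> admissible_Re_zero'[OF _ adm]])
qed

text \<open>For \<sigma> \<noteq> 0 the last two cases are excluded on both sides. For \<sigma> = 0
  the weighted alternative is transferred in both directions.\<close>

lemma classification_independent:
  assumes 1: "(\<theta>, K) \<in> admissible (Qset a \<phi> q)" "\<mu> \<in> half_plane K \<theta>"
    and 2: "(\<theta>', K') \<in> admissible (Qset a \<phi> q)" "\<nu> \<in> half_plane K' \<theta>'"
  shows "limit_point_I a \<phi> q \<mu> \<theta> K \<longleftrightarrow> limit_point_I a \<phi> q \<nu> \<theta>' K'"
    "limit_point_II a \<phi> q \<mu> \<theta> K \<longleftrightarrow> limit_point_II a \<phi> q \<nu> \<theta>' K'"
    "limit_circle a \<phi> q \<mu> \<theta> K \<longleftrightarrow> limit_circle a \<phi> q \<nu> \<theta>' K'"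
proof -
  note c = classification[OF 1] and c' = classification[OF 2]
  show "limit_point_I a \<phi> q \<mu> \<theta> K \<longleftrightarrow> limit_point_I a \<phi> q \<nu> \<theta>' K'"
    unfolding c(1) c'(1) ..
  have w: "all_fin a (s_fun \<phi> q \<mu>) (\<lambda>x. Re (cis \<theta> * (q x - K)) + 1)
      \<longleftrightarrow> all_fin a (s_fun \<phi> q \<nu>) (\<lambda>x. Re (cis \<theta>' * (q x - K')) + 1)" if "\<sigma> = 0"
    using weight_transfer[OF that 1(1) 2(1)] weight_transfer[OF that 2(1) 1(1)] by blast
  show "limit_point_II a \<phi> q \<mu> \<theta> K \<longleftrightarrow> limit_point_II a \<phi> q \<nu> \<theta>' K'"
    using c(2,5) c'(2,5) w by blast
  show "limit_circle a \<phi> q \<mu> \<theta> K \<longleftrightarrow> limit_circle a \<phi> q \<nu> \<theta>' K'"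
    using c(3,4) c'(3,4) w by blast
qed

text \<open>The supporting angle is one of the two values up to a multiple of 2 pi, and both
  requirements involve the angle only through \<open>cis\<close>, so it may be reduced.\<close>

lemma angle_exists:
  assumes "\<sigma> = 0" "\<mu> \<notin> Qset a \<phi> q"
  shows "\<exists>\<theta>\<in>{pi / 2 + 2 * \<phi>, - (pi / 2) + 2 * \<phi>}.
     (\<theta>, closest_point (Qset a \<phi> q) \<mu>) \<in> admissible (Qset a \<phi> q) \<and>
     \<mu> \<in> half_plane (closest_point (Qset a \<phi> q) \<mu>) \<theta>"
proof -
  let ?K = "closest_point (Qset a \<phi> q) \<mu>"
  obtain \<theta> where \<theta>: "(\<theta>, ?K) \<in> admissible (Qset a \<phi> q)" "\<mu> \<in> half_plane ?K \<theta>"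
    using supporting_half_plane[OF assms(2)] .
  obtain n :: int where "\<theta> = pi / 2 + 2 * \<phi> + 2 * pi * of_int n \<or> \<theta> = - (pi / 2) + 2 * \<phi> + 2 * pi * of_int n"
    using admissible_angle[OF \<phi> q_inf q0 \<sigma> assms(1) \<theta>(1)] ..
  then obtain \<theta>' where n: "\<theta> = \<theta>' + 2 * pi * of_int n"
    and \<theta>': "\<theta>' \<in> {pi / 2 + 2 * \<phi>, - (pi / 2) + 2 * \<phi>}"
    using that[of "pi / 2 + 2 * \<phi>"] that[of "- (pi / 2) + 2 * \<phi>"] by auto
  have "cis \<theta> = cis \<theta>' * cis (2 * pi * of_int n)"
    unfolding n by (rule cis_mult[symmetric])
  also have "cis (2 * pi * of_int n) = 1"
    by (rule cis_multiple_2pi) simp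
  finally have eq: "cis \<theta> = cis \<theta>'"
    by simp
  have "(\<theta>', ?K) \<in> admissible (Qset a \<phi> q)"
    using \<theta>(1) by (simp only: admissible_def mem_Collect_eq prod.case eq)
  moreover have "\<mu> \<in> half_plane ?K \<theta>'"
    using \<theta>(2) by (simp only: half_plane_def mem_Collect_eq eq)
  ultimately show ?thesis
    using \<theta>' by (intro bexI[of _ \<theta>'] conjI)
qed

end

theorem theorem5p4:
  fixes a \<phi> q0 \<sigma> :: real and q q' q'' :: "real \<Rightarrow> complex" and lam :: complex
    and Q :: "complex set" and s :: "real \<Rightarrow> complex"
  assumes "0 \<le> a"
    and "- (pi / 2) < \<phi>" and "\<phi> < pi / 2"
    and "Q = Qset a \<phi> q"
    and "lam \<notin> Q"
    and "AC1_loc a q q' q''"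
    and "(\<lambda>x. 5 * (cis (2 * \<phi>) * q' x)\<^sup>2 / (16 * csqrt (cis (2 * \<phi>) * (q x - lam)) ^ 5)
            - cis (2 * \<phi>) * q'' x / (4 * csqrt (cis (2 * \<phi>) * (q x - lam)) ^ 3))
          absolutely_integrable_on {a..}"
    and "s = s_fun \<phi> q lam"
    and "filterlim (\<lambda>x. cmod (q x)) at_top at_top"
    and "((\<lambda>x. Re (csqrt (q x)) / sqrt (cmod (q x))) \<longlongrightarrow> q0) at_top"
    and "((\<lambda>x. Re (csqrt (s x)) / sqrt (cmod (s x))) \<longlongrightarrow> \<sigma>) at_top"
  shows
    "(\<sigma> = 0 \<longleftrightarrow> q0 = \<bar>sin \<phi>\<bar> \<and> (\<forall>\<^sub>F x in at_top. 0 \<le> \<phi> * Im (q x)))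
   \<and> (\<sigma> = 0 \<longrightarrow>
        (filterlim (\<lambda>x. Im (csqrt (s x))) at_top at_top
         \<or> filterlim (\<lambda>x. Im (csqrt (s x))) at_bot at_top)
      \<and> (\<forall>\<mu>. \<mu> \<notin> Q \<longrightarrow>
           (\<forall>\<theta>. (\<theta>, closest_point Q \<mu>) \<in> admissible Q \<longrightarrow>
              (\<exists>n::int. \<theta> = pi / 2 + 2 * \<phi> + 2 * pi * of_int n
                     \<or> \<theta> = - (pi / 2) + 2 * \<phi> + 2 * pi * of_int n))
         \<and> (\<exists>\<theta>\<in>{pi / 2 + 2 * \<phi>, - (pi / 2) + 2 * \<phi>}.
              (\<theta>, closest_point Q \<mu>) \<in> admissible Q
              \<and> \<mu> \<in> half_plane (closest_point Q \<mu>) \<theta>)))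
   \<and> (\<forall>\<theta> K. (\<theta>, K) \<in> admissible Q \<and> lam \<in> half_plane K \<theta> \<longrightarrow>
        (\<sigma> \<noteq> 0 \<longrightarrow> limit_point_I a \<phi> q lam \<theta> K)
      \<and> (\<sigma> = 0
          \<and> \<not> (\<lambda>x. exp (2 * integral {a..x} (\<lambda>t. Re (csqrt (s t)))) / Im (csqrt (s x)))
                absolutely_integrable_on {a..}
          \<longrightarrow> limit_point_I a \<phi> q lam \<theta> K)
      \<and> (\<sigma> = 0
          \<and> \<not> (\<lambda>x. Re (csqrt (s x))) absolutely_integrable_on {a..}
          \<and> (\<lambda>x. exp (2 * integral {a..x} (\<lambda>t. Re (csqrt (s t)))) / Im (csqrt (s x)))
                absolutely_integrable_on {a..}
          \<longrightarrow> limit_point_II a \<phi> q lam \<theta> K)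
      \<and> (\<sigma> = 0
          \<and> (\<lambda>x. Re (csqrt (s x))) absolutely_integrable_on {a..}
          \<and> (\<lambda>x. inverse (Im (csqrt (s x)))) absolutely_integrable_on {a..}
          \<longrightarrow> limit_circle a \<phi> q lam \<theta> K))
   \<and> (\<forall>\<theta> K \<mu> \<theta>' K'.
        (\<theta>, K) \<in> admissible Q \<and> lam \<in> half_plane K \<theta>
        \<and> (\<theta>', K') \<in> admissible Q \<and> \<mu> \<in> half_plane K' \<theta>' \<longrightarrow>
        (limit_point_I a \<phi> q lam \<theta> K \<longleftrightarrow> limit_point_I a \<phi> q \<mu> \<theta>' K')
      \<and> (limit_point_II a \<phi> q lam \<theta> K \<longleftrightarrow> limit_point_II a \<phi> q \<mu> \<theta>' K')
      \<and> (limit_circle a \<phi> q lam \<theta> K \<longleftrightarrow> limit_circle a \<phi> q \<mu> \<theta>' K'))"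
proof -
  interpret wkb_setting a \<phi> q0 \<sigma> q q' q'' lam
    using assms by unfold_locales simp_all
  have s: "s = s_fun \<phi> q lam" and Q: "Q = Qset a \<phi> q"
    by fact+
  show ?thesis
    unfolding s Q
  proof (intro conjI allI impI; (elim conjE)?)
    show "\<sigma> = 0 \<longleftrightarrow> q0 = \<bar>sin \<phi>\<bar> \<and> (\<forall>\<^sub>F x in at_top. 0 \<le> \<phi> * Im (q x))"
      by (rule sigma_zero_iff[OF \<phi> q_inf q0 \<sigma>])
  next
    assume "\<sigma> = 0"
    then show "filterlim (\<lambda>x. Im (csqrt (s_fun \<phi> q lam x))) at_top at_top
        \<or> filterlim (\<lambda>x. Im (csqrt (s_fun \<phi> q lam x))) at_bot at_top"
      by (rule Im_infinity)
  next
    fix \<mu> \<theta>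
    assume "\<sigma> = 0" "(\<theta>, closest_point (Qset a \<phi> q) \<mu>) \<in> admissible (Qset a \<phi> q)"
    then show "\<exists>n::int. \<theta> = pi / 2 + 2 * \<phi> + 2 * pi * of_int n
        \<or> \<theta> = - (pi / 2) + 2 * \<phi> + 2 * pi * of_int n"
      by (rule admissible_angle[OF \<phi> q_inf q0 \<sigma>])
  next
    fix \<mu>
    assume "\<sigma> = 0" "\<mu> \<notin> Qset a \<phi> q"
    then show "\<exists>\<theta>\<in>{pi / 2 + 2 * \<phi>, - (pi / 2) + 2 * \<phi>}.
        (\<theta>, closest_point (Qset a \<phi> q) \<mu>) \<in> admissible (Qset a \<phi> q)
        \<and> \<mu> \<in> half_plane (closest_point (Qset a \<phi> q) \<mu>) \<theta>"
      by (rule angle_exists)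
  next
    fix \<theta> K
    assume A: "(\<theta>, K) \<in> admissible (Qset a \<phi> q)" "lam \<in> half_plane K \<theta>"
    note c = classification[OF A]
    {
      assume "\<sigma> \<noteq> 0"
      then show "limit_point_I a \<phi> q lam \<theta> K"
        unfolding c(1) by (rule sigma_nonzero)
    next
      assume "\<sigma> = 0" "\<not> (\<lambda>x. exp (2 * integral {a..x} (\<lambda>t. Re (csqrt (s_fun \<phi> q lam t))))
          / Im (csqrt (s_fun \<phi> q lam x))) absolutely_integrable_on {a..}"
      then show "limit_point_I a \<phi> q lam \<theta> K"
        unfolding c(1) by (simp only: all_fin_1_iff not_False_eq_True)
    next
      assume *: "\<sigma> = 0" "\<not> (\<lambda>x. Re (csqrt (s_fun \<phi> q lam x))) absolutely_integrable_on {a..}"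
        "(\<lambda>x. exp (2 * integral {a..x} (\<lambda>t. Re (csqrt (s_fun \<phi> q lam t))))
          / Im (csqrt (s_fun \<phi> q lam x))) absolutely_integrable_on {a..}"
      \<comment> \<open>Integrability of the quotient places all solutions in L^2; failure of
        integrability of the real part denies finiteness for the weight |Im s|, hence (C), to some
        solution.\<close>
      then show "limit_point_II a \<phi> q lam \<theta> K"
        using c(5)[OF *(1)] all_fin_1_iff[OF *(1)] Re_iff[OF *(1)] weight_iff_Im[OF *(1) A] by blast
    next
      assume *: "\<sigma> = 0" "(\<lambda>x. Re (csqrt (s_fun \<phi> q lam x))) absolutely_integrable_on {a..}"
      \<comment> \<open>Integrability of the real part of the root makes all solutions square
        integrable for the weight |Im s|, and this weight is comparable to the one that expresses
        (C).\<close>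
      then show "limit_circle a \<phi> q lam \<theta> K"
        using c(4)[OF *(1)] Re_iff[OF *(1)] weight_iff_Im[OF *(1) A] by blast
    }
  next
    fix \<theta> K \<mu> \<theta>' K'
    assume A: "(\<theta>, K) \<in> admissible (Qset a \<phi> q)" "lam \<in> half_plane K \<theta>"
      "(\<theta>', K') \<in> admissible (Qset a \<phi> q)" "\<mu> \<in> half_plane K' \<theta>'"
    note i = classification_independent[OF A]
    show "limit_point_I a \<phi> q lam \<theta> K \<longleftrightarrow> limit_point_I a \<phi> q \<mu> \<theta>' K'"
      "limit_point_II a \<phi> q lam \<theta> K \<longleftrightarrow> limit_point_II a \<phi> q \<mu> \<theta>' K'"
      "limit_circle a \<phi> q lam \<theta> K \<longleftrightarrow> limit_circle a \<phi> q \<mu> \<theta>' K'"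
      by (fact i)+
  qed
qed

end
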